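(* Let $d\geq 4$ be an integer. For every integer $k$ with $2\leq k\leq d-3$ (a vacuous condition when $d=4$) we have $\beta_{k,d}=d-2$. Moreover, $2\leq \beta_{1,d}\leq d-2$; in particular $\beta_{1,4}=2$.
   Context: A vertex of a $d$-polytope is called nonsimple if the number of edges incident to it is more than $d$, and simple otherwise. For $0\le k\le d-1$, the $k$-skeleton of a polytope is the restriction of its face lattice to the faces of dimension at most $k$ (so the $1$-skeleton is the graph). A $d$-polytope $P$ is reconstructible from its $k$-skeleton if its $k$-skeleton determines its entire face lattice, i.e. every $d$-polytope whose $k$-skeleton is isomorphic to that of $P$ is combinatorially isomorphic to $P$. For $1\leq k\leq d-3$, $\beta_{k,d}$ denotes the maximum number $j$ such that every $d$-polytope with at most $j$ nonsimple vertices is reconstructible from its $k$-skeleton. *)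

theory Defs
  imports "HOL-Analysis.Analysis"
begin

definition d_polytope :: "nat \<Rightarrow> 'a::euclidean_space set \<Rightarrow> bool"
  where "d_polytope d P \<longleftrightarrow> polytope P \<and> aff_dim P = int d"

definition faces :: "'a::euclidean_space set \<Rightarrow> 'a set set"
  where "faces P = {F. F face_of P}"

(* As in the face lattice, the empty face (of dimension -1) belongs to every skeleton. *)
definition skeleton :: "nat \<Rightarrow> 'a::euclidean_space set \<Rightarrow> 'a set set"
  where "skeleton k P = {F \<in> faces P. aff_dim F \<le> int k}"

(* Isomorphism of two families of sets, both ordered by inclusion.  For face lattices this is
   lattice isomorphism, since meets and joins are determined by the order. *)
definition inclusion_isomorphic :: "'a set set \<Rightarrow> 'b set set \<Rightarrow> bool"
  where "inclusion_isomorphic \<A> \<B> \<longleftrightarrow>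
    (\<exists>f. bij_betw f \<A> \<B> \<and> (\<forall>X\<in>\<A>. \<forall>Y\<in>\<A>. X \<subseteq> Y \<longleftrightarrow> f X \<subseteq> f Y))"

definition combinatorially_isomorphic :: "'a::euclidean_space set \<Rightarrow> 'b::euclidean_space set \<Rightarrow> bool"
  where "combinatorially_isomorphic P Q \<longleftrightarrow> inclusion_isomorphic (faces P) (faces Q)"

definition nonsimple_vertices :: "nat \<Rightarrow> 'a::euclidean_space set \<Rightarrow> 'a set"
  where "nonsimple_vertices d P = {v. v extreme_point_of P \<and> card {e. e edge_of P \<and> v \<in> e} > d}"

definition reconstructible :: "nat \<Rightarrow> nat \<Rightarrow> 'a::euclidean_space set \<Rightarrow> bool"
  where "reconstructible k d P \<longleftrightarrow>
    (\<forall>Q::'a set. d_polytope d Q \<and> inclusion_isomorphic (skeleton k P) (skeleton k Q)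
       \<longrightarrow> combinatorially_isomorphic P Q)"

(* The type argument is the ambient space, in which d-polytopes need not be full-dimensional.
   As soon as it has dimension at least d, it contains d-polytopes of every combinatorial type. *)
definition all_reconstructible :: "'a::euclidean_space itself \<Rightarrow> nat \<Rightarrow> nat \<Rightarrow> nat \<Rightarrow> bool"
  where "all_reconstructible _ k d j \<longleftrightarrow>
    (\<forall>P::'a set. d_polytope d P \<and> card (nonsimple_vertices d P) \<le> j \<longrightarrow> reconstructible k d P)"

definition beta :: "'a::euclidean_space itself \<Rightarrow> nat \<Rightarrow> nat \<Rightarrow> nat"
  where "beta T k d = (GREATEST j. all_reconstructible T k d j)"

(* GREATEST is unspecified when there is no greatest element; this says that the maximum
   named by beta exists. *)
definition beta_exists :: "'a::euclidean_space itself \<Rightarrow> nat \<Rightarrow> nat \<Rightarrow> bool"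
  where "beta_exists T k d \<longleftrightarrow>
    (\<exists>m. all_reconstructible T k d m \<and> (\<forall>j. all_reconstructible T k d j \<longrightarrow> j \<le> m))"

end

(* A facet F of a d-polytope has dimension d - 1, so by Balinski's theorem its graph stays connected
   after the removal of at most d - 2 vertices.  At a simple vertex, a facet is determined by the
   single edge that it omits, and along an edge between two simple vertices the omitted edges
   correspond to each other through the 2-faces containing that edge.  Hence, with at most d - 2
   nonsimple vertices, the facets can be followed through the 2-skeleton.

   If all vertices except u and v are simple, the graph determines the 2-faces that this argument
   needs, by a variant of Kalai's proof.  For an injective height h with maximum at v, the sum of
   binomial(indegree, 2) over the vertices other than u and v counts the pairs of a 2-face and one
   of its local maxima other than u and v.  It is therefore at least the number of 2-faces that
   avoid v and do not have u as a local maximum.  Linear-fractional heights attain equality, and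
   equality controls the local maxima on all 2-faces.  If u is the minimum, the bound is independent
   of h, and the 2-faces through u that avoid v are recognised as initial sets.  Once these are
   known, the bound is known for every h, so all 2-faces avoiding v are recognised; likewise for u.

   Sharpness: let a facet of a d-polytope be the union of two polytopes that meet in a
   (d - 2)-simplex, and let all vertices outside this simplex be simple.  Bending the facet along the
   simplex replaces one facet by two, but does not change the (d - 3)-skeleton. *)

theory Submission
  imports Defs
begin

section \<open>Vertices, edges and simple vertices\<close>

text \<open>At a nonsimple vertex two edges need not span a 2-face, so Kalai's count says nothing
  there. With v on top, the 2-faces through v drop out; those that peak at u leave an unknown term,
  which is why u is put at the bottom before general heights are treated. A height can be geometric
  for only one of the two polytopes. On the other there is just a transported function, and all that
  is known of it comes from the fact that the sum depends on the graph alone. The 2-faces through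
  both u and v escape the count altogether; the facet argument is therefore stated for edges between
  simple vertices, where such a 2-face can be found by elimination.

  In the sharpness example all faces affected by the bending have dimension at least d - 2, whence k
  <= d - 3, and the (d - 2)-simplex has d - 1 vertices, one more than the bound. Side walls of
  pairwise different slopes keep the other vertices simple.\<close>

definition verts :: "'a::euclidean_space set \<Rightarrow> 'a set"
  where "verts P = {v. v extreme_point_of P}"

definition nbrs :: "'a::euclidean_space set \<Rightarrow> 'a \<Rightarrow> 'a set"
  where "nbrs P v = {w. w \<noteq> v \<and> closed_segment v w face_of P}"

lemma verts_subset: "verts P \<subseteq> P"
  by (auto simp: verts_def extreme_point_of_def)

lemma verts_face: "F face_of P \<Longrightarrow> verts F = verts P \<inter> F"
  by (auto simp: verts_def extreme_point_of_face)

lemma finite_verts: "polytope P \<Longrightarrow> finite (verts P)"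
  by (simp add: verts_def finite_polyhedron_extreme_points polytope_imp_polyhedron)

lemma polytope_hull_verts: "polytope P \<Longrightarrow> P = convex hull (verts P)"
  by (simp add: Krein_Milman_Minkowski verts_def polytope_imp_compact polytope_imp_convex)

lemma verts_nonempty: "polytope P \<Longrightarrow> P \<noteq> {} \<Longrightarrow> verts P \<noteq> {}"
  using polytope_hull_verts by fastforce

lemma face_subset_iff_verts:
  assumes "polytope P" "polytope Q"
  shows "P \<subseteq> Q \<longleftrightarrow> verts P \<subseteq> Q"
  by (metis assms hull_minimal polytope_hull_verts polytope_imp_convex subset_trans verts_subset)

lemma face_eqI_verts:
  assumes "polytope P" "F face_of P" "G face_of P" "verts F = verts G"
  shows "F = G"
  by (metis assms face_of_polytope_polytope polytope_hull_verts)

lemma nbrs_sym: "w \<in> nbrs P v \<longleftrightarrow> v \<in> nbrs P w"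
  by (auto simp: nbrs_def closed_segment_commute)

lemma nbrs_verts: "w \<in> nbrs P v \<Longrightarrow> w \<in> verts P \<and> v \<in> verts P"
  by (auto simp: nbrs_def verts_def dest: segment_face_of)

lemma nbrs_neq: "w \<in> nbrs P v \<Longrightarrow> w \<noteq> v"
  by (simp add: nbrs_def)

lemma finite_nbrs: "polytope P \<Longrightarrow> finite (nbrs P v)"
  by (meson finite_subset finite_verts nbrs_verts subsetI)

lemma nbrs_face:
  assumes "F face_of P" "v \<in> F" 
  shows "nbrs F v = nbrs P v \<inter> F"
proof -
  have "convex F"
    using assms(1) face_of_imp_convex by blast
  then have "closed_segment v w face_of F \<longleftrightarrow> closed_segment v w face_of P \<and> w \<in> F" for w
    using assms face_of_face[OF assms(1)] closed_segment_subset[of v F w] by auto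
  then show ?thesis
    by (auto simp: nbrs_def)
qed

lemma edge_segment:
  assumes "polytope P" "e edge_of P" "v \<in> e" "v \<in> verts P"
  obtains w where "w \<in> nbrs P v" "e = closed_segment v w"
proof -
  have e: "e face_of P" "aff_dim e = 1"
    using assms by (auto simp: edge_of_def)
  then have "polytope e"
    using assms face_of_polytope_polytope by blast
  have "collinear e" "compact e" "convex e" "e \<noteq> {}"
    using e assms \<open>polytope e\<close> by (auto simp: collinear_aff_dim polytope_imp_compact polytope_imp_convex)
  then obtain a b where ab: "e = closed_segment a b"
    using compact_convex_collinear_segment by blast
  have "a \<noteq> b"
    using ab e by auto
  have "v extreme_point_of e"
    using assms e by (simp add: extreme_point_of_face verts_def)
  then consider "v = a" | "v = b"
    using ab extreme_point_of_segment by blast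
  then show ?thesis
  proof cases
    case 1
    then show ?thesis
      using that[of b] ab \<open>a \<noteq> b\<close> e(1) by (auto simp: nbrs_def)
  next
    case 2
    have "e = closed_segment b a"
      by (simp add: ab closed_segment_commute)
    then show ?thesis
      using that[of a] 2 \<open>a \<noteq> b\<close> e(1) unfolding nbrs_def by blast
  qed
qed

lemma nbrs_edge:
  assumes "w \<in> nbrs P v"
  shows "closed_segment v w edge_of P"
  using assms by (auto simp: nbrs_def edge_of_def segment_convex_hull aff_dim_convex_hull)

lemma card_edges:
  assumes "polytope P" "v \<in> verts P"
  shows "card {e. e edge_of P \<and> v \<in> e} = card (nbrs P v)"
proof -
  have "bij_betw (closed_segment v) (nbrs P v) {e. e edge_of P \<and> v \<in> e}"
    unfolding bij_betw_def
  proof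
    show "inj_on (closed_segment v) (nbrs P v)"
      by (metis (lifting) closed_segment_eq doubleton_eq_iff inj_onI)
    show "closed_segment v ` nbrs P v = {e. e edge_of P \<and> v \<in> e}"
    proof (intro equalityI subsetI)
      fix e assume "e \<in> {e. e edge_of P \<and> v \<in> e}"
      then show "e \<in> closed_segment v ` nbrs P v"
        using edge_segment[OF assms(1), of e v] assms(2) by blast
    qed (auto intro: nbrs_edge)
  qed
  then show ?thesis
    by (simp add: bij_betw_same_card)
qed

lemma polytope_rel_interior_face:
  fixes P :: "'a::euclidean_space set"
  assumes "polytope P" "x \<in> P"
  obtains F where "F face_of P" "x \<in> rel_interior F"
proof -
  let ?A = "{F. F face_of P \<and> x \<in> F}"
  have fin: "finite ?A"
    using finite_polytope_faces[OF assms(1)] by (rule rev_finite_subset) auto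
  have PA: "P \<in> ?A"
    using assms by (simp add: face_of_refl polytope_imp_convex)
  define F where "F = \<Inter> ?A"
  have F: "F face_of P" "x \<in> F"
    unfolding F_def using PA by (auto intro!: face_of_Inter)
  have pF: "polyhedron F"
    using F assms face_of_polytope_polytope polytope_imp_polyhedron by blast
  have "x \<in> rel_interior F"
  proof (rule ccontr)
    assume "x \<notin> rel_interior F"
    then obtain G where G: "G facet_of F" "x \<in> G"
      using F rel_boundary_of_polyhedron[OF pF] by auto
    then have "G face_of P"
      using F(1) face_of_trans facet_of_imp_face_of by blast
    then have "F \<subseteq> G"
      using G unfolding F_def by auto
    then have "F = G"
      using G facet_of_imp_subset by blast
    then show False
      using G by simp
  qed
  then show ?thesis
    using that F by blast
qed

text \<open>The idea is to pass to the vertex figure: the extreme points of a hyperplane section that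
  separates \<open>v\<close> from the other vertices lie on the edges at \<open>v\<close>.\<close>

lemma polytope_vertex_cone:
  assumes P: "polytope P" and v: "v \<in> verts P" and x: "x \<in> P"
    and C: "convex_cone C" and nb: "\<And>w. w \<in> nbrs P v \<Longrightarrow> w - v \<in> C"
  shows "x - v \<in> C"
proof -
  have "{v} exposed_face_of P"
    using v P by (simp add: exposed_face_of_polyhedron polytope_imp_polyhedron verts_def face_of_singleton)
  then obtain a b where ab: "P \<subseteq> {x. a \<bullet> x \<le> b}" "{v} = P \<inter> {x. a \<bullet> x = b}"
    unfolding exposed_face_of_def by blast
  have av: "a \<bullet> v = b"
    using ab by auto
  have less: "a \<bullet> w < b" if "w \<in> verts P - {v}" for w
    using that ab verts_subset[of P] by fastforce
  obtain \<beta> where \<beta>: "\<beta> < b" "\<And>w. w \<in> verts P - {v} \<Longrightarrow> a \<bullet> w < \<beta>"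
  proof -
    \<comment> \<open>The element \<open>b - 1\<close> keeps the set nonempty when \<open>v\<close>
      is the only vertex.\<close>
    define M where "M = Max (insert (b - 1) ((\<bullet>) a ` (verts P - {v})))"
    have fin: "finite (insert (b - 1) ((\<bullet>) a ` (verts P - {v})))"
      by (simp add: P finite_verts)
    have "M < b"
      unfolding M_def using fin less by (subst Max_less_iff) auto
    moreover have "a \<bullet> w \<le> M" if "w \<in> verts P - {v}" for w
      unfolding M_def using fin that by (intro Max_ge) auto
    ultimately show ?thesis
      using that[of "(M + b) / 2"] by force
  qed
  define S where "S = P \<inter> {x. a \<bullet> x = \<beta>}"
  have pS: "polytope S"
    unfolding S_def by (intro polytope_Int_polyhedron P polyhedron_hyperplane)
  have ext: "p - v \<in> C" if "p \<in> verts S" for p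
  proof -
    have pP: "p \<in> P" and ap: "a \<bullet> p = \<beta>"
      using that verts_subset[of S] by (auto simp: S_def)
    obtain F where F: "F face_of P" "p \<in> rel_interior F"
      using polytope_rel_interior_face[OF P pP] .
    have pF: "p \<in> F"
      using F(2) rel_interior_subset by blast
    \<comment> \<open>A second point of the hyperplane in this affine hull would let
      \<open>p\<close> move inside \<open>S\<close> in two opposite directions, although
      \<open>p\<close> is extreme in \<open>S\<close>.\<close>
    have "affine hull F \<inter> {x. a \<bullet> x = \<beta>} = {p}"
    proof (rule ccontr)
      assume "affine hull F \<inter> {x. a \<bullet> x = \<beta>} \<noteq> {p}"
      then obtain q where q: "q \<in> affine hull F" "a \<bullet> q = \<beta>" "q \<noteq> p"
        using ap pF by (auto simp: hull_inc)
      obtain e where e: "e > 0" "cball p e \<inter> affine hull F \<subseteq> F"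
        using F(2) by (auto simp: rel_interior_cball)
      define t where "t = (e / norm (q - p)) *\<^sub>R (q - p)"
      have t: "norm t = e" "a \<bullet> t = 0" "t \<noteq> 0"
        using q e ap by (auto simp: t_def inner_diff_right)
      have "(1 - c) *\<^sub>R p + c *\<^sub>R q \<in> affine hull F" for c
        using q pF by (intro mem_affine) (auto simp: hull_inc)
      from this[of "e / norm (q - p)"] this[of "- e / norm (q - p)"]
      have "p + t \<in> affine hull F" "p - t \<in> affine hull F"
        by (auto simp: t_def algebra_simps)
      then have "p + t \<in> F" "p - t \<in> F"
        using e t by (auto intro!: subsetD[OF e(2)] simp: dist_norm)
      then have *: "p + t \<in> S" "p - t \<in> S"
        using F(1) face_of_imp_subset ap t by (auto simp: S_def inner_add_right inner_diff_right)
      have "p = midpoint (p - t) (p + t)"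
        by (simp add: midpoint_def scaleR_2[symmetric])
      moreover have "p - t \<noteq> p + t"
        using t by (metis add_cancel_right_right add_diff_cancel diff_add_cancel scaleR_2 
            scaleR_cancel_left zero_neq_numeral add.assoc scaleR_zero_right)
      ultimately have "p \<in> open_segment (p - t) (p + t)"
        by (metis midpoint_in_open_segment)
      then show False
        using that * by (auto simp: verts_def extreme_point_of_def)
    qed
    then have "aff_dim (affine hull F \<inter> {x. a \<bullet> x = \<beta>}) = 0"
      by simp
    then have "aff_dim F \<le> 1"
      using aff_dim_affine_Int_hyperplane[of "affine hull F" a \<beta>]
      by (auto split: if_splits)
    moreover have "aff_dim F \<ge> 0"
      using pF by (metis aff_dim_negative_iff empty_iff not_less)
    moreover have "aff_dim F \<noteq> 0"
    proof
      assume "aff_dim F = 0"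
      then have "F = {p}"
        using pF by (auto simp: aff_dim_eq_0)
      then have "p \<in> verts P"
        using F by (simp add: face_of_singleton verts_def)
      then show False
        using \<beta> ap av by (cases "p = v") force+
    qed
    ultimately have "F edge_of P"
      using F by (auto simp: edge_of_def)
    have pF': "polytope F"
      using F P face_of_polytope_polytope by blast
    \<comment> \<open>Otherwise all vertices of \<open>F\<close> lie strictly below the level
      \<beta> of \<open>p\<close>.\<close>
    have "v \<in> F"
    proof (rule ccontr)
      assume "v \<notin> F"
      then have "verts F \<subseteq> {x. a \<bullet> x < \<beta>}"
        using verts_face[OF F(1)] \<beta> by auto
      then have "F \<subseteq> {x. a \<bullet> x < \<beta>}"
        using polytope_hull_verts[OF pF'] by (metis convex_halfspace_lt hull_minimal)
      then show False
        using ap pF by auto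
    qed
    then obtain w where w: "w \<in> nbrs P v" "F = closed_segment v w"
      using edge_segment[OF P \<open>F edge_of P\<close>] v by blast
    then obtain u where "0 \<le> u" "p = (1 - u) *\<^sub>R v + u *\<^sub>R w"
      using pF by (auto simp: in_segment)
    then have "p - v = u *\<^sub>R (w - v)"
      by (simp add: algebra_simps)
    then show ?thesis
      using C nb[OF w(1)] \<open>0 \<le> u\<close> by (simp add: convex_cone_scaleR)
  qed
  have convC: "convex ((\<lambda>y. v + y) ` C)"
    using C by (simp add: convex_cone_def)
  have "S \<subseteq> (\<lambda>y. v + y) ` C"
    apply (subst polytope_hull_verts[OF pS])
    apply (rule hull_minimal)
    using ext convC by (force intro: image_eqI[where x = "_ - v"])+
  then have SC: "y - v \<in> C" if "y \<in> S" for y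
    using that by auto
  have "verts P \<subseteq> (\<lambda>y. v + y) ` C"
  proof
    fix y assume y: "y \<in> verts P"
    have "y - v \<in> C"
    proof (cases "y = v")
      case True
      then show ?thesis
        using C by (simp add: convex_cone_contains_0)
    next
      case False
      then have ay: "a \<bullet> y < \<beta>"
        using y \<beta> by auto
      \<comment> \<open>The parameter at which the segment from \<open>v\<close> to \<open>y\<close>
        crosses the hyperplane.\<close>
      define u where "u = (b - \<beta>) / (b - a \<bullet> y)"
      have u: "0 < u" "u < 1"
        using ay \<beta> by (auto simp: u_def field_simps)
      define z where "z = (1 - u) *\<^sub>R v + u *\<^sub>R y"
      have "u * (b - a \<bullet> y) = b - \<beta>"
        using ay \<beta> by (auto simp: u_def)
      then have "a \<bullet> z = \<beta>"
        by (simp add: z_def inner_add_right av algebra_simps)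
      moreover have "z \<in> P"
        unfolding z_def using P u y v verts_subset
        by (intro convexD) (auto simp: polytope_imp_convex)
      ultimately have "z - v \<in> C"
        using SC S_def by auto
      moreover have "y - v = (1 / u) *\<^sub>R (z - v)"
        using u by (simp add: z_def algebra_simps)
      ultimately show ?thesis
        using u C by (simp add: convex_cone_scaleR)
    qed
    then show "y \<in> (\<lambda>y. v + y) ` C"
      by (force intro: image_eqI[where x = "_ - v"])
  qed
  then have "P \<subseteq> (\<lambda>y. v + y) ` C"
    using polytope_hull_verts[OF P] convC by (metis hull_minimal)
  then show ?thesis
    using x by auto
qed

text \<open>Local optimality is global: if no neighbour improved, the half-space
  \<open>g \<bullet> y \<le> 0\<close> would be a convex cone that contains all edge directions at
  \<open>v\<close>, hence every \<open>x - v\<close>.\<close>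

lemma improving_nbr:
  assumes P: "polytope P" and v: "v \<in> verts P" and x: "x \<in> P" and "g \<bullet> v < g \<bullet> x"
  obtains w where "w \<in> nbrs P v" "g \<bullet> v < g \<bullet> w"
proof (rule ccontr)
  assume "\<not> thesis"
  then have "\<And>w. w \<in> nbrs P v \<Longrightarrow> g \<bullet> (w - v) \<le> 0"
    using that by (force simp: inner_diff_right)
  then have "x - v \<in> {y. g \<bullet> y \<le> 0}"
    by (intro polytope_vertex_cone[OF P v x] convex_cone_halfspace_le) auto
  then show False
    using assms by (simp add: inner_diff_right)
qed

lemma polytope_span_nbrs:
  assumes "polytope P" "v \<in> verts P" "x \<in> P"
  shows "x - v \<in> span ((\<lambda>w. w - v) ` nbrs P v)"
  using assms by (rule polytope_vertex_cone) (auto intro: span_base convex_cone_span)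

lemma aff_dim_eq_dim_nbrs:
  assumes "polytope P" "v \<in> verts P"
  shows "aff_dim P = int (dim ((\<lambda>w. w - v) ` nbrs P v))"
proof -
  have "v \<in> P"
    using assms verts_subset by blast
  then have "aff_dim P = int (dim ((\<lambda>x. x - v) ` P))"
    by (intro aff_dim_eq_dim_subtract hull_inc)
  also have "dim ((\<lambda>x. x - v) ` P) = dim ((\<lambda>w. w - v) ` nbrs P v)"
  proof (rule antisym)
    show "dim ((\<lambda>x. x - v) ` P) \<le> dim ((\<lambda>w. w - v) ` nbrs P v)"
      using polytope_span_nbrs[OF assms] by (metis dim_span dim_subset image_subsetI)
    have "nbrs P v \<subseteq> P"
      using nbrs_verts verts_subset by blast
    then show "dim ((\<lambda>w. w - v) ` nbrs P v) \<le> dim ((\<lambda>x. x - v) ` P)"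
      by (intro dim_subset image_mono)
  qed
  finally show ?thesis .
qed

lemma aff_dim_le_card_nbrs:
  assumes "polytope P" "v \<in> verts P"
  shows "aff_dim P \<le> int (card (nbrs P v))"
proof -
  have "dim ((\<lambda>w. w - v) ` nbrs P v) \<le> card ((\<lambda>w. w - v) ` nbrs P v)"
    using assms by (intro dim_le_card) (auto simp: finite_nbrs span_base)
  also have "\<dots> = card (nbrs P v)"
    by (intro card_image) (auto simp: inj_on_def)
  finally show ?thesis
    using aff_dim_eq_dim_nbrs[OF assms] by simp
qed

text \<open>A face is the part of \<open>P\<close> in its affine hull, and a face through
  \<open>v\<close> lies in the affine space that its edges at \<open>v\<close> span.\<close>

lemma face_subset_nbrs:
  assumes P: "polytope P" and F: "F face_of P" and G: "G face_of P"
    and v: "v \<in> verts P" "v \<in> F" "v \<in> G" and sub: "nbrs P v \<inter> F \<subseteq> G"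
  shows "F \<subseteq> G"
proof
  fix x assume x: "x \<in> F"
  have vF: "v \<in> verts F"
    using v verts_face[OF F] by auto
  have pF: "polytope F"
    using P F face_of_polytope_polytope by blast
  have "x - v \<in> span ((\<lambda>w. w - v) ` nbrs F v)"
    by (rule polytope_span_nbrs[OF pF vF x])
  also have "\<dots> \<subseteq> span ((\<lambda>y. - v + y) ` G)"
    using sub nbrs_face[OF F v(2)] by (intro span_mono) auto
  finally have "v + (x - v) \<in> (\<lambda>y. v + y) ` span ((\<lambda>y. - v + y) ` G)"
    by (rule imageI)
  then have "x \<in> affine hull G"
    using affine_hull_span_gen[of v G] v(3) by (simp add: hull_inc)
  moreover have "x \<in> P"
    using x F face_of_imp_subset by blast
  ultimately show "x \<in> G"
    using face_of_imp_eq_affine_Int[OF polytope_imp_convex[OF P] G] by blast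
qed

lemma face_eq_nbrs:
  assumes "polytope P" "F face_of P" "G face_of P"
    and "v \<in> verts P" "v \<in> F" "v \<in> G" "nbrs P v \<inter> F = nbrs P v \<inter> G"
  shows "F = G"
  using face_subset_nbrs assms by (metis inf_le2 subset_antisym)

section \<open>Faces at a simple vertex\<close>

lemma simple_vertex_independent:
  assumes "polytope P" "v \<in> verts P" "aff_dim P = int (card (nbrs P v))"
  shows "independent ((\<lambda>w. w - v) ` nbrs P v)"
proof -
  have "card ((\<lambda>w. w - v) ` nbrs P v) = card (nbrs P v)"
    by (intro card_image) (auto simp: inj_on_def)
  then have "dim ((\<lambda>w. w - v) ` nbrs P v) = card ((\<lambda>w. w - v) ` nbrs P v)"
    using assms aff_dim_eq_dim_nbrs[OF assms(1,2)] by simp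
  then show ?thesis
    using assms(1) finite_nbrs by (metis card_eq_dim finite_imageI order_refl span_superset)
qed

lemma simple_vertex_face_dim:
  assumes P: "polytope P" and v: "v \<in> verts P" and s: "aff_dim P = int (card (nbrs P v))"
    and F: "F face_of P" "v \<in> F"
  shows "aff_dim F = int (card (nbrs P v \<inter> F))"
proof -
  have "independent ((\<lambda>w. w - v) ` (nbrs P v \<inter> F))"
    using simple_vertex_independent[OF P v s] by (rule independent_mono) auto
  then have "dim ((\<lambda>w. w - v) ` nbrs F v) = card ((\<lambda>w. w - v) ` nbrs F v)"
    unfolding nbrs_face[OF F] by (rule dim_eq_card_independent)
  also have "\<dots> = card (nbrs F v)"
    by (intro card_image) (auto simp: inj_on_def)
  finally show ?thesis
    using aff_dim_eq_dim_nbrs[of F v] F P v nbrs_face[OF F] verts_face[OF F(1)] 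
      face_of_polytope_polytope by auto
qed

text \<open>The edge directions at a simple vertex are independent, so a linear functional may be
  prescribed as 0 along the edges to \<open>S\<close> and -1 along the others. It has a local, hence
  global, maximum at \<open>v\<close>, and the face where it is maximal contains exactly the edges
  to \<open>S\<close>.\<close>

lemma simple_vertex_face_exists:
  fixes P :: "'a::euclidean_space set"
  assumes P: "polytope P" and v: "v \<in> verts P" and s: "aff_dim P = int (card (nbrs P v))"
    and S: "S \<subseteq> nbrs P v"
  obtains F where "F face_of P" "v \<in> F" "nbrs P v \<inter> F = S" "aff_dim F = int (card S)"
proof -
  obtain g0 :: "'a \<Rightarrow> real" where g0: "linear g0"
    "\<forall>x\<in>(\<lambda>w. w - v) ` nbrs P v. g0 x = (if x + v \<in> S then 0 else -1)"
    using linear_independent_extend[OF simple_vertex_independent[OF P v s],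
        of "\<lambda>x. if x + v \<in> S then 0 else -1"] by auto
  \<comment> \<open>The vector that represents \<open>g0\<close> as an inner product.\<close>
  define g where "g = adjoint g0 1"
  have gg: "g \<bullet> x = g0 x" for x
    using adjoint_works[OF g0(1), of x 1] by (simp add: g_def inner_commute)
  have gnb: "g \<bullet> w - g \<bullet> v = (if w \<in> S then 0 else -1)" if "w \<in> nbrs P v" for w
    using g0(2) that by (auto simp: gg linear_diff[OF g0(1)])
  have le: "g \<bullet> x \<le> g \<bullet> v" if x: "x \<in> P" for x
  proof (rule ccontr)
    assume "\<not> g \<bullet> x \<le> g \<bullet> v"
    then obtain w where "w \<in> nbrs P v" "g \<bullet> v < g \<bullet> w"
      using improving_nbr[OF P v x, of g] by auto
    then show False
      using gnb[of w] by (auto split: if_splits)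
  qed
  define F where "F = P \<inter> {x. g \<bullet> x = g \<bullet> v}"
  have F: "F face_of P" "v \<in> F"
    unfolding F_def using le v verts_subset P
    by (auto intro!: face_of_Int_supporting_hyperplane_le simp: polytope_imp_convex)
  moreover have "nbrs P v \<inter> F = S"
    using gnb S nbrs_verts verts_subset unfolding F_def
    by (fastforce split: if_splits)
  ultimately show ?thesis
    using that simple_vertex_face_dim[OF P v s F] by auto
qed

lemma polygon_two_nbrs:
  assumes T: "polytope T" "aff_dim T = 2" and v: "v \<in> verts T"
  shows "card (nbrs T v) = 2"
proof (rule antisym)
  show "2 \<le> card (nbrs T v)"
    using aff_dim_le_card_nbrs[OF T(1) v] T(2) by simp
  show "card (nbrs T v) \<le> 2"
  proof (rule ccontr)
    assume "\<not> card (nbrs T v) \<le> 2"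
    then obtain W where W: "W \<subseteq> nbrs T v" "card W = 3"
      by (metis not_less_eq_eq numeral_2_eq_2 numeral_3_eq_3 obtain_subset_with_card_n)
    then have finW: "finite W"
      by (metis card.infinite zero_neq_numeral)
    have "dim ((\<lambda>w. w - v) ` W) \<le> 2"
      using aff_dim_eq_dim_nbrs[OF T(1) v] T(2) dim_subset[of "(\<lambda>w. w - v) ` W" "(\<lambda>w. w - v) ` nbrs T v"] W(1)
      by auto
    moreover have c3: "card ((\<lambda>w. w - v) ` W) = 3"
      using W(2) by (subst card_image) (auto simp: inj_on_def)
    ultimately have "dependent ((\<lambda>w. w - v) ` W)"
      using dim_eq_card_independent by fastforce
    then obtain u where u: "(\<Sum>x\<in>(\<lambda>w. w - v) ` W. u x *\<^sub>R x) = 0" "\<exists>x\<in>(\<lambda>w. w - v) ` W. u x \<noteq> 0"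
      using dependent_finite[of "(\<lambda>w. w - v) ` W"] finW by auto
    define c where "c w = u (w - v)" for w
    have sum0: "(\<Sum>w\<in>W. c w *\<^sub>R (w - v)) = 0"
      using u(1) by (subst (asm) sum.reindex) (auto simp: inj_on_def c_def)
    have ex: "\<exists>w\<in>W. c w \<noteq> 0"
      using u(2) by (auto simp: c_def)
    text \<open>The supporting functional of the edge towards \<open>w1\<close> shows that the coefficients
      of the other two directions are both zero or of opposite signs.\<close>
    have opp: "c w2 * c w3 < 0 \<or> (c w2 = 0 \<and> c w3 = 0)"
      if W123: "W = {w1, w2, w3}" "w1 \<noteq> w2" "w1 \<noteq> w3" "w2 \<noteq> w3" for w1 w2 w3
    proof -
      let ?E = "closed_segment v w1"
      have "?E exposed_face_of T"
        using W that T(1) by (auto simp: exposed_face_of_polyhedron polytope_imp_polyhedron nbrs_def)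
      then obtain a b where ab: "T \<subseteq> {x. a \<bullet> x \<le> b}" "?E = T \<inter> {x. a \<bullet> x = b}"
        unfolding exposed_face_of_def by blast
      have in1: "a \<bullet> v = b" "a \<bullet> w1 = b"
        using ab by auto
      have neg: "a \<bullet> (w - v) < 0" if "w \<in> {w2, w3}" for w
      proof -
        have wn: "w \<in> nbrs T v" "w1 \<in> nbrs T v"
          using that W W123 by auto
        then have "w \<in> verts T" "w \<in> T"
          using nbrs_verts verts_subset by blast+
        have "w \<notin> ?E"
        proof
          assume "w \<in> ?E"
          then have "w extreme_point_of ?E"
            using \<open>w \<in> verts T\<close> wn(2) by (auto simp: verts_def nbrs_def extreme_point_of_face)
          then have "w = v \<or> w = w1"
            by (simp add: extreme_point_of_segment)
          then show False
            using wn W123 that by (auto simp: nbrs_def)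
        qed
        then show ?thesis
          using ab \<open>w \<in> T\<close> in1 by (force simp: inner_diff_right)
      qed
      have "0 = a \<bullet> (\<Sum>w\<in>W. c w *\<^sub>R (w - v))"
        using sum0 by simp
      also have "\<dots> = c w2 * (a \<bullet> (w2 - v)) + c w3 * (a \<bullet> (w3 - v))"
        using W123 in1 by (simp add: inner_add_right inner_diff_right)
      finally have e: "c w2 * (a \<bullet> (w2 - v)) = - (c w3 * (a \<bullet> (w3 - v)))"
        by simp
      define s2 s3 where "s2 = a \<bullet> (w2 - v)" and "s3 = a \<bullet> (w3 - v)"
      have s: "s2 < 0" "s3 < 0" "c w2 * s2 = - (c w3 * s3)"
        using neg e by (auto simp: s2_def s3_def)
      show ?thesis
      proof (rule ccontr)
        assume "\<not> ?thesis"
        then consider "c w2 \<ge> 0" "c w3 \<ge> 0" "c w2 > 0 \<or> c w3 > 0" | "c w2 \<le> 0" "c w3 \<le> 0" "c w2 < 0 \<or> c w3 < 0"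
          by (smt (verit) mult_neg_pos mult_pos_neg)
        then show False
        proof cases
          case 1
          then show ?thesis
            using s by (smt (verit) mult_nonneg_nonpos mult_pos_neg)
        next
          case 2
          then show ?thesis
            using s by (smt (verit) mult_nonpos_nonpos mult_neg_neg)
        qed
      qed
    qed
    obtain w1 w2 w3 where w: "W = {w1, w2, w3}" "w1 \<noteq> w2" "w1 \<noteq> w3" "w2 \<noteq> w3"
      using W(2) by (auto simp: card_3_iff)
    have "c w2 * c w3 < 0 \<or> (c w2 = 0 \<and> c w3 = 0)" "c w1 * c w3 < 0 \<or> (c w1 = 0 \<and> c w3 = 0)"
      "c w1 * c w2 < 0 \<or> (c w1 = 0 \<and> c w2 = 0)"
      using opp[of w1 w2 w3] opp[of w2 w1 w3] opp[of w3 w1 w2] w by auto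
    \<comment> \<open>Three reals cannot have pairwise opposite signs, so all coefficients would
      vanish.\<close>
    then show False
      using ex w by (auto simp: mult_less_0_iff)
  qed
qed

section \<open>Connectivity of the graph\<close>

lemma obtain_max_on:
  fixes f :: "'a \<Rightarrow> real"
  assumes "finite A" "A \<noteq> {}"
  obtains z where "z \<in> A" "\<And>x. x \<in> A \<Longrightarrow> f x \<le> f z"
proof -
  have "Max (f ` A) \<in> f ` A"
    using assms by simp
  then obtain z where "z \<in> A" "f z = Max (f ` A)"
    by auto
  then show ?thesis
    using that assms(1) by simp
qed

definition reach :: "'a::euclidean_space set \<Rightarrow> 'a set \<Rightarrow> ('a \<times> 'a) set"
  where "reach P S = {(v, w). v \<in> verts P - S \<and> w \<in> verts P - S \<and> w \<in> nbrs P v}"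

lemma reach_sym: "(x, y) \<in> (reach P S)\<^sup>* \<Longrightarrow> (y, x) \<in> (reach P S)\<^sup>*"
proof -
  have "sym (reach P S)"
    by (auto simp: sym_def reach_def nbrs_sym)
  then show "(x, y) \<in> (reach P S)\<^sup>* \<Longrightarrow> (y, x) \<in> (reach P S)\<^sup>*"
    by (meson sym_rtrancl symD)
qed

lemma reach_face_mono:
  assumes "F face_of P" "S \<inter> F \<subseteq> S'"
  shows "(reach F S')\<^sup>* \<subseteq> (reach P S)\<^sup>*"
proof (rule rtrancl_mono, clarify)
  fix x y assume "(x, y) \<in> reach F S'"
  then show "(x, y) \<in> reach P S"
    using assms verts_face[OF assms(1)] nbrs_face[OF assms(1), of x] 
    by (auto simp: reach_def)
qed

text \<open>Climb along improving neighbours as in the simplex method. Each of them lies strictly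
  above the level \<open>c\<close>, hence outside \<open>S\<close>, and a highest vertex reached in
  this way maximises \<open>g\<close> on \<open>P\<close>.\<close>

lemma reach_upwards:
  assumes P: "polytope P" and S: "\<And>s. s \<in> S \<Longrightarrow> s \<in> P \<Longrightarrow> g \<bullet> s \<le> c"
    and y: "y \<in> verts P - S" "c \<le> g \<bullet> y" "\<exists>z\<in>P. c < g \<bullet> z"
  obtains z where "z \<in> verts P" "(y, z) \<in> (reach P S)\<^sup>*" "c < g \<bullet> z" "\<And>x. x \<in> P \<Longrightarrow> g \<bullet> x \<le> g \<bullet> z"
proof -
  define R where "R = {z \<in> verts P - S. (y, z) \<in> (reach P S)\<^sup>* \<and> c \<le> g \<bullet> z}"
  have "finite R" "y \<in> R"
    using finite_verts[OF P] y by (auto simp: R_def)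
  then obtain z where z: "z \<in> R" "\<And>x. x \<in> R \<Longrightarrow> g \<bullet> x \<le> g \<bullet> z"
    using obtain_max_on[of R "(\<bullet>) g"] by blast
  have top: "g \<bullet> x \<le> g \<bullet> z" if x: "x \<in> P" for x
  proof (rule ccontr)
    assume "\<not> g \<bullet> x \<le> g \<bullet> z"
    then obtain w where w: "w \<in> nbrs P z" "g \<bullet> z < g \<bullet> w"
      using improving_nbr[OF P _ x, of z g] z(1) by (auto simp: R_def)
    have "w \<in> verts P" "w \<in> P"
      using w nbrs_verts verts_subset by blast+
    moreover have "w \<notin> S"
      using S[of w] w z(1) \<open>w \<in> P\<close> by (auto simp: R_def)
    ultimately have "(z, w) \<in> reach P S"
      using w z(1) by (auto simp: reach_def R_def)
    then have "w \<in> R"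
      using z(1) w \<open>w \<in> verts P\<close> \<open>w \<notin> S\<close> by (auto simp: R_def)
    then show False
      using z(2) w by fastforce
  qed
  then have "c < g \<bullet> z"
    using y(3) by (meson less_le_trans)
  then show ?thesis
    using that z(1) top by (auto simp: R_def)
qed

text \<open>The climbs from \<open>x\<close> and from \<open>y\<close> end on the same face, the one
  where \<open>g\<close> is maximal. It lies above the level \<open>c\<close>, so it misses
  \<open>S\<close> and also \<open>x\<close>; being proper, it is connected by the hypothesis on
  faces.\<close>

lemma reach_upper_half:
  assumes P: "polytope P" and S: "\<And>s. s \<in> S \<Longrightarrow> s \<in> P \<Longrightarrow> g \<bullet> s \<le> c"
    and top: "\<exists>z\<in>P. c < g \<bullet> z"
    and faces: "\<And>F x y. F face_of P \<Longrightarrow> F \<noteq> P \<Longrightarrow> x \<in> verts F \<Longrightarrow> y \<in> verts F \<Longrightarrow> (x, y) \<in> (reach F {})\<^sup>*"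
    and x: "x \<in> verts P - S" "g \<bullet> x = c" and y: "y \<in> verts P - S" "c \<le> g \<bullet> y"
  shows "(x, y) \<in> (reach P S)\<^sup>*"
proof -
  obtain z where z: "z \<in> verts P" "(y, z) \<in> (reach P S)\<^sup>*" "c < g \<bullet> z" "\<And>x. x \<in> P \<Longrightarrow> g \<bullet> x \<le> g \<bullet> z"
    using reach_upwards[OF P S y top] by blast
  obtain z' where z': "z' \<in> verts P" "(x, z') \<in> (reach P S)\<^sup>*" "c < g \<bullet> z'" "\<And>x. x \<in> P \<Longrightarrow> g \<bullet> x \<le> g \<bullet> z'"
    using reach_upwards[OF P S x(1) _ top] x(2) by auto
  define F where "F = P \<inter> {x. g \<bullet> x = g \<bullet> z}"
  have F: "F face_of P"
    unfolding F_def using z(4) P by (auto intro!: face_of_Int_supporting_hyperplane_le simp: polytope_imp_convex)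
  have "x \<in> P" "x \<notin> F"
    using x z(3) verts_subset by (auto simp: F_def)
  have "z \<in> P" "z' \<in> P"
    using z z' verts_subset by blast+
  then have "g \<bullet> z' = g \<bullet> z"
    using z(4) z'(4) by (meson antisym)
  then have "z \<in> verts F" "z' \<in> verts F"
    unfolding verts_face[OF F] using z(1) z'(1) \<open>z \<in> P\<close> \<open>z' \<in> P\<close> by (auto simp: F_def)
  then have "(z', z) \<in> (reach F {})\<^sup>*"
    using F \<open>x \<in> P\<close> \<open>x \<notin> F\<close> by (intro faces) auto
  moreover have "S \<inter> F \<subseteq> {}"
    using S z(3) by (force simp: F_def)
  ultimately have "(z', z) \<in> (reach P S)\<^sup>*"
    using reach_face_mono[OF F] by blast
  then show ?thesis
    using z z' reach_sym rtrancl_trans by metis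
qed

text \<open>As \<open>x\<close> lies on the hyperplane, it belongs to both closed half-spaces; on
  whichever side \<open>y\<close> lies, climbing with \<open>g\<close> or \<open>- g\<close> joins
  it to \<open>x\<close>.\<close>

lemma reach_level:
  assumes P: "polytope P" and S: "\<And>s. s \<in> S \<Longrightarrow> g \<bullet> s = c"
    and nonconst: "\<exists>z\<in>P. g \<bullet> z \<noteq> c"
    and faces: "\<And>F x y. F face_of P \<Longrightarrow> F \<noteq> P \<Longrightarrow> x \<in> verts F \<Longrightarrow> y \<in> verts F \<Longrightarrow> (x, y) \<in> (reach F {})\<^sup>*"
    and x: "x \<in> verts P - S" "g \<bullet> x = c" and y: "y \<in> verts P - S"
  shows "(x, y) \<in> (reach P S)\<^sup>*"
proof -
  have up: ?thesis if "\<exists>z\<in>P. c < g \<bullet> z" "c \<le> g \<bullet> y"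
    using that S by (intro reach_upper_half[OF P _ that(1) faces x y]) auto
  have down: ?thesis if "\<exists>z\<in>P. g \<bullet> z < c" "g \<bullet> y \<le> c"
    using that S x(2) by (intro reach_upper_half[OF P _ _ faces x(1) _ y, of "- g" "- c"]) auto
  have "y \<in> P"
    using y verts_subset by blast
  then show ?thesis
    using up down nonconst by (metis linorder_less_linear not_less order_le_less)
qed

text \<open>So few points have an affine hull that misses some \<open>z\<close> in \<open>P\<close>;
  the functional is the component of \<open>z - x\<close> orthogonal to that hull.\<close>

lemma functional_const_on:
  fixes S :: "'a::euclidean_space set"
  assumes "finite S" "x \<in> S" "int (card S) \<le> aff_dim P"
  obtains g c where "\<And>s. s \<in> S \<Longrightarrow> g \<bullet> s = c" "\<exists>z\<in>P. g \<bullet> z \<noteq> c"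
proof -
  have "aff_dim S < aff_dim P"
    using aff_dim_le_card[OF assms(1)] assms(3) by linarith
  then have "\<not> P \<subseteq> affine hull S"
    using aff_dim_subset[of P "affine hull S"] by auto
  then obtain z where z: "z \<in> P" "z \<notin> affine hull S"
    by blast
  obtain p w where pw: "p \<in> span ((\<lambda>y. - x + y) ` S)"
    "\<And>v. v \<in> span ((\<lambda>y. - x + y) ` S) \<Longrightarrow> orthogonal w v" "z - x = p + w"
    using orthogonal_subspace_decomp_exists[of "(\<lambda>y. - x + y) ` S" "z - x"] by blast
  have "w \<noteq> 0"
  proof
    assume "w = 0"
    then have "z = x + p"
      using pw(3) by (simp add: algebra_simps)
    then have "z \<in> (\<lambda>y. x + y) ` span ((\<lambda>y. - x + y) ` S)"
      using pw(1) by blast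
    then show False
      using z affine_hull_span_gen[of x S] assms(2) by (simp add: hull_inc)
  qed
  have "w \<bullet> s = w \<bullet> x" if "s \<in> S" for s
    using pw(2)[of "- x + s"] that by (auto simp: orthogonal_def inner_diff_right span_base)
  moreover have "w \<bullet> z \<noteq> w \<bullet> x"
  proof -
    have "w \<bullet> (z - x) = w \<bullet> w"
      using pw(2)[OF pw(1)] by (simp add: pw(3) inner_add_right orthogonal_def)
    then show ?thesis
      using \<open>w \<noteq> 0\<close> by (auto simp: inner_diff_right)
  qed
  ultimately show ?thesis
    using that z by blast
qed

text \<open>The argument with \<open>reach_level\<close> asks for connected graphs of the proper
  faces, with nothing removed there; induction on the dimension supplies them.\<close>

lemma polytope_graph_connected:
  assumes "polytope P" "x \<in> verts P" "y \<in> verts P"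
  shows "(x, y) \<in> (reach P {})\<^sup>*"
  using assms
proof (induction "nat (aff_dim P)" arbitrary: P x y rule: less_induct)
  case less
  show ?case
  proof (cases "aff_dim P \<le> 0")
    case True
    have "x \<in> P" "y \<in> P"
      using less verts_subset by blast+
    then have "aff_dim P = 0"
      using True by (metis aff_dim_negative_iff empty_iff linorder_not_less order_antisym_conv)
    then show ?thesis
      using \<open>x \<in> P\<close> \<open>y \<in> P\<close> by (auto simp: aff_dim_eq_0)
  next
    case False
    then obtain g c where g: "\<And>s. s \<in> {x} \<Longrightarrow> g \<bullet> s = c" "\<exists>z\<in>P. g \<bullet> z \<noteq> c"
      using functional_const_on[of "{x}" x P] by auto
    show ?thesis
    proof (rule reach_level[of P "{}" g c])
      fix F u v assume "F face_of P" "F \<noteq> P" "u \<in> verts F" "v \<in> verts F"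
      then show "(u, v) \<in> (reach F {})\<^sup>*"
        using less False face_of_aff_dim_lt[of P F] face_of_polytope_polytope[of P F]
        by (intro less(1)) (auto simp: polytope_imp_convex)
    qed (use g less in auto)
  qed
qed

text \<open>The hyperplane is put through the removed vertices and through \<open>x\<close> as well,
  which is possible because these are at most \<open>aff_dim P\<close> points.\<close>

theorem balinski:
  assumes P: "polytope P" and S: "S \<subseteq> verts P" "int (card S) < aff_dim P"
    and x: "x \<in> verts P - S" and y: "y \<in> verts P - S"
  shows "(x, y) \<in> (reach P S)\<^sup>*"
proof -
  have fS: "finite S"
    using S(1) finite_verts[OF P] finite_subset by blast
  then have "int (card (insert x S)) \<le> aff_dim P"
    using S(2) x by simp
  then obtain g c where g: "\<And>s. s \<in> insert x S \<Longrightarrow> g \<bullet> s = c" "\<exists>z\<in>P. g \<bullet> z \<noteq> c"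
    using functional_const_on[of "insert x S" x P] fS by auto
  show ?thesis
  proof (rule reach_level[OF P, of S g c])
    fix F u v assume "F face_of P" "u \<in> verts F" "v \<in> verts F"
    then show "(u, v) \<in> (reach F {})\<^sup>*"
      using polytope_graph_connected face_of_polytope_polytope[OF P] by blast
  qed (use g x y in auto)
qed

section \<open>Following facets through the 2-faces\<close>

definition graph_iso :: "('a::euclidean_space \<Rightarrow> 'a) \<Rightarrow> 'a set \<Rightarrow> 'a set \<Rightarrow> bool"
  where "graph_iso \<phi> P Q \<longleftrightarrow> bij_betw \<phi> (verts P) (verts Q) \<and>
    (\<forall>x\<in>verts P. nbrs Q (\<phi> x) = \<phi> ` nbrs P x)"

lemma nbrs_subset_verts: "nbrs P x \<subseteq> verts P"
  using nbrs_verts by blast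

lemma graph_iso_inv:
  assumes "graph_iso \<phi> P Q"
  shows "graph_iso (inv_into (verts P) \<phi>) Q P"
proof -
  let ?\<psi> = "inv_into (verts P) \<phi>"
  have b: "bij_betw \<phi> (verts P) (verts Q)"
    using assms by (simp add: graph_iso_def)
  have "nbrs P (?\<psi> y) = ?\<psi> ` nbrs Q y" if y: "y \<in> verts Q" for y
  proof -
    obtain x where x: "x \<in> verts P" "y = \<phi> x"
      using b y by (auto simp: bij_betw_def)
    have "?\<psi> ` \<phi> ` nbrs P x = nbrs P x"
      using b nbrs_subset_verts by (intro inv_into_image_cancel) (auto simp: bij_betw_def)
    moreover have "?\<psi> y = x"
      using x b by (simp add: bij_betw_def)
    ultimately show ?thesis
      using assms x by (simp add: graph_iso_def)
  qed
  then show ?thesis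
    using b bij_betw_inv_into by (auto simp: graph_iso_def)
qed

lemma graph_iso_card_nbrs:
  assumes "graph_iso \<phi> P Q" "x \<in> verts P"
  shows "card (nbrs Q (\<phi> x)) = card (nbrs P x)"
proof -
  have "inj_on \<phi> (nbrs P x)"
    using assms nbrs_subset_verts by (meson bij_betw_def graph_iso_def inj_on_subset)
  then show ?thesis
    using assms by (simp add: graph_iso_def card_image)
qed

lemma verts_face_subset: "F face_of P \<Longrightarrow> verts F \<subseteq> verts P"
  by (simp add: verts_face)

lemma graph_isoD:
  assumes "graph_iso \<phi> P Q"
  shows "inj_on \<phi> (verts P)" "\<phi> ` verts P = verts Q" "x \<in> verts P \<Longrightarrow> \<phi> x \<in> verts Q"
  using assms by (auto simp: graph_iso_def bij_betw_def)

section \<open>Face lattices from vertex sets and facets\<close>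

lemma inclusion_isomorphic_vertsI:
  fixes P :: "'a::euclidean_space set" and Q :: "'a set"
  assumes P: "polytope P" and Q: "polytope Q" and b: "bij_betw \<phi> (verts P) (verts Q)"
    and \<A>: "\<A> \<subseteq> faces P" and \<B>: "\<B> \<subseteq> faces Q"
    and 1: "\<And>A. A \<in> \<A> \<Longrightarrow> \<exists>B\<in>\<B>. verts B = \<phi> ` verts A"
    and 2: "\<And>B. B \<in> \<B> \<Longrightarrow> \<exists>A\<in>\<A>. verts B = \<phi> ` verts A"
  shows "inclusion_isomorphic \<A> \<B>"
proof -
  obtain f where f: "\<And>A. A \<in> \<A> \<Longrightarrow> f A \<in> \<B> \<and> verts (f A) = \<phi> ` verts A"
    using 1 by metis
  have inj: "inj_on \<phi> (verts P)"
    using b by (simp add: bij_betw_def)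
  have vA: "verts A \<subseteq> verts P" if "A \<in> \<A>" for A
    using that \<A> verts_face[of A P] by (auto simp: faces_def)
  have sub: "X \<subseteq> Y \<longleftrightarrow> verts X \<subseteq> verts Y" if "X face_of R" "Y face_of R" "polytope R" for X Y R :: "'a set"
    using that face_subset_iff_verts[of X Y] verts_face[of X R] verts_face[of Y R] face_of_polytope_polytope
    by blast
  have subiff: "X \<subseteq> Y \<longleftrightarrow> f X \<subseteq> f Y" if "X \<in> \<A>" "Y \<in> \<A>" for X Y
  proof -
    have "X \<subseteq> Y \<longleftrightarrow> verts X \<subseteq> verts Y"
      using that \<A> P by (intro sub) (auto simp: faces_def)
    also have "\<dots> \<longleftrightarrow> \<phi> ` verts X \<subseteq> \<phi> ` verts Y"
      using inj_on_image_subset_iff[OF inj vA vA] that by simp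
    also have "\<dots> \<longleftrightarrow> verts (f X) \<subseteq> verts (f Y)"
      using f that by simp
    also have "\<dots> \<longleftrightarrow> f X \<subseteq> f Y"
      using that f \<B> Q by (subst sub[of _ Q]) (auto simp: faces_def)
    finally show ?thesis .
  qed
  have "bij_betw f \<A> \<B>"
    unfolding bij_betw_def
  proof
    show "inj_on f \<A>"
      using subiff by (metis inj_onI order_antisym order_refl)
    show "f ` \<A> = \<B>"
    proof (intro equalityI subsetI)
      fix B assume B: "B \<in> \<B>"
      then obtain A where A: "A \<in> \<A>" "verts B = \<phi> ` verts A"
        using 2 by blast
      then have "B face_of Q" "f A face_of Q" "verts B = verts (f A)"
        using f[OF A(1)] B \<B> by (auto simp: faces_def)
      then have "B = f A"
        using face_eqI_verts[OF Q] by blast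
      then show "B \<in> f ` \<A>"
        using A by blast
    qed (use f in auto)
  qed
  then show ?thesis
    using subiff unfolding inclusion_isomorphic_def by blast
qed

text \<open>A proper nonempty face is the intersection of the facets that contain it, so the
  corresponding facets of \<open>Q\<close> are intersected.\<close>

lemma face_image_of_facets:
  assumes P: "polytope P" and Q: "polytope Q" and b: "bij_betw \<phi> (verts P) (verts Q)"
    and facets: "\<And>F. F facet_of P \<Longrightarrow> \<exists>G. G facet_of Q \<and> verts G = \<phi> ` verts F"
    and A: "A face_of P"
  shows "\<exists>B. B face_of Q \<and> verts B = \<phi> ` verts A"
proof -
  consider "A = {}" | "A = P" | "A \<noteq> {}" "A \<noteq> P"
    by blast
  then show ?thesis
  proof cases
    case 1
    then show ?thesis
      by (intro exI[of _ "{}"]) (auto simp: verts_def)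
  next
    case 2
    then show ?thesis
      using Q b by (intro exI[of _ Q]) (auto simp: bij_betw_def face_of_refl polytope_imp_convex)
  next
    case 3
    define \<F> where "\<F> = {F. F facet_of P \<and> A \<subseteq> F}"
    have A_eq: "A = \<Inter>\<F>"
      unfolding \<F>_def using P A 3 by (intro face_of_polyhedron) (auto simp: polytope_imp_polyhedron)
    have ne: "\<F> \<noteq> {}"
      using face_of_polyhedron_subset_facet[of P A] P A 3 
      by (auto simp: \<F>_def polytope_imp_polyhedron)
    obtain G where G: "\<And>F. F facet_of P \<Longrightarrow> G F facet_of Q \<and> verts (G F) = \<phi> ` verts F"
      using facets by metis
    have inj: "inj_on \<phi> (verts P)" and sur: "\<phi> ` verts P = verts Q"
      using b by (auto simp: bij_betw_def)
    define B where "B = \<Inter>(G ` \<F>)"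
    have B: "B face_of Q"
      unfolding B_def using ne G by (intro face_of_Inter) (auto simp: \<F>_def facet_of_imp_face_of)
    have mem: "\<phi> x \<in> G F \<longleftrightarrow> x \<in> F" if x: "x \<in> verts P" and F: "F \<in> \<F>" for x F
    proof -
      have "G F face_of Q" "F face_of P" "verts (G F) = \<phi> ` verts F"
        using F G by (auto simp: \<F>_def facet_of_imp_face_of)
      then have "verts Q \<inter> G F = \<phi> ` (verts P \<inter> F)"
        using verts_face by metis
      then have "\<phi> x \<in> G F \<longleftrightarrow> \<phi> x \<in> \<phi> ` (verts P \<inter> F)"
        using x sur by (metis IntD2 IntI imageI)
      also have "\<dots> \<longleftrightarrow> x \<in> F"
        using inj_on_image_mem_iff[OF inj x, of "verts P \<inter> F"] x by auto
      finally show ?thesis .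
    qed
    have "verts B = \<phi> ` verts A"
      unfolding verts_face[OF A] verts_face[OF B] sur[symmetric] 
      using mem by (auto simp: A_eq B_def)
    then show ?thesis
      using B by blast
  qed
qed

lemma combinatorially_isomorphic_facetsI:
  fixes P :: "'a::euclidean_space set" and Q :: "'a set"
  assumes P: "polytope P" and Q: "polytope Q" and b: "bij_betw \<phi> (verts P) (verts Q)"
    and 1: "\<And>F. F facet_of P \<Longrightarrow> \<exists>G. G facet_of Q \<and> verts G = \<phi> ` verts F"
    and 2: "\<And>G. G facet_of Q \<Longrightarrow> \<exists>F. F facet_of P \<and> verts G = \<phi> ` verts F"
  shows "combinatorially_isomorphic P Q"
  unfolding combinatorially_isomorphic_def
proof (rule inclusion_isomorphic_vertsI[OF P Q b])
  fix A assume "A \<in> faces P"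
  then show "\<exists>B\<in>faces Q. verts B = \<phi> ` verts A"
    using face_image_of_facets[OF P Q b 1] by (auto simp: faces_def)
next
  let ?\<psi> = "inv_into (verts P) \<phi>"
  fix B assume "B \<in> faces Q"
  then have B: "B face_of Q"
    by (simp add: faces_def)
  have inv1: "?\<psi> ` \<phi> ` verts A = verts A" if "A face_of P" for A
    using b that by (intro inv_into_image_cancel) (auto simp: bij_betw_def verts_face)
  have "\<exists>A. A face_of P \<and> verts A = ?\<psi> ` verts B"
    using face_image_of_facets[OF Q P bij_betw_inv_into[OF b] _ B] 2 inv1
    by (metis facet_of_imp_face_of)
  moreover have "\<phi> ` ?\<psi> ` verts B = verts B"
    using b B by (intro image_inv_into_cancel[of _ "verts P" "verts Q"]) (auto simp: bij_betw_def verts_face)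
  ultimately show "\<exists>A\<in>faces P. verts B = \<phi> ` verts A"
    by (metis faces_def mem_Collect_eq)
qed auto

text \<open>Along an edge between two simple vertices, the 2-faces through the edge match the remaining
  edges at one end with those at the other.\<close>

definition transports :: "'a::euclidean_space set \<Rightarrow> 'a set \<Rightarrow> ('a \<Rightarrow> 'a) \<Rightarrow> 'a set \<Rightarrow> bool"
  where "transports P Q \<phi> V \<longleftrightarrow> (\<forall>w\<in>V. \<forall>w'\<in>V. \<forall>x x' T.
    w' \<in> nbrs P w \<and> x \<in> nbrs P w \<and> x \<noteq> w' \<and> x' \<in> nbrs P w' \<and> x' \<noteq> w \<and>
    T face_of P \<and> aff_dim T = 2 \<and> {w, w', x, x'} \<subseteq> T \<longrightarrow>
    (\<exists>U. U face_of Q \<and> aff_dim U = 2 \<and> {\<phi> w, \<phi> w', \<phi> x, \<phi> x'} \<subseteq> U))"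

section \<open>Polygonal faces and the transport of a facet\<close>

lemma polygon_face_nbrs:
  assumes "polytope P" "T face_of P" "aff_dim T = 2" "v \<in> verts P" "v \<in> T"
  shows "card (nbrs P v \<inter> T) = 2"
proof -
  have "polytope T" "v \<in> verts T"
    using assms face_of_polytope_polytope by (auto simp: verts_face)
  then show ?thesis
    using polygon_two_nbrs[of T v] assms by (simp add: nbrs_face)
qed

lemma card_2_eqI:
  "card A = 2 \<Longrightarrow> x \<in> A \<Longrightarrow> y \<in> A \<Longrightarrow> x \<noteq> y \<Longrightarrow> A = {x, y}"
  by (auto simp: card_2_iff)

lemma polygon_subset_face:
  assumes P: "polytope P" and T: "T face_of P" "aff_dim T = 2" and F: "F face_of P"
    and v: "v \<in> verts P" "v \<in> T" "v \<in> F" 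
    and x: "x \<in> nbrs P v" "x \<in> T" "x \<in> F" and y: "y \<in> nbrs P v" "y \<in> T" "y \<in> F" "x \<noteq> y"
  shows "T \<subseteq> F"
proof -
  have "nbrs P v \<inter> T = {x, y}"
    using polygon_face_nbrs[OF P T v(1,2)] x y by (intro card_2_eqI) auto
  then show ?thesis
    using x y by (intro face_subset_nbrs[OF P T(1) F v]) auto
qed

lemma polygon_unique:
  assumes P: "polytope P" and T: "T face_of P" "aff_dim T = 2" and U: "U face_of P" "aff_dim U = 2"
    and v: "v \<in> verts P" "v \<in> T" "v \<in> U" 
    and x: "x \<in> nbrs P v" "x \<in> T" "x \<in> U" and y: "y \<in> nbrs P v" "y \<in> T" "y \<in> U" "x \<noteq> y"
  shows "T = U"
  using polygon_subset_face[OF P T U(1) v x y] polygon_subset_face[OF P U T(1) v(1,3,2)] x y by blast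

lemma simple_polygon_exists:
  assumes P: "polytope P" and v: "v \<in> verts P" "aff_dim P = int (card (nbrs P v))"
    and x: "x \<in> nbrs P v" and y: "y \<in> nbrs P v" "x \<noteq> y"
  obtains T where "T face_of P" "aff_dim T = 2" "v \<in> T" "nbrs P v \<inter> T = {x, y}"
proof -
  obtain T where "T face_of P" "v \<in> T" "nbrs P v \<inter> T = {x, y}" "aff_dim T = int (card {x, y})"
    using simple_vertex_face_exists[OF P v, of "{x, y}"] x y by (metis empty_subsetI insert_subset)
  then show ?thesis
    using that y by simp
qed

lemma facet_omits_one_nbr:
  assumes P: "polytope P" and v: "v \<in> verts P" and s: "aff_dim P = int (card (nbrs P v))"
    and F: "F facet_of P" "v \<in> F"
  shows "\<exists>x. nbrs P v - F = {x}"
proof -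
  have "card (nbrs P v \<inter> F) + 1 = card (nbrs P v)"
    using simple_vertex_face_dim[OF P v s _ F(2)] F(1) s by (auto simp: facet_of_def)
  then have "card (nbrs P v - F) = 1"
    using finite_nbrs[OF P, of v] card_Diff_subset_Int[of "nbrs P v" F] by auto
  then show ?thesis
    by (simp add: card_1_singleton_iff)
qed

text \<open>The 2-face \<open>T\<close> through the edge from \<open>w\<close> to \<open>w'\<close>
  and the omitted edge from \<open>w\<close> to \<open>x\<close> is not contained in
  \<open>F\<close>. Its second edge at \<open>w'\<close> must therefore leave \<open>F\<close>, for
  two edges of \<open>T\<close> in \<open>F\<close> would force \<open>T \<subseteq> F\<close>; so
  it is the edge omitted at \<open>w'\<close>. The 2-face \<open>U\<close> gives the same for
  \<open>G\<close>, starting from \<open>\<phi> x \<notin> G\<close>.\<close>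

lemma facet_transport_step:
  assumes P: "polytope P" and Q: "polytope Q"
    and dP: "aff_dim P = int d" and dQ: "aff_dim Q = int d"
    and iso: "graph_iso \<phi> P Q" and V: "V \<subseteq> verts P" "\<And>w. w \<in> V \<Longrightarrow> card (nbrs P w) = d"
    and tr: "transports P Q \<phi> V" and F: "F facet_of P" and G: "G facet_of Q"
    and w: "w \<in> V" "w \<in> F" "\<phi> w \<in> G" "\<And>y. y \<in> nbrs P w \<Longrightarrow> y \<in> F \<longleftrightarrow> \<phi> y \<in> G"
    and w': "w' \<in> V" "w' \<in> F" "w' \<in> nbrs P w"
  shows "\<phi> w' \<in> G" "\<And>y. y \<in> nbrs P w' \<Longrightarrow> y \<in> F \<longleftrightarrow> \<phi> y \<in> G"
proof -
  have Fd: "F face_of P" "aff_dim F = int d - 1" and Gd: "G face_of Q" "aff_dim G = int d - 1"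
    using F G dP dQ by (auto simp: facet_of_def)
  have \<phi>V: "\<phi> u \<in> verts Q" "card (nbrs Q (\<phi> u)) = d" "u \<in> verts P" if "u \<in> V" for u
    using V(2)[OF that] subsetD[OF V(1) that] graph_iso_card_nbrs[OF iso] graph_isoD(3)[OF iso] by auto
  have inj: "inj_on \<phi> (verts P)"
    using iso by (auto simp: graph_iso_def bij_betw_def)
  have one: "\<exists>x. nbrs P u - F = {x}" if "u \<in> V" "u \<in> F" for u
    using that V dP by (intro facet_omits_one_nbr[OF P _ _ F]) auto
  have oneQ: "\<exists>x. nbrs Q (\<phi> u) - G = {x}" if "u \<in> V" "\<phi> u \<in> G" for u
    using that \<phi>V dQ by (intro facet_omits_one_nbr[OF Q _ _ G]) auto
  show g': "\<phi> w' \<in> G"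
    using w w' by auto
  obtain x where x: "nbrs P w - F = {x}"
    using one w by blast
  have xw: "x \<in> nbrs P w" "x \<notin> F" "x \<noteq> w'"
    using x w' by auto
  obtain T where T: "T face_of P" "aff_dim T = 2" "w \<in> T" "nbrs P w \<inter> T = {x, w'}"
    using simple_polygon_exists[OF P, of w x w'] w(1) V dP xw w' by auto
  have w'T: "w' \<in> T" and xT: "x \<in> T"
    using T by auto
  have wn: "w \<in> nbrs P w'"
    using w' nbrs_sym by metis
  have "card (nbrs P w' \<inter> T) = 2"
    using polygon_face_nbrs[OF P T(1,2) _ w'T] w'(1) V by auto
  then obtain a b where ab: "nbrs P w' \<inter> T = {a, b}" "a \<noteq> b"
    by (auto simp: card_2_iff)
  moreover have "w \<in> nbrs P w' \<inter> T"
    using wn T(3) by blast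
  ultimately have "w = a \<or> w = b"
    by simp
  then obtain x' where x': "nbrs P w' \<inter> T = {w, x'}" "x' \<noteq> w"
    using ab by (metis insert_commute)
  then have x'n: "x' \<in> nbrs P w'" "x' \<in> T"
    by auto
  have "x' \<notin> F"
    using polygon_subset_face[OF P T(1,2) Fd(1), of w' w x'] x' x'n w w' V wn T w'T xT xw by auto
  then have oF: "nbrs P w' - F = {x'}"
    using one[OF w'(1,2)] x'n by (metis DiffI singletonD)
  obtain U where U: "U face_of Q" "aff_dim U = 2" "{\<phi> w, \<phi> w', \<phi> x, \<phi> x'} \<subseteq> U"
    using tr[unfolded transports_def, rule_format, of w w' x x' T] w(1) w' xw x'n x'(2) T(1-3) w'T xT
    by auto
  have nb: "\<phi> w \<in> nbrs Q (\<phi> w')" "\<phi> x' \<in> nbrs Q (\<phi> w')" "\<phi> x \<in> nbrs Q (\<phi> w)"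
    using wn x'n xw iso w(1) w'(1) V by (auto simp: graph_iso_def)
  have "\<phi> x \<notin> G"
    using w xw by auto
  have "\<phi> x' \<noteq> \<phi> w"
    using x'(2) inj inj_onD[OF inj, of x' w] x'n nbrs_verts w V by blast
  then have "\<phi> x' \<notin> G"
    using polygon_subset_face[OF Q U(1,2) Gd(1), of "\<phi> w'" "\<phi> w" "\<phi> x'"] nb U(3) w w' \<phi>V g' \<open>\<phi> x \<notin> G\<close> by auto
  then have oG: "nbrs Q (\<phi> w') - G = {\<phi> x'}"
    using oneQ[OF w'(1) g'] nb(2) by (metis DiffI singletonD)
  fix y assume y: "y \<in> nbrs P w'"
  show "y \<in> F \<longleftrightarrow> \<phi> y \<in> G"
  proof
    assume "y \<in> F"
    then have "y \<noteq> x'"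
      using \<open>x' \<notin> F\<close> by auto
    then have "\<phi> y \<noteq> \<phi> x'"
      using inj_onD[OF inj, of y x'] y x'n nbrs_verts by blast
    moreover have "\<phi> y \<in> nbrs Q (\<phi> w')"
      using y iso w' V by (auto simp: graph_iso_def)
    ultimately show "\<phi> y \<in> G"
      using oG by blast
  next
    assume "\<phi> y \<in> G"
    then show "y \<in> F"
      using oF y \<open>\<phi> x' \<notin> G\<close> by (metis DiffI singletonD)
  qed
qed

text \<open>The facet \<open>G\<close> is built from the images of the edges of \<open>F\<close> at
  one vertex \<open>w0\<close> of \<open>V\<close>, and the pattern of edges inside and outside the
  facet is carried along walks in \<open>F\<close> that stay in \<open>V\<close>. Only an inclusion
  results, since the walks do not control further vertices of \<open>G\<close>.\<close>

lemma facet_transport: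
  assumes P: "polytope P" and Q: "polytope Q"
    and dP: "aff_dim P = int d" and dQ: "aff_dim Q = int d" and d: "2 \<le> d"
    and iso: "graph_iso \<phi> P Q" and V: "V \<subseteq> verts P" "\<And>w. w \<in> V \<Longrightarrow> card (nbrs P w) = d"
    and few: "card (verts P - V) \<le> d - 2"
    and tr: "transports P Q \<phi> V" and F: "F facet_of P"
  shows "\<exists>G. G facet_of Q \<and> \<phi> ` verts F \<subseteq> verts G"
proof -
  have Fd: "F face_of P" "aff_dim F = int d - 1" "F \<noteq> {}"
    using F dP by (auto simp: facet_of_def)
  have pF: "polytope F"
    using P Fd face_of_polytope_polytope by blast
  define N where "N = verts F - V"
  have "N \<subseteq> verts P - V"
    unfolding N_def verts_face[OF Fd(1)] by auto
  then have N: "card N \<le> d - 2" "finite N"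
    using few finite_verts[OF P] by (meson card_mono finite_Diff finite_subset order_trans)+
  \<comment> \<open>A vertex of \<open>F\<close> has at least \<open>d - 1\<close> neighbours in
    \<open>F\<close>, more than there are vertices outside \<open>V\<close>. This provides a
    starting point and reaches the vertices that the walks avoid.\<close>
  have simple_nbr: "\<exists>w\<in>V. w \<in> nbrs P v \<and> w \<in> F" if v: "v \<in> verts F" for v
  proof -
    have "int d - 1 \<le> int (card (nbrs F v))"
      using aff_dim_le_card_nbrs[OF pF v] Fd by simp
    then have "card N < card (nbrs F v)"
      using N d by linarith
    then have "\<not> nbrs F v \<subseteq> N"
      using N card_mono by (metis not_less)
    then obtain w where "w \<in> nbrs F v" "w \<notin> N"
      by blast
    then have "w \<in> V" "w \<in> nbrs F v"
      using nbrs_subset_verts[of F v] by (auto simp: N_def)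
    moreover have "v \<in> F"
      using v verts_subset by blast
    ultimately show ?thesis
      using nbrs_face[OF Fd(1)] by blast
  qed
  obtain w0 where w0: "w0 \<in> V" "w0 \<in> F"
    using verts_nonempty[OF pF Fd(3)] simple_nbr by blast
  have w0P: "w0 \<in> verts P"
    using w0 V by auto
  have inj: "inj_on \<phi> (verts P)"
    using iso by (auto simp: graph_iso_def bij_betw_def)
  have c0: "card (nbrs Q (\<phi> w0)) = d" "\<phi> w0 \<in> verts Q"
    using graph_iso_card_nbrs[OF iso w0P] V w0 iso w0P by (auto simp: graph_iso_def bij_betw_def)
  have cF: "int d - 1 = int (card (nbrs P w0 \<inter> F))"
    using simple_vertex_face_dim[OF P w0P _ Fd(1) w0(2)] V w0 dP Fd by auto
  have im: "nbrs Q (\<phi> w0) = \<phi> ` nbrs P w0"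
    using iso w0P by (auto simp: graph_iso_def)
  obtain G where G: "G face_of Q" "\<phi> w0 \<in> G" "nbrs Q (\<phi> w0) \<inter> G = \<phi> ` (nbrs P w0 \<inter> F)"
    "aff_dim G = int (card (\<phi> ` (nbrs P w0 \<inter> F)))"
    using simple_vertex_face_exists[OF Q c0(2), of "\<phi> ` (nbrs P w0 \<inter> F)"] c0 dQ im by auto
  have "card (\<phi> ` (nbrs P w0 \<inter> F)) = card (nbrs P w0 \<inter> F)"
    using inj nbrs_subset_verts by (intro card_image inj_on_subset[OF inj]) blast
  then have "G facet_of Q"
    using G cF dQ by (auto simp: facet_of_def)
  have at_w0: "y \<in> F \<longleftrightarrow> \<phi> y \<in> G" if y: "y \<in> nbrs P w0" for y
  proof -
    have "\<phi> y \<in> G \<longleftrightarrow> \<phi> y \<in> \<phi> ` (nbrs P w0 \<inter> F)"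
      using G(3) y im by blast
    also have "\<dots> \<longleftrightarrow> y \<in> nbrs P w0 \<inter> F"
      using inj_on_image_mem_iff[OF inj] nbrs_verts y nbrs_subset_verts by (metis inf.coboundedI1)
    finally show ?thesis
      using y by auto
  qed
  have inv: "\<phi> w \<in> G \<and> (\<forall>y\<in>nbrs P w. y \<in> F \<longleftrightarrow> \<phi> y \<in> G)" if w: "w \<in> V" "w \<in> F" for w
  proof -
    have wF: "w \<in> verts F - N" "w0 \<in> verts F - N"
      using w w0 V by (auto simp: N_def verts_face[OF Fd(1)])
    have "(w0, w) \<in> (reach F N)\<^sup>*"
      using N d Fd(2) by (intro balinski[OF pF _ _ wF(2,1)]) (auto simp: N_def)
    then show ?thesis
    proof (induction rule: rtrancl_induct)
      case base
      then show ?case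
        using at_w0 G by auto
    next
      case (step y z)
      have yz: "y \<in> verts F" "y \<in> V" "z \<in> verts F" "z \<in> V" "z \<in> nbrs F y"
        using step(2) by (auto simp: reach_def N_def)
      then have "y \<in> F" "z \<in> F" "z \<in> nbrs P y"
        using verts_subset nbrs_face[OF Fd(1), of y] by blast+
      then show ?case
        using facet_transport_step[OF P Q dP dQ iso V tr F \<open>G facet_of Q\<close>, of y z] yz step(3)
        by blast
    qed
  qed
  have "\<phi> v \<in> G" if v: "v \<in> verts F" for v
  proof (cases "v \<in> V")
    case True
    then show ?thesis
      using inv v verts_subset by blast
  next
    case False
    obtain w where w: "w \<in> V" "w \<in> nbrs P v" "w \<in> F"
      using simple_nbr[OF v] by blast
    then have "v \<in> nbrs P w"
      using nbrs_sym by metis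
    then show ?thesis
      using inv[OF w(1,3)] v verts_subset by blast
  qed
  moreover have "\<phi> ` verts F \<subseteq> verts Q"
    using iso by (auto simp: graph_iso_def bij_betw_def verts_face[OF Fd(1)])
  ultimately have "\<phi> ` verts F \<subseteq> verts G"
    by (auto simp: verts_face[OF G(1)])
  then show ?thesis
    using \<open>G facet_of Q\<close> by blast
qed

text \<open>Each direction of transport gives only an inclusion. Going there and back puts a facet
  inside a facet, which by dimension is the same one, and so both inclusions are equalities.\<close>

theorem combinatorially_isomorphic_transports:
  assumes P: "polytope P" and Q: "polytope Q"
    and dP: "aff_dim P = int d" and dQ: "aff_dim Q = int d" and d: "2 \<le> d"
    and iso: "graph_iso \<phi> P Q" and V: "V \<subseteq> verts P" "\<And>w. w \<in> V \<Longrightarrow> card (nbrs P w) = d"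
    and few: "card (verts P - V) \<le> d - 2"
    and tr: "transports P Q \<phi> V" and tr': "transports Q P (inv_into (verts P) \<phi>) (\<phi> ` V)"
  shows "combinatorially_isomorphic P Q"
proof -
  let ?\<psi> = "inv_into (verts P) \<phi>"
  have b: "bij_betw \<phi> (verts P) (verts Q)" and inj: "inj_on \<phi> (verts P)" and sur: "\<phi> ` verts P = verts Q"
    using iso by (auto simp: graph_iso_def bij_betw_def)
  have "verts Q - \<phi> ` V = \<phi> ` (verts P - V)"
    using inj_on_image_set_diff[OF inj, of "verts P" V] V sur by auto
  then have few': "card (verts Q - \<phi> ` V) \<le> d - 2"
    using few card_image_le[of "verts P - V" \<phi>] finite_verts[OF P] by fastforce
  have V': "\<phi> ` V \<subseteq> verts Q" "\<And>w. w \<in> \<phi> ` V \<Longrightarrow> card (nbrs Q w) = d"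
    using V sur graph_iso_card_nbrs[OF iso] by auto
  have fwd: "\<exists>G. G facet_of Q \<and> \<phi> ` verts F \<subseteq> verts G" if "F facet_of P" for F
    by (rule facet_transport[OF P Q dP dQ d iso V few tr that])
  have bwd: "\<exists>F. F facet_of P \<and> ?\<psi> ` verts G \<subseteq> verts F" if "G facet_of Q" for G
    by (rule facet_transport[OF Q P dQ dP d graph_iso_inv[OF iso] V' few' tr' that])
  have facet_eq: "F = F'" if "F facet_of R" "F' facet_of R" "verts F \<subseteq> verts F'" "polytope R" for F F' R :: "'a set"
  proof -
    have "F \<subseteq> F'"
      using that face_subset_iff_verts[of F F'] verts_subset[of F'] face_of_polytope_polytope facet_of_imp_face_of
      by blast
    then have "F face_of F'"
      using that by (meson face_of_subset facet_of_imp_face_of facet_of_imp_subset)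
    then show ?thesis
      using that face_of_aff_dim_lt[of F' F] by (force simp: facet_of_def face_of_imp_convex)
  qed
  have \<psi>\<phi>: "?\<psi> ` \<phi> ` verts F = verts F" if "F facet_of P" for F
    by (rule inv_into_image_cancel[OF inj verts_face_subset[OF facet_of_imp_face_of[OF that]]])
  have \<phi>\<psi>: "\<phi> ` ?\<psi> ` verts G = verts G" if "G facet_of Q" for G
    by (rule image_inv_into_cancel[OF sur verts_face_subset[OF facet_of_imp_face_of[OF that]]])
  show ?thesis
  proof (rule combinatorially_isomorphic_facetsI[OF P Q b])
    fix F assume F: "F facet_of P"
    obtain G where G: "G facet_of Q" "\<phi> ` verts F \<subseteq> verts G"
      using fwd[OF F] by blast
    obtain F' where F': "F' facet_of P" "?\<psi> ` verts G \<subseteq> verts F'"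
      using bwd[OF G(1)] by blast
    have "verts F \<subseteq> verts F'"
      using G(2) F'(2) \<psi>\<phi>[OF F] by blast
    then have "F = F'"
      using facet_eq F F' P by blast
    then have "verts G = \<phi> ` verts F"
      using G F' \<phi>\<psi>[OF G(1)] by blast
    then show "\<exists>G. G facet_of Q \<and> verts G = \<phi> ` verts F"
      using G by blast
  next
    fix G assume G: "G facet_of Q"
    obtain F where F: "F facet_of P" "?\<psi> ` verts G \<subseteq> verts F"
      using bwd[OF G] by blast
    obtain G' where G': "G' facet_of Q" "\<phi> ` verts F \<subseteq> verts G'"
      using fwd[OF F(1)] by blast
    have "verts G \<subseteq> verts G'"
      using F(2) G'(2) \<phi>\<psi>[OF G] by blast
    then have "G = G'"
      using facet_eq G G' Q by blast
    then have "verts G = \<phi> ` verts F"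
      using F G' \<phi>\<psi>[OF G] by blast
    then show "\<exists>F. F facet_of P \<and> verts G = \<phi> ` verts F"
      using F by blast
  qed
qed

section \<open>Skeletons\<close>

lemma polytope_facet_exists_any_dim:
  assumes "polytope A" "A \<noteq> {}"
  obtains B where "B face_of A" "B \<noteq> A" "aff_dim B = aff_dim A - 1"
proof (cases "aff_dim A = 0")
  case True
  \<comment> \<open>The empty face, of dimension -1, plays the part of the facet of a point.\<close>
  then show ?thesis
    using that[of "{}"] assms by auto
next
  case False
  have "aff_dim A \<ge> 0"
    using assms(2) aff_dim_negative_iff not_less by blast
  then obtain B where "B facet_of A"
    using polytope_facet_exists[OF assms(1)] False by auto
  then show ?thesis
    using that[of B] facet_of_def facet_of_irrefl by metis
qed

text \<open>Descending one dimension at a time in \<open>\<A>\<close> makes the images shrink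
  strictly, each time by at least one dimension, until the empty face is reached.\<close>

lemma aff_dim_le_strict_mono:
  fixes P :: "'a::euclidean_space set" and Q :: "'b::euclidean_space set"
  assumes P: "polytope P" and Q: "polytope Q" and \<A>: "\<A> \<subseteq> faces P" and f: "f ` \<A> \<subseteq> faces Q"
    and down: "\<And>A B. A \<in> \<A> \<Longrightarrow> B face_of A \<Longrightarrow> B \<in> \<A>"
    and mono: "\<And>A B. A \<in> \<A> \<Longrightarrow> B \<in> \<A> \<Longrightarrow> A \<subset> B \<Longrightarrow> f A \<subset> f B"
    and A: "A \<in> \<A>"
  shows "aff_dim A \<le> aff_dim (f A)"
  using A
proof (induction "nat (aff_dim A + 1)" arbitrary: A rule: less_induct)
  case less
  show ?case
  proof (cases "A = {}")
    case True
    then show ?thesis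
      by (simp add: aff_dim_geq)
  next
    case False
    have "A face_of P"
      using less \<A> by (auto simp: faces_def)
    then have "polytope A"
      using P face_of_polytope_polytope by blast
    then obtain B where B: "B face_of A" "B \<noteq> A" "aff_dim B = aff_dim A - 1"
      using False polytope_facet_exists_any_dim by blast
    have "B \<in> \<A>" "B \<subset> A"
      using less down B face_of_imp_subset by blast+
    have "- 1 \<le> aff_dim B"
      by (rule aff_dim_geq)
    then have "aff_dim B \<le> aff_dim (f B)"
      using B \<open>B \<in> \<A>\<close> by (intro less(1)) auto
    moreover have "f B \<subset> f A"
      using mono less \<open>B \<in> \<A>\<close> \<open>B \<subset> A\<close> by blast
    moreover have "f A face_of Q" "f B face_of Q"
      using f less \<open>B \<in> \<A>\<close> by (auto simp: faces_def)
    ultimately have "aff_dim (f B) < aff_dim (f A)"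
      using Q by (intro face_of_aff_dim_lt) (auto intro: face_of_imp_convex face_of_subset dest: face_of_imp_subset)
    then show ?thesis
      using B \<open>aff_dim B \<le> aff_dim (f B)\<close> by simp
  qed
qed

text \<open>The preceding bound for \<open>f\<close> and for its inverse: the order alone determines
  the dimension.\<close>

lemma aff_dim_order_iso:
  fixes P :: "'a::euclidean_space set" and Q :: "'b::euclidean_space set"
  assumes P: "polytope P" and Q: "polytope Q" and \<A>: "\<A> \<subseteq> faces P" and \<B>: "\<B> \<subseteq> faces Q"
    and down: "\<And>A B. A \<in> \<A> \<Longrightarrow> B face_of A \<Longrightarrow> B \<in> \<A>" "\<And>A B. A \<in> \<B> \<Longrightarrow> B face_of A \<Longrightarrow> B \<in> \<B>"
    and f: "bij_betw f \<A> \<B>" "\<And>X Y. X \<in> \<A> \<Longrightarrow> Y \<in> \<A> \<Longrightarrow> X \<subseteq> Y \<longleftrightarrow> f X \<subseteq> f Y"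
    and A: "A \<in> \<A>"
  shows "aff_dim (f A) = aff_dim A"
proof (rule antisym)
  have fim: "f ` \<A> = \<B>" and inj: "inj_on f \<A>"
    using f by (auto simp: bij_betw_def)
  show "aff_dim A \<le> aff_dim (f A)"
    using A fim \<B> f(2) by (intro aff_dim_le_strict_mono[OF P Q \<A> _ down(1)]) (auto simp: less_le_not_le)
  let ?g = "inv_into \<A> f"
  have gf: "?g (f X) = X" if "X \<in> \<A>" for X
    using inj that by simp
  have "?g ` \<B> \<subseteq> faces P"
    using fim gf \<A> by auto
  moreover have "?g X \<subset> ?g Y" if XY: "X \<in> \<B>" "Y \<in> \<B>" "X \<subset> Y" for X Y
  proof -
    obtain U W where "U \<in> \<A>" "W \<in> \<A>" "X = f U" "Y = f W"
      using XY unfolding fim[symmetric] by blast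
    then show ?thesis
      using XY gf f(2) by (metis less_le_not_le)
  qed
  ultimately have "aff_dim (f A) \<le> aff_dim (?g (f A))"
    using A fim by (intro aff_dim_le_strict_mono[OF Q P \<B> _ down(2)]) auto
  then show "aff_dim (f A) \<le> aff_dim A"
    using gf A by simp
qed

lemma skeleton_down: "A \<in> skeleton k P \<Longrightarrow> B face_of A \<Longrightarrow> B \<in> skeleton k P"
  unfolding skeleton_def faces_def
  by (smt (verit) aff_dim_subset face_of_imp_subset face_of_trans mem_Collect_eq)

text \<open>Adjacency in terms of a face, its dimension and its vertex set, which is what a skeleton
  isomorphism preserves.\<close>

lemma nbrs_iff_edge:
  assumes "polytope P"
  shows "w \<in> nbrs P v \<longleftrightarrow> w \<noteq> v \<and> (\<exists>e. e face_of P \<and> aff_dim e = 1 \<and> verts e = {v, w})"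
proof
  assume w: "w \<in> nbrs P v"
  then show "w \<noteq> v \<and> (\<exists>e. e face_of P \<and> aff_dim e = 1 \<and> verts e = {v, w})"
  proof (intro conjI exI[of _ "closed_segment v w"])
    show "closed_segment v w face_of P" "aff_dim (closed_segment v w) = 1"
      using nbrs_edge[OF w] by (simp_all add: edge_of_def)
    show "verts (closed_segment v w) = {v, w}"
      unfolding verts_def extreme_point_of_segment by blast
  qed (use w nbrs_neq in blast)
next
  assume r: "w \<noteq> v \<and> (\<exists>e. e face_of P \<and> aff_dim e = 1 \<and> verts e = {v, w})"
  then obtain e where e: "e face_of P" "aff_dim e = 1" "verts e = {v, w}"
    by blast
  then have "e edge_of P" "v \<in> e" "v \<in> verts P"
    using verts_subset[of e] verts_face[OF e(1)] by (auto simp: edge_of_def)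
  then obtain u where u: "u \<in> nbrs P v" "e = closed_segment v u"
    using edge_segment[OF assms] by blast
  have "verts e = {v, u}"
    unfolding verts_def u(2) extreme_point_of_segment by blast
  then have "u = w"
    using e(3) r by (metis doubleton_eq_iff)
  then show "w \<in> nbrs P v"
    using u by simp
qed

text \<open>Dimensions are preserved, so points go to points, which defines \<open>\<phi>\<close>. A
  vertex lies in a face exactly if its singleton is below the face in the order, so vertex sets are
  carried along.\<close>

lemma skeleton_iso_graph_iso:
  fixes P Q :: "'a::euclidean_space set"
  assumes P: "polytope P" and Q: "polytope Q" and k: "1 \<le> k"
    and iso: "inclusion_isomorphic (skeleton k P) (skeleton k Q)"
  obtains \<phi> where "graph_iso \<phi> P Q"
    "\<And>A. A \<in> skeleton k P \<Longrightarrow> \<exists>B\<in>skeleton k Q. aff_dim B = aff_dim A \<and> verts B = \<phi> ` verts A"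
    "\<And>B. B \<in> skeleton k Q \<Longrightarrow> \<exists>A\<in>skeleton k P. aff_dim B = aff_dim A \<and> verts B = \<phi> ` verts A"
proof -
  obtain f where f: "bij_betw f (skeleton k P) (skeleton k Q)"
    and ord': "\<forall>X\<in>skeleton k P. \<forall>Y\<in>skeleton k P. X \<subseteq> Y \<longleftrightarrow> f X \<subseteq> f Y"
    using iso unfolding inclusion_isomorphic_def by blast
  have ord: "X \<subseteq> Y \<longleftrightarrow> f X \<subseteq> f Y" if "X \<in> skeleton k P" "Y \<in> skeleton k P" for X Y
    using ord' that by blast
  have fim: "f ` skeleton k P = skeleton k Q" and finj: "inj_on f (skeleton k P)"
    using f by (auto simp: bij_betw_def)
  have dim: "aff_dim (f A) = aff_dim A" if "A \<in> skeleton k P" for A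
    by (rule aff_dim_order_iso[OF P Q _ _ skeleton_down skeleton_down f ord that]) (auto simp: skeleton_def)
  have sing: "{v} \<in> skeleton k R \<longleftrightarrow> v \<in> verts R" for v and R :: "'a set"
    by (simp add: skeleton_def faces_def verts_def face_of_singleton)
  have "\<exists>y. f {v} = {y}" if "v \<in> verts P" for v
    using dim[of "{v}"] sing[of v P] that by (auto simp: aff_dim_eq_0)
  then obtain \<phi> where \<phi>: "\<And>v. v \<in> verts P \<Longrightarrow> f {v} = {\<phi> v}"
    by metis
  have \<phi>Q: "\<phi> v \<in> verts Q" if "v \<in> verts P" for v
    using \<phi>[OF that] fim sing that by (metis imageI)
  have sur: "\<exists>v\<in>verts P. y = \<phi> v" if y: "y \<in> verts Q" for y
  proof -
    have "{y} \<in> f ` skeleton k P"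
      using y sing fim by blast
    then obtain A where A: "A \<in> skeleton k P" "f A = {y}"
      by (metis imageE)
    then have "aff_dim A = 0"
      using dim[OF A(1)] by simp
    then obtain v where "A = {v}"
      by (auto simp: aff_dim_eq_0)
    then show ?thesis
      using A sing \<phi> by (metis singleton_inject)
  qed
  have inj: "inj_on \<phi> (verts P)"
  proof (rule inj_onI)
    fix v w assume vw: "v \<in> verts P" "w \<in> verts P" "\<phi> v = \<phi> w"
    then have "f {v} = f {w}"
      using \<phi> by simp
    then have "{v} = {w}"
      using finj vw sing by (meson inj_onD)
    then show "v = w"
      by simp
  qed
  have b: "bij_betw \<phi> (verts P) (verts Q)"
    unfolding bij_betw_def using inj sur \<phi>Q by blast
  have vf: "verts (f A) = \<phi> ` verts A" if A: "A \<in> skeleton k P" for A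
  proof -
    have AP: "A face_of P" "f A face_of Q"
      using A fim by (auto simp: skeleton_def faces_def)
    have mem: "\<phi> v \<in> f A \<longleftrightarrow> v \<in> A" if v: "v \<in> verts P" for v
      using ord[of "{v}" A] A v sing \<phi>[OF v] by auto
    have "verts (f A) = verts Q \<inter> f A"
      using verts_face[OF AP(2)] .
    also have "\<dots> = \<phi> ` (verts P \<inter> A)"
      using mem sur \<phi>Q by blast
    finally show ?thesis
      using verts_face[OF AP(1)] by simp
  qed
  have 1: "\<exists>B\<in>skeleton k Q. aff_dim B = aff_dim A \<and> verts B = \<phi> ` verts A" if "A \<in> skeleton k P" for A
    using that dim vf fim by blast
  have 2: "\<exists>A\<in>skeleton k P. aff_dim B = aff_dim A \<and> verts B = \<phi> ` verts A" if "B \<in> skeleton k Q" for B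
    using that dim vf fim by (metis imageE)
  have "nbrs Q (\<phi> x) = \<phi> ` nbrs P x" if x: "x \<in> verts P" for x
  proof (intro equalityI subsetI)
    fix y assume y: "y \<in> nbrs Q (\<phi> x)"
    then obtain e where e: "y \<noteq> \<phi> x" "e face_of Q" "aff_dim e = 1" "verts e = {\<phi> x, y}"
      using nbrs_iff_edge[OF Q] by blast
    then have "e \<in> skeleton k Q"
      using k by (auto simp: skeleton_def faces_def)
    then obtain A where A: "A \<in> skeleton k P" "aff_dim e = aff_dim A" "verts e = \<phi> ` verts A"
      using 2 by blast
    have AP: "A face_of P"
      using A by (auto simp: skeleton_def faces_def)
    obtain z where z: "z \<in> verts P" "y = \<phi> z"
      using sur y nbrs_verts by blast
    have "\<phi> ` verts A = \<phi> ` {x, z}"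
      using A(3) e(4) z by simp
    then have "verts A = {x, z}"
      using inj_on_image_eq_iff[OF inj, of "verts A" "{x, z}"] verts_face_subset[OF AP] x z by simp
    then have "z \<in> nbrs P x"
      using nbrs_iff_edge[OF P] A e AP z by force
    then show "y \<in> \<phi> ` nbrs P x"
      using z by blast
  next
    fix y assume "y \<in> \<phi> ` nbrs P x"
    then obtain z where z: "z \<in> nbrs P x" "y = \<phi> z"
      by blast
    then obtain e where e: "z \<noteq> x" "e face_of P" "aff_dim e = 1" "verts e = {x, z}"
      using nbrs_iff_edge[OF P] by blast
    then have "e \<in> skeleton k P"
      using k by (auto simp: skeleton_def faces_def)
    then obtain B where B: "B \<in> skeleton k Q" "aff_dim B = 1" "verts B = {\<phi> x, \<phi> z}"
      using 1 e by fastforce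
    moreover have "\<phi> z \<noteq> \<phi> x"
      using inj e(1) x z nbrs_verts by (metis inj_onD)
    ultimately show "y \<in> nbrs Q (\<phi> x)"
      using nbrs_iff_edge[OF Q] z by (auto simp: skeleton_def faces_def)
  qed
  then have "graph_iso \<phi> P Q"
    using b by (simp add: graph_iso_def)
  then show ?thesis
    using that 1 2 by blast
qed

section \<open>Reconstruction from the 2-skeleton\<close>

lemma simple_vertex_card_nbrs:
  assumes "d_polytope d P" "w \<in> verts P - nonsimple_vertices d P"
  shows "card (nbrs P w) = d"
proof -
  have "card (nbrs P w) \<le> d"
    using assms card_edges[of P w] by (auto simp: d_polytope_def nonsimple_vertices_def verts_def)
  moreover have "d \<le> card (nbrs P w)"
    using assms aff_dim_le_card_nbrs[of P w] by (auto simp: d_polytope_def)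
  ultimately show ?thesis
    by simp
qed

lemma transports_skeleton:
  assumes "graph_iso \<phi> P Q" "V \<subseteq> verts P"
    and "\<And>T. T face_of P \<Longrightarrow> aff_dim T = 2 \<Longrightarrow> \<exists>U. U face_of Q \<and> aff_dim U = 2 \<and> verts U = \<phi> ` verts T"
  shows "transports P Q \<phi> V"
  unfolding transports_def
proof (intro ballI allI impI)
  fix w w' x x' T
  assume *: "w \<in> V" "w' \<in> V" "w' \<in> nbrs P w \<and> x \<in> nbrs P w \<and> x \<noteq> w' \<and> x' \<in> nbrs P w' \<and> x' \<noteq> w \<and>
    T face_of P \<and> aff_dim T = 2 \<and> {w, w', x, x'} \<subseteq> T"
  then obtain U where U: "U face_of Q" "aff_dim U = 2" "verts U = \<phi> ` verts T"
    using assms(3) by blast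
  have "{w, w', x, x'} \<subseteq> verts P \<inter> T"
    using * assms(2) nbrs_verts by blast
  also have "\<dots> = verts T"
    using * verts_face by blast
  finally have "\<phi> ` {w, w', x, x'} \<subseteq> verts U"
    unfolding U(3) by (rule image_mono)
  then have "{\<phi> w, \<phi> w', \<phi> x, \<phi> x'} \<subseteq> U"
    using verts_subset[of U] by auto
  then show "\<exists>U. U face_of Q \<and> aff_dim U = 2 \<and> {\<phi> w, \<phi> w', \<phi> x, \<phi> x'} \<subseteq> U"
    using U by blast
qed

theorem reconstructible_from_2_skeleton:
  assumes P: "d_polytope d P" and d: "2 \<le> d" and k: "2 \<le> k"
    and few: "card (nonsimple_vertices d P) \<le> d - 2"
  shows "reconstructible k d P"
  unfolding reconstructible_def
proof (intro allI impI)
  fix Q :: "'a set"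
  assume Q: "d_polytope d Q \<and> inclusion_isomorphic (skeleton k P) (skeleton k Q)"
  have pP: "polytope P" "aff_dim P = int d" and pQ: "polytope Q" "aff_dim Q = int d"
    using P Q by (auto simp: d_polytope_def)
  obtain \<phi> where \<phi>: "graph_iso \<phi> P Q"
    and sk1: "\<And>A. A \<in> skeleton k P \<Longrightarrow> \<exists>B\<in>skeleton k Q. aff_dim B = aff_dim A \<and> verts B = \<phi> ` verts A"
    and sk2: "\<And>B. B \<in> skeleton k Q \<Longrightarrow> \<exists>A\<in>skeleton k P. aff_dim B = aff_dim A \<and> verts B = \<phi> ` verts A"
    using skeleton_iso_graph_iso[OF pP(1) pQ(1), of k] Q k by auto
  define V where "V = verts P - nonsimple_vertices d P"
  have V: "V \<subseteq> verts P" "\<And>w. w \<in> V \<Longrightarrow> card (nbrs P w) = d"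
    using simple_vertex_card_nbrs[OF P] by (auto simp: V_def)
  have "verts P - V = nonsimple_vertices d P"
    by (auto simp: V_def nonsimple_vertices_def verts_def)
  then have few': "card (verts P - V) \<le> d - 2"
    using few by simp
  have b: "bij_betw \<phi> (verts P) (verts Q)"
    using \<phi> by (simp add: graph_iso_def)
  have inV: "\<phi> ` V \<subseteq> verts Q"
    using V graph_isoD[OF \<phi>] by blast
  show "combinatorially_isomorphic P Q"
  proof (rule combinatorially_isomorphic_transports[OF pP(1) pQ(1) pP(2) pQ(2) d \<phi> V few'])
    show "transports P Q \<phi> V"
    proof (rule transports_skeleton[OF \<phi> V(1)])
      fix T assume "T face_of P" "aff_dim T = 2"
      then have "T \<in> skeleton k P"
        using k by (simp add: skeleton_def faces_def)
      then show "\<exists>U. U face_of Q \<and> aff_dim U = 2 \<and> verts U = \<phi> ` verts T"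
        using sk1 \<open>aff_dim T = 2\<close> by (fastforce simp: skeleton_def faces_def)
    qed
    show "transports Q P (inv_into (verts P) \<phi>) (\<phi> ` V)"
    proof (rule transports_skeleton[OF graph_iso_inv[OF \<phi>] inV])
      fix T assume "T face_of Q" "aff_dim T = 2"
      then have "T \<in> skeleton k Q"
        using k by (simp add: skeleton_def faces_def)
      then obtain A where A: "A \<in> skeleton k P" "aff_dim T = aff_dim A" "verts T = \<phi> ` verts A"
        using sk2 by blast
      then have "verts A \<subseteq> verts P" "A face_of P"
        by (auto simp: skeleton_def faces_def verts_face)
      then have "verts A = inv_into (verts P) \<phi> ` verts T"
        using A(3) b by (simp add: bij_betw_def)
      then show "\<exists>U. U face_of P \<and> aff_dim U = 2 \<and> verts U = inv_into (verts P) \<phi> ` verts T"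
        using A \<open>A face_of P\<close> \<open>aff_dim T = 2\<close> by auto
    qed
  qed
qed

section \<open>Heights and local maxima on 2-faces\<close>

text \<open>Finitely many hyperplanes do not cover the space.\<close>

lemma exists_nonorthogonal:
  fixes W :: "'b::euclidean_space set"
  assumes "finite W" "0 \<notin> W"
  shows "\<exists>c. \<forall>w\<in>W. c \<bullet> w \<noteq> 0"
  using assms
proof (induction W rule: finite_induct)
  case (insert w W)
  then obtain c where c: "\<forall>x\<in>W. c \<bullet> x \<noteq> 0"
    by auto
  \<comment> \<open>The values of \<open>t\<close> at which some vector becomes orthogonal to
    \<open>c + t *\<^sub>R w\<close>. Where \<open>w \<bullet> x = 0\<close> the quotient is 0,
    which merely excludes one more value.\<close>
  have "finite (insert (- (c \<bullet> w) / (w \<bullet> w)) ((\<lambda>x. - (c \<bullet> x) / (w \<bullet> x)) ` W))"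
    using insert by simp
  then obtain t where t: "t \<notin> insert (- (c \<bullet> w) / (w \<bullet> w)) ((\<lambda>x. - (c \<bullet> x) / (w \<bullet> x)) ` W)"
    using ex_new_if_finite[OF infinite_UNIV_char_0] by blast
  have "(c + t *\<^sub>R w) \<bullet> x \<noteq> 0" if x: "x \<in> insert w W" for x
  proof
    assume e: "(c + t *\<^sub>R w) \<bullet> x = 0"
    show False
    proof (cases "w \<bullet> x = 0")
      case True
      then show ?thesis
        using e c x insert by (auto simp: inner_add_left)
    next
      case False
      then have "t = - (c \<bullet> x) / (w \<bullet> x)"
        using e by (simp add: inner_add_left field_simps)
      then show ?thesis
        using t x by auto
    qed
  qed
  then show ?case
    by blast
qed simp

text \<open>Cross-multiplication turns a coincidence of two values into orthogonality of
  \<open>(\<mu>, \<mu>0)\<close> to a nonzero vector in the product of the space with the reals;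
  finitely many such conditions can be avoided at once.\<close>

lemma exists_injective_ratio:
  fixes V :: "'a::euclidean_space set"
  assumes "finite V" and pos: "\<And>x. x \<in> V \<Longrightarrow> 0 < \<beta> \<bullet> x + \<beta>0"
  shows "\<exists>\<mu> \<mu>0. inj_on (\<lambda>x. (\<mu> \<bullet> x + \<mu>0) / (\<beta> \<bullet> x + \<beta>0)) V"
proof -
  define b where "b x = \<beta> \<bullet> x + \<beta>0" for x
  define D where "D = (\<lambda>(x, y). (b y *\<^sub>R x - b x *\<^sub>R y, b y - b x)) ` {p \<in> V \<times> V. fst p \<noteq> snd p}"
  have "finite D"
    unfolding D_def using assms(1) by auto
  moreover have "0 \<notin> D"
  proof
    assume "0 \<in> D"
    then obtain x y where "x \<in> V" "x \<noteq> y" "(b y *\<^sub>R x - b x *\<^sub>R y, b y - b x) = (0, 0)"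
      unfolding D_def zero_prod_def by force
    then have xy: "x \<in> V" "x \<noteq> y" "b y *\<^sub>R x = b x *\<^sub>R y" "b y = b x"
      by auto
    moreover have "b x > 0"
      using pos[OF xy(1)] by (simp add: b_def)
    ultimately show False
      by simp
  qed
  ultimately have "\<exists>c. \<forall>w\<in>D. c \<bullet> w \<noteq> 0"
    by (rule exists_nonorthogonal)
  then obtain c where c: "\<And>w. w \<in> D \<Longrightarrow> c \<bullet> w \<noteq> 0"
    by auto
  have "inj_on (\<lambda>x. (fst c \<bullet> x + snd c) / b x) V"
  proof (rule inj_onI, rule ccontr)
    fix x y assume xy: "x \<in> V" "y \<in> V" "(fst c \<bullet> x + snd c) / b x = (fst c \<bullet> y + snd c) / b y" "x \<noteq> y"
    have "b x > 0" "b y > 0"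
      using pos xy by (auto simp: b_def)
    then have "b y * (fst c \<bullet> x + snd c) - b x * (fst c \<bullet> y + snd c) = 0"
      using xy(3) by (simp add: field_simps)
    then have "c \<bullet> (b y *\<^sub>R x - b x *\<^sub>R y, b y - b x) = 0"
      by (simp add: inner_prod_def inner_diff_right algebra_simps)
    moreover have "(b y *\<^sub>R x - b x *\<^sub>R y, b y - b x) \<in> D"
      using xy by (force simp: D_def)
    ultimately show False
      using c by blast
  qed
  then show ?thesis
    unfolding b_def by blast
qed

lemma eventually_less_perturbed:
  fixes r s m n :: real
  assumes "r < s"
  shows "eventually (\<lambda>\<epsilon>. r + \<epsilon> * m < s + \<epsilon> * n) (at_right 0)"
proof -
  have "((\<lambda>\<epsilon>. s + \<epsilon> * n - (r + \<epsilon> * m)) \<longlongrightarrow> s + 0 * n - (r + 0 * m)) (at_right 0)"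
    by (intro tendsto_intros)
  then have "eventually (\<lambda>\<epsilon>. 0 < s + \<epsilon> * n - (r + \<epsilon> * m)) (at_right 0)"
    using assms by (intro order_tendstoD) auto
  then show ?thesis
    by eventually_elim simp
qed

lemma exists_positive_perturbation:
  fixes m :: "'b \<Rightarrow> real"
  assumes "finite A" "\<And>p. p \<in> A \<Longrightarrow> r p < s p"
  shows "\<exists>\<epsilon>>0. \<forall>p\<in>A. r p + \<epsilon> * m p < s p + \<epsilon> * n p"
proof -
  have "eventually (\<lambda>\<epsilon>. \<forall>p\<in>A. r p + \<epsilon> * m p < s p + \<epsilon> * n p) (at_right 0)"
    using assms by (intro eventually_ball_finite ballI eventually_less_perturbed) auto
  moreover have "eventually (\<lambda>\<epsilon>::real. 0 < \<epsilon>) (at_right 0)"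
    by (simp add: eventually_at_right_less)
  ultimately have "eventually (\<lambda>\<epsilon>. 0 < \<epsilon> \<and> (\<forall>p\<in>A. r p + \<epsilon> * m p < s p + \<epsilon> * n p)) (at_right 0)"
    by eventually_elim simp
  then show ?thesis
    using eventually_happens'[OF trivial_limit_at_right_real] by blast
qed

text \<open>The perturbation is added to the numerator only, so the result is again a ratio with the
  same denominator. If small enough, it breaks ties and keeps every strict comparison.\<close>

lemma perturb_to_injective_ratio:
  fixes V :: "'a::euclidean_space set"
  assumes fin: "finite V" and pos: "\<And>x. x \<in> V \<Longrightarrow> 0 < \<beta> \<bullet> x + \<beta>0"
  obtains \<alpha>' \<alpha>0' where "inj_on (\<lambda>x. (\<alpha>' \<bullet> x + \<alpha>0') / (\<beta> \<bullet> x + \<beta>0)) V"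
    "\<And>x y. x \<in> V \<Longrightarrow> y \<in> V \<Longrightarrow> (\<alpha> \<bullet> x + \<alpha>0) / (\<beta> \<bullet> x + \<beta>0) < (\<alpha> \<bullet> y + \<alpha>0) / (\<beta> \<bullet> y + \<beta>0) \<Longrightarrow>
       (\<alpha>' \<bullet> x + \<alpha>0') / (\<beta> \<bullet> x + \<beta>0) < (\<alpha>' \<bullet> y + \<alpha>0') / (\<beta> \<bullet> y + \<beta>0)"
proof -
  define r where "r x = (\<alpha> \<bullet> x + \<alpha>0) / (\<beta> \<bullet> x + \<beta>0)" for x
  obtain \<mu> \<mu>0 where inj: "inj_on (\<lambda>x. (\<mu> \<bullet> x + \<mu>0) / (\<beta> \<bullet> x + \<beta>0)) V"
    using exists_injective_ratio[OF fin pos] by blast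
  define m where "m x = (\<mu> \<bullet> x + \<mu>0) / (\<beta> \<bullet> x + \<beta>0)" for x
  let ?A = "{p \<in> V \<times> V. r (fst p) < r (snd p)}"
  have "finite ?A"
    using fin by auto
  then have "\<exists>\<epsilon>>0. \<forall>p\<in>?A. r (fst p) + \<epsilon> * m (fst p) < r (snd p) + \<epsilon> * m (snd p)"
    by (rule exists_positive_perturbation) simp
  then obtain \<epsilon> where \<epsilon>: "\<epsilon> > 0" "\<And>p. p \<in> ?A \<Longrightarrow> r (fst p) + \<epsilon> * m (fst p) < r (snd p) + \<epsilon> * m (snd p)"
    by auto
  have mono: "r x + \<epsilon> * m x < r y + \<epsilon> * m y" if "x \<in> V" "y \<in> V" "r x < r y" for x y
    using \<epsilon>(2)[of "(x, y)"] that by simp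
  have eq: "((\<alpha> + \<epsilon> *\<^sub>R \<mu>) \<bullet> x + (\<alpha>0 + \<epsilon> * \<mu>0)) / (\<beta> \<bullet> x + \<beta>0) = r x + \<epsilon> * m x" for x
    by (simp add: r_def m_def inner_add_left algebra_simps add_divide_distrib)
  have "inj_on (\<lambda>x. r x + \<epsilon> * m x) V"
  proof (rule inj_onI, rule ccontr)
    fix x y assume xy: "x \<in> V" "y \<in> V" "r x + \<epsilon> * m x = r y + \<epsilon> * m y" "x \<noteq> y"
    then have "r x = r y"
      using mono[of x y] mono[of y x] by fastforce
    then have "m x = m y"
      using xy \<epsilon> by simp
    then show False
      using inj xy by (auto simp: m_def inj_on_def)
  qed
  then show ?thesis
    using that[of "\<alpha> + \<epsilon> *\<^sub>R \<mu>" "\<alpha>0 + \<epsilon> * \<mu>0"] mono unfolding eq r_def[symmetric] by blast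
qed

section \<open>Local maxima of linear-fractional heights\<close>

definition polygons :: "'a::euclidean_space set \<Rightarrow> 'a set set"
  where "polygons P = {T. T face_of P \<and> aff_dim T = 2}"

definition local_max :: "'a::euclidean_space set \<Rightarrow> ('a \<Rightarrow> real) \<Rightarrow> 'a set \<Rightarrow> 'a \<Rightarrow> bool"
  where "local_max P h T w \<longleftrightarrow> w \<in> verts P \<and> w \<in> T \<and> (\<forall>y\<in>nbrs P w \<inter> T. h y < h w)"

lemma finite_polygons: "polytope P \<Longrightarrow> finite (polygons P)"
  unfolding polygons_def using finite_polytope_faces by (rule rev_finite_subset) auto

text \<open>As denominators are positive, \<open>h x - h w\<close> has the sign of
  \<open>g \<bullet> x - g \<bullet> w\<close> for the fixed vector
  \<open>g = \<alpha> - h w *\<^sub>R \<beta>\<close>. So comparison with the value at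
  \<open>w\<close> is linear, and \<open>improving_nbr\<close> applies to \<open>T\<close>.\<close>

lemma local_max_ratio_imp_max:
  fixes P :: "'a::euclidean_space set"
  assumes P: "polytope P" and pos: "\<And>x. x \<in> P \<Longrightarrow> 0 < \<beta> \<bullet> x + \<beta>0"
    and T: "T face_of P" and w: "local_max P (\<lambda>x. (\<alpha> \<bullet> x + \<alpha>0) / (\<beta> \<bullet> x + \<beta>0)) T w" and y: "y \<in> T"
  shows "(\<alpha> \<bullet> y + \<alpha>0) / (\<beta> \<bullet> y + \<beta>0) \<le> (\<alpha> \<bullet> w + \<alpha>0) / (\<beta> \<bullet> w + \<beta>0)"
proof (rule ccontr)
  define h where "h x = (\<alpha> \<bullet> x + \<alpha>0) / (\<beta> \<bullet> x + \<beta>0)" for x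
  define g where "g = \<alpha> - h w *\<^sub>R \<beta>"
  have TP: "T \<subseteq> P" and pT: "polytope T"
    using T P face_of_imp_subset face_of_polytope_polytope by blast+
  have wT: "w \<in> T" "w \<in> verts T"
    using w T by (auto simp: local_max_def verts_face)
  have g: "g \<bullet> x - g \<bullet> w = (\<beta> \<bullet> x + \<beta>0) * (h x - h w)" if "x \<in> T" for x
  proof -
    have "(\<beta> \<bullet> x + \<beta>0) * h x = \<alpha> \<bullet> x + \<alpha>0" "(\<beta> \<bullet> w + \<beta>0) * h w = \<alpha> \<bullet> w + \<alpha>0"
      using pos[of x] pos[of w] that wT TP by (auto simp: h_def)
    then show ?thesis
      by (simp add: g_def inner_diff_left algebra_simps)
  qed
  assume "\<not> ?thesis"
  then have "h w < h y"
    by (simp add: h_def)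
  then have "g \<bullet> w < g \<bullet> y"
    using g[OF y] pos[of y] y TP by (smt (verit) mult_pos_pos subsetD)
  then obtain z where z: "z \<in> nbrs T w" "g \<bullet> w < g \<bullet> z"
    using improving_nbr[OF pT wT(2) y] by blast
  have "z \<in> nbrs P w \<inter> T"
    using z nbrs_face[OF T wT(1)] by simp
  then have "h z < h w" "z \<in> T"
    using w by (auto simp: local_max_def h_def)
  then show False
    using g[of z] z pos[of z] TP by (smt (verit) mult_pos_neg subsetD)
qed

text \<open>The clause on \<open>T\<close> serves to confine to \<open>T\<close> a 2-face found in
  the other polytope; uniqueness of local maxima on faces yields equality in the count.\<close>

definition geometric_height :: "'a::euclidean_space set \<Rightarrow> 'a set \<Rightarrow> 'a \<Rightarrow> 'a \<Rightarrow> ('a \<Rightarrow> real) \<Rightarrow> bool"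
  where "geometric_height P T z v h \<longleftrightarrow> inj_on h (verts P) \<and>
    (\<forall>x\<in>verts P. x \<noteq> z \<longrightarrow> h z < h x) \<and> (\<forall>x\<in>verts P. x \<noteq> v \<longrightarrow> h x < h v) \<and>
    (\<forall>x\<in>verts P \<inter> T. \<forall>y\<in>verts P - T. h x < h y) \<and>
    (\<forall>F x y. F face_of P \<longrightarrow> local_max P h F x \<longrightarrow> local_max P h F y \<longrightarrow> x = y)"

text \<open>The function is a ratio of two affine functions: after a projective transformation, any two
  vertices become the unique minimum and the unique maximum of a linear functional.\<close>

lemma exists_geometric_height:
  fixes P :: "'a::euclidean_space set"
  assumes P: "polytope P" and T: "T face_of P" and z: "z \<in> verts P" "z \<in> T" and v: "v \<in> verts P" "v \<notin> T"
  shows "\<exists>h. geometric_height P T z v h"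
proof -
  have expo: "\<exists>l l0. (\<forall>x\<in>P. 0 \<le> l \<bullet> x + l0) \<and> (\<forall>x\<in>P. l \<bullet> x + l0 = 0 \<longleftrightarrow> x \<in> F)" if "F face_of P" for F
  proof -
    have "F exposed_face_of P"
      using that P by (simp add: exposed_face_of_polyhedron polytope_imp_polyhedron)
    then obtain a b where "P \<subseteq> {x. a \<bullet> x \<le> b}" "F = P \<inter> {x. a \<bullet> x = b}"
      unfolding exposed_face_of_def by blast
    then show ?thesis
      by (intro exI[of _ "- a"] exI[of _ b]) auto
  qed
  obtain t t0 where t: "\<And>x. x \<in> P \<Longrightarrow> 0 \<le> t \<bullet> x + t0" "\<And>x. x \<in> P \<Longrightarrow> t \<bullet> x + t0 = 0 \<longleftrightarrow> x \<in> T"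
    using expo[OF T] by blast
  have "{z} face_of P" "{v} face_of P"
    using z v by (auto simp: verts_def face_of_singleton)
  then obtain p p0 q q0 where "\<forall>x\<in>P. 0 \<le> p \<bullet> x + p0" "\<forall>x\<in>P. p \<bullet> x + p0 = 0 \<longleftrightarrow> x \<in> {z}"
    "\<forall>x\<in>P. 0 \<le> q \<bullet> x + q0" "\<forall>x\<in>P. q \<bullet> x + q0 = 0 \<longleftrightarrow> x \<in> {v}"
    using expo[of "{z}"] expo[of "{v}"] by metis
  then have p: "\<And>x. x \<in> P \<Longrightarrow> 0 \<le> p \<bullet> x + p0" "\<And>x. x \<in> P \<Longrightarrow> p \<bullet> x + p0 = 0 \<longleftrightarrow> x = z"
    and q: "\<And>x. x \<in> P \<Longrightarrow> 0 \<le> q \<bullet> x + q0" "\<And>x. x \<in> P \<Longrightarrow> q \<bullet> x + q0 = 0 \<longleftrightarrow> x = v"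
    by auto
  define lT where "lT x = t \<bullet> x + t0" for x
  define lz where "lz x = p \<bullet> x + p0" for x
  define lv where "lv x = q \<bullet> x + q0" for x
  have VP: "x \<in> P" if "x \<in> verts P" for x
    using that verts_subset by blast
  \<comment> \<open>Inside \<open>T\<close> the numerator \<open>a\<close> defined below reduces to
    \<open>\<epsilon> * lz\<close>; at vertices outside it is at least \<open>lT\<close>, which is
    positive there. Such an \<epsilon> ranks all vertices of \<open>T\<close> below the
    rest.\<close>
  let ?A = "{a \<in> verts P \<times> verts P. fst a \<in> T \<and> snd a \<notin> T}"
  have "finite ?A"
    using finite_verts[OF P] by auto
  moreover have "0 < lT (snd a) * lv (fst a)" if "a \<in> ?A" for a
    using that t[of "snd a"] q[of "fst a"] VP v unfolding lT_def lv_def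
    by (intro mult_pos_pos) (auto simp: order_less_le)
  ultimately have "\<exists>\<epsilon>>0. \<forall>a\<in>?A.
    0 + \<epsilon> * (lz (fst a) * lv (snd a)) < lT (snd a) * lv (fst a) + \<epsilon> * 0"
    by (rule exists_positive_perturbation)
  then obtain \<epsilon> where \<epsilon>: "\<epsilon> > 0" 
    "\<And>a. a \<in> ?A \<Longrightarrow> 0 + \<epsilon> * (lz (fst a) * lv (snd a)) < lT (snd a) * lv (fst a) + \<epsilon> * 0"
    by blast
  define \<alpha> \<alpha>0 where "\<alpha> = t + \<epsilon> *\<^sub>R p" and "\<alpha>0 = t0 + \<epsilon> * p0"
  \<comment> \<open>Before the final perturbation the height is \<open>a / (a + lv)\<close>: 0
    exactly at \<open>z\<close>, 1 exactly at \<open>v\<close>, and otherwise ordered like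
    \<open>a / lv\<close>. Adding \<open>a\<close> to the denominator keeps it positive at
    \<open>v\<close> too.\<close>
  define \<beta> \<beta>0 where "\<beta> = \<alpha> + q" and "\<beta>0 = \<alpha>0 + q0"
  define a where "a x = \<alpha> \<bullet> x + \<alpha>0" for x
  have a_eq: "a x = lT x + \<epsilon> * lz x" for x
    by (simp add: a_def \<alpha>_def \<alpha>0_def lT_def lz_def inner_add_left algebra_simps)
  have b_eq: "\<beta> \<bullet> x + \<beta>0 = a x + lv x" for x
    by (simp add: a_def \<beta>_def \<beta>0_def lv_def inner_add_left algebra_simps)
  have a0: "0 \<le> a x" if "x \<in> P" for x
    using t(1)[OF that] p(1)[OF that] \<epsilon>(1) by (simp add: a_eq lT_def lz_def)
  have apos: "0 < a x" if "x \<in> P" "x \<noteq> z" for x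
  proof -
    have "0 < lz x"
      using p[OF that(1)] that(2) unfolding lz_def by (metis order_less_le)
    then show ?thesis
      using t(1)[OF that(1)] \<epsilon>(1) unfolding a_eq lT_def by (simp add: add_nonneg_pos)
  qed
  have lv0: "0 \<le> lv x" "lv x = 0 \<longleftrightarrow> x = v" if "x \<in> P" for x
    using q that by (auto simp: lv_def)
  have zv: "z \<noteq> v"
    using z v by auto
  have pos: "0 < \<beta> \<bullet> x + \<beta>0" if "x \<in> P" for x
    using apos[OF that] a0[OF that] lv0[OF that] zv unfolding b_eq by (cases "x = z") auto
  have az: "a z = 0"
    using t(2)[of z] p(2)[of z] z VP by (simp add: a_eq lT_def lz_def)
  obtain \<alpha>' \<alpha>0' where inj: "inj_on (\<lambda>x. (\<alpha>' \<bullet> x + \<alpha>0') / (\<beta> \<bullet> x + \<beta>0)) (verts P)"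
    and pert: "\<And>x y. x \<in> verts P \<Longrightarrow> y \<in> verts P \<Longrightarrow>
       (\<alpha> \<bullet> x + \<alpha>0) / (\<beta> \<bullet> x + \<beta>0) < (\<alpha> \<bullet> y + \<alpha>0) / (\<beta> \<bullet> y + \<beta>0) \<Longrightarrow>
       (\<alpha>' \<bullet> x + \<alpha>0') / (\<beta> \<bullet> x + \<beta>0) < (\<alpha>' \<bullet> y + \<alpha>0') / (\<beta> \<bullet> y + \<beta>0)"
    using perturb_to_injective_ratio[of "verts P" \<beta> \<beta>0 \<alpha> \<alpha>0] finite_verts[OF P] pos VP by blast
  define h where "h x = (\<alpha>' \<bullet> x + \<alpha>0') / (\<beta> \<bullet> x + \<beta>0)" for x
  have less: "h x < h y" if "x \<in> verts P" "y \<in> verts P" "a x * lv y < a y * lv x" for x y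
  proof -
    have "a x / (\<beta> \<bullet> x + \<beta>0) < a y / (\<beta> \<bullet> y + \<beta>0)"
      using pos[of x] pos[of y] that VP unfolding b_eq by (simp add: frac_less_eq field_simps)
    then show ?thesis
      using pert that by (simp add: a_def h_def)
  qed
  have v_lv: "lv v = 0"
    using lv0 v VP by blast
  have zmin: "h z < h x" if "x \<in> verts P" "x \<noteq> z" for x
    using that z apos[of x] lv0[of z] zv VP az by (intro less) (auto simp: order_less_le)
  have vmax: "h x < h v" if "x \<in> verts P" "x \<noteq> v" for x
    using that v v_lv apos[of v] lv0[of x] zv VP by (intro less) (auto simp: order_less_le)
  have Tinit: "h x < h y" if "x \<in> verts P" "x \<in> T" "y \<in> verts P" "y \<notin> T" for x y
  proof (rule less)
    have "a x * lv y = \<epsilon> * (lz x * lv y)"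
      using t(2)[of x] that VP by (simp add: a_eq lT_def)
    also have "\<dots> < lT y * lv x"
      using \<epsilon>(2)[of "(x, y)"] that by simp
    also have "\<dots> \<le> a y * lv x"
      using lv0[of x] p(1)[of y] \<epsilon>(1) that VP by (intro mult_right_mono) (auto simp: a_eq lz_def)
    finally show "a x * lv y < a y * lv x" .
  qed (use that in auto)
  have "x = y" if "F face_of P" "local_max P h F x" "local_max P h F y" for F x y
  proof -
    have "h x \<le> h y" "h y \<le> h x"
      using local_max_ratio_imp_max[OF P pos that(1), of \<alpha>' \<alpha>0'] that unfolding h_def[symmetric] h_def[abs_def, symmetric]
      by (auto simp: local_max_def)
    then show ?thesis
      using inj that unfolding h_def[symmetric] by (auto simp: local_max_def inj_on_def)
  qed
  moreover have "inj_on h (verts P)"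
    using inj unfolding h_def[symmetric] .
  ultimately have "geometric_height P T z v h"
    unfolding geometric_height_def using zmin vmax Tinit by blast
  then show ?thesis
    by blast
qed

section \<open>Counting local maxima on 2-faces\<close>

definition lower_nbrs :: "'a::euclidean_space set \<Rightarrow> ('a \<Rightarrow> real) \<Rightarrow> 'a \<Rightarrow> 'a set"
  where "lower_nbrs P h w = {y \<in> nbrs P w. h y < h w}"

definition tips :: "'a::euclidean_space set \<Rightarrow> ('a \<Rightarrow> real) \<Rightarrow> 'a set \<Rightarrow> 'a set \<Rightarrow> 'a set"
  where "tips P h V T = {w \<in> V. local_max P h T w}"

text \<open>Only the graph and \<open>h\<close> enter, so a transported height has the same score in
  the other polytope. The link to 2-faces is \<open>card_polygons_local_max\<close>, which holds at
  simple vertices.\<close>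

definition score :: "'a::euclidean_space set \<Rightarrow> ('a \<Rightarrow> real) \<Rightarrow> 'a set \<Rightarrow> nat"
  where "score P h V = (\<Sum>w\<in>V. card (lower_nbrs P h w) choose 2)"

text \<open>At a simple vertex each pair of neighbours spans exactly one 2-face, and
  \<open>w\<close> is its local maximum exactly if both neighbours are lower.\<close>

lemma card_polygons_local_max:
  assumes P: "polytope P" and w: "w \<in> verts P" and s: "aff_dim P = int (card (nbrs P w))"
  shows "card {T \<in> polygons P. local_max P h T w} = card (lower_nbrs P h w) choose 2"
proof -
  let ?A = "{T \<in> polygons P. local_max P h T w}" and ?B = "{S. S \<subseteq> lower_nbrs P h w \<and> card S = 2}"
  have "bij_betw (\<lambda>T. nbrs P w \<inter> T) ?A ?B"
    unfolding bij_betw_def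
  proof
    show "inj_on (\<lambda>T. nbrs P w \<inter> T) ?A"
      using face_eq_nbrs[OF P _ _ w] by (auto simp: inj_on_def polygons_def local_max_def)
    show "(\<lambda>T. nbrs P w \<inter> T) ` ?A = ?B"
    proof (intro equalityI subsetI)
      fix S assume "S \<in> (\<lambda>T. nbrs P w \<inter> T) ` ?A"
      then show "S \<in> ?B"
        using polygon_face_nbrs[OF P _ _ w] by (auto simp: polygons_def local_max_def lower_nbrs_def)
    next
      fix S assume S: "S \<in> ?B"
      then have "S \<subseteq> nbrs P w"
        by (auto simp: lower_nbrs_def)
      then obtain T where T: "T face_of P" "w \<in> T" "nbrs P w \<inter> T = S" "aff_dim T = int (card S)"
        using simple_vertex_face_exists[OF P w s] by blast
      then have "T \<in> ?A"
        using S w by (auto simp: polygons_def local_max_def lower_nbrs_def)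
      then show "S \<in> (\<lambda>T. nbrs P w \<inter> T) ` ?A"
        using T by blast
    qed
  qed
  then have "card ?A = card ?B"
    by (rule bij_betw_same_card)
  also have "\<dots> = card (lower_nbrs P h w) choose 2"
    using finite_nbrs[OF P, of w] by (intro n_subsets) (simp add: lower_nbrs_def)
  finally show ?thesis .
qed

lemma score_eq_sum_tips:
  assumes P: "polytope P" and V: "V \<subseteq> verts P" "\<And>w. w \<in> V \<Longrightarrow> aff_dim P = int (card (nbrs P w))"
  shows "score P h V = (\<Sum>T\<in>polygons P. card (tips P h V T))"
proof -
  have fin: "finite V" "finite (polygons P)"
    using P V finite_verts finite_subset finite_polygons by blast+
  have "score P h V = (\<Sum>w\<in>V. card {T \<in> polygons P. local_max P h T w})"
    unfolding score_def using card_polygons_local_max[OF P] V by (intro sum.cong) (auto simp: subset_iff)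
  also have "\<dots> = (\<Sum>w\<in>V. \<Sum>T\<in>polygons P. if local_max P h T w then 1 else 0)"
    using fin by (simp add: sum.If_cases Int_def)
  also have "\<dots> = (\<Sum>T\<in>polygons P. \<Sum>w\<in>V. if local_max P h T w then 1 else 0)"
    by (rule sum.swap)
  also have "\<dots> = (\<Sum>T\<in>polygons P. card (tips P h V T))"
    using fin by (simp add: sum.If_cases Int_def tips_def)
  finally show ?thesis .
qed

definition regular :: "'a::euclidean_space set \<Rightarrow> ('a \<Rightarrow> real) \<Rightarrow> 'a \<Rightarrow> 'a \<Rightarrow> 'a set \<Rightarrow> bool"
  where "regular P h u v T \<longleftrightarrow> v \<notin> T \<and> \<not> local_max P h T u"

text \<open>The equality case of \<open>score_ge_regular\<close>, face by face.\<close>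

definition tame :: "'a::euclidean_space set \<Rightarrow> ('a \<Rightarrow> real) \<Rightarrow> 'a \<Rightarrow> 'a \<Rightarrow> bool"
  where "tame P h u v \<longleftrightarrow> (\<forall>T\<in>polygons P. card (tips P h (verts P - {u, v}) T) = (if regular P h u v T then 1 else 0))"

definition topped :: "'a::euclidean_space set \<Rightarrow> ('a \<Rightarrow> real) \<Rightarrow> 'a \<Rightarrow> bool"
  where "topped P h v \<longleftrightarrow> inj_on h (verts P) \<and> v \<in> verts P \<and> (\<forall>x\<in>verts P. x \<noteq> v \<longrightarrow> h x < h v)"

lemma polygon_max_exists:
  assumes P: "polytope P" and T: "T \<in> polygons P" and h: "inj_on h (verts P)"
  obtains x where "x \<in> verts T" "local_max P h T x" "\<And>y. y \<in> verts T \<Longrightarrow> h y \<le> h x"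
proof -
  have TP: "T face_of P" and "T \<noteq> {}"
    using T by (auto simp: polygons_def)
  have pT: "polytope T"
    using TP P face_of_polytope_polytope by blast
  then obtain x where x: "x \<in> verts T" "\<And>y. y \<in> verts T \<Longrightarrow> h y \<le> h x"
    using obtain_max_on[OF finite_verts[OF pT] verts_nonempty[OF pT \<open>T \<noteq> {}\<close>], of h] by blast
  have "local_max P h T x"
    unfolding local_max_def
  proof (intro conjI ballI)
    show "x \<in> verts P" "x \<in> T"
      using x TP by (auto simp: verts_face)
    fix y assume y: "y \<in> nbrs P x \<inter> T"
    then have "y \<in> verts T" "y \<noteq> x"
      using TP nbrs_verts[of y P x] nbrs_neq[of y P x] by (auto simp: verts_face)
    then have "h y \<le> h x" "h y \<noteq> h x"
      using x h TP by (auto simp: inj_on_def verts_face)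
    then show "h y < h x"
      by simp
  qed
  then show ?thesis
    using that x by blast
qed

lemma finite_tips: "polytope P \<Longrightarrow> finite (tips P h (verts P - {u, v}) T)"
  by (simp add: tips_def finite_verts)

lemma regular_tip_exists:
  assumes P: "polytope P" and T: "T \<in> polygons P" and h: "topped P h v" and r: "regular P h u v T"
  shows "tips P h (verts P - {u, v}) T \<noteq> {}"
proof -
  have "inj_on h (verts P)"
    using h by (simp add: topped_def)
  then obtain x where x: "x \<in> verts T" "local_max P h T x"
    using polygon_max_exists[OF P T] by blast
  have "x \<noteq> v" "x \<noteq> u"
    using x r by (auto simp: regular_def local_max_def)
  then show ?thesis
    using x by (auto simp: tips_def local_max_def)
qed

lemma card_regular:
  assumes P: "polytope P" 
  shows "card {T \<in> polygons P. regular P h u v T} = (\<Sum>T\<in>polygons P. if regular P h u v T then 1 else 0)"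
  using finite_polygons[OF P] by (simp add: sum.If_cases Int_def)

lemma tips_ge:
  assumes P: "polytope P" and T: "T \<in> polygons P" and h: "topped P h v"
  shows "(if regular P h u v T then 1 else 0) \<le> card (tips P h (verts P - {u, v}) T)"
  using regular_tip_exists[OF P T h] finite_tips[OF P] by (auto simp: Suc_le_eq card_gt_0_iff)

lemma score_ge_regular:
  assumes P: "polytope P" and s: "\<And>w. w \<in> verts P - {u, v} \<Longrightarrow> aff_dim P = int (card (nbrs P w))"
    and h: "topped P h v"
  shows "card {T \<in> polygons P. regular P h u v T} \<le> score P h (verts P - {u, v})"
proof -
  have "score P h (verts P - {u, v}) = (\<Sum>T\<in>polygons P. card (tips P h (verts P - {u, v}) T))"
    using s by (intro score_eq_sum_tips[OF P]) auto
  then show ?thesis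
    unfolding card_regular[OF P] using tips_ge[OF P _ h] by (simp add: sum_mono)
qed

text \<open>The sums compare term by term, so they are equal only if all terms are.\<close>

lemma tame_iff_score:
  assumes P: "polytope P" and s: "\<And>w. w \<in> verts P - {u, v} \<Longrightarrow> aff_dim P = int (card (nbrs P w))"
    and h: "topped P h v"
  shows "tame P h u v \<longleftrightarrow> score P h (verts P - {u, v}) = card {T \<in> polygons P. regular P h u v T}"
proof -
  have e: "score P h (verts P - {u, v}) = (\<Sum>T\<in>polygons P. card (tips P h (verts P - {u, v}) T))"
    using s by (intro score_eq_sum_tips[OF P]) auto
  show ?thesis
  proof
    assume "tame P h u v"
    then show "score P h (verts P - {u, v}) = card {T \<in> polygons P. regular P h u v T}"
      unfolding e card_regular[OF P] tame_def by (intro sum.cong) auto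
  next
    assume "score P h (verts P - {u, v}) = card {T \<in> polygons P. regular P h u v T}"
    then have "(\<Sum>T\<in>polygons P. if regular P h u v T then 1 else 0) = 
        (\<Sum>T\<in>polygons P. card (tips P h (verts P - {u, v}) T))"
      unfolding e card_regular[OF P] by simp
    then have "(if regular P h u v T then 1 else 0) = card (tips P h (verts P - {u, v}) T)" 
      if T: "T \<in> polygons P" for T
      by (rule sum_mono_inv[OF _ tips_ge[OF P _ h] T finite_polygons[OF P]])
    then show "tame P h u v"
      unfolding tame_def by auto
  qed
qed

text \<open>A 2-face that is not regular has a local maximum at \<open>u\<close> or
  \<open>v\<close>; by uniqueness it has no other, hence no tip.\<close>

lemma geometric_tame:
  assumes P: "polytope P" and h: "topped P h v"
    and unique: "\<And>F x y. F face_of P \<Longrightarrow> local_max P h F x \<Longrightarrow> local_max P h F y \<Longrightarrow> x = y"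
  shows "tame P h u v"
  unfolding tame_def
proof
  fix T assume T: "T \<in> polygons P"
  then have TP: "T face_of P"
    by (simp add: polygons_def)
  show "card (tips P h (verts P - {u, v}) T) = (if regular P h u v T then 1 else 0)"
  proof (cases "regular P h u v T")
    case True
    then obtain x where "x \<in> tips P h (verts P - {u, v}) T"
      using regular_tip_exists[OF P T h] by blast
    then have "tips P h (verts P - {u, v}) T = {x}"
      using unique[OF TP] by (auto simp: tips_def)
    then show ?thesis
      using True by simp
  next
    case False
    have "local_max P h T v" if "v \<in> T"
      using h that nbrs_verts[of _ P v] nbrs_neq[of _ P v] by (auto simp: local_max_def topped_def)
    then have "local_max P h T u \<or> local_max P h T v"
      using False by (auto simp: regular_def)
    then have "tips P h (verts P - {u, v}) T = {}"
      using unique[OF TP] by (auto simp: tips_def)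
    then show ?thesis
      using False by simp
  qed
qed

text \<open>At each of its points \<open>X\<close> contains both neighbours within the polygon, so
  it is closed under adjacency in a connected graph.\<close>

lemma polygon_vertex_subset_eq:
  assumes P: "polytope P" and T: "T \<in> polygons P" and X: "X \<subseteq> verts T" "X \<noteq> {}"
    and two: "\<And>x. x \<in> X \<Longrightarrow> 2 \<le> card (nbrs P x \<inter> X)"
  shows "X = verts T"
proof
  show "verts T \<subseteq> X"
  proof
    fix y assume y: "y \<in> verts T"
    have TP: "T face_of P" "aff_dim T = 2"
      using T by (auto simp: polygons_def)
    have pT: "polytope T"
      using TP P face_of_polytope_polytope by blast
    obtain x where "x \<in> X"
      using X by blast
    then have "(x, y) \<in> (reach T {})\<^sup>*"
      using polytope_graph_connected[OF pT] X y by blast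
    then show "y \<in> X"
    proof (induction rule: rtrancl_induct)
      case base
      then show ?case
        using \<open>x \<in> X\<close> .
    next
      case (step a b)
      have a: "a \<in> verts T" "a \<in> T"
        using step X verts_subset by blast+
      have "nbrs P a \<inter> X \<subseteq> nbrs T a"
        using X verts_subset nbrs_face[OF TP(1) a(2)] by blast
      moreover have "card (nbrs T a) = 2"
        using polygon_two_nbrs[OF pT TP(2) a(1)] .
      ultimately have "nbrs P a \<inter> X = nbrs T a"
        using two[OF step(3)] finite_nbrs[OF pT] by (metis card_seteq)
      then show ?case
        using step by (auto simp: reach_def)
    qed
  qed
qed (rule X)

section \<open>Recognising 2-faces in the presence of two exceptional vertices\<close>

locale exceptional_pair =
  fixes d :: nat and P Q :: "'a::euclidean_space set" and \<phi> :: "'a \<Rightarrow> 'a" and u v :: 'a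
  assumes P: "polytope P" and Q: "polytope Q" and dP: "aff_dim P = int d" and dQ: "aff_dim Q = int d"
    and iso: "graph_iso \<phi> P Q" and u: "u \<in> verts P" and v: "v \<in> verts P" and uv: "u \<noteq> v"
    and simple: "\<And>w. w \<in> verts P - {u, v} \<Longrightarrow> card (nbrs P w) = d"
begin

lemma inj: "inj_on \<phi> (verts P)" and sur: "\<phi> ` verts P = verts Q"
  using graph_isoD[OF iso] by auto

text \<open>Together with \<open>inverse\<close> this allows \<open>u\<close> and \<open>v\<close>,
  or \<open>P\<close> and \<open>Q\<close>, to change roles; bounds proved in one direction thereby
  become equalities.\<close>

lemma swap: "exceptional_pair d P Q \<phi> v u"
  using P Q dP dQ iso u v uv simple by unfold_locales auto

lemma image_minus: "verts Q - {\<phi> u, \<phi> v} = \<phi> ` (verts P - {u, v})"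
  using inj u v sur by (auto simp: inj_on_def)

lemma inverse: "exceptional_pair d Q P (inv_into (verts P) \<phi>) (\<phi> u) (\<phi> v)"
proof
  show "card (nbrs Q w) = d" if "w \<in> verts Q - {\<phi> u, \<phi> v}" for w
    using that graph_iso_card_nbrs[OF iso] simple unfolding image_minus by auto
  show "\<phi> u \<noteq> \<phi> v"
    using inj u v uv by (auto simp: inj_on_def)
qed (use P Q dP dQ graph_iso_inv[OF iso] u v sur in auto)

lemma sP: "w \<in> verts P - {u, v} \<Longrightarrow> aff_dim P = int (card (nbrs P w))"
  using simple dP by simp

lemma sQ: "w \<in> verts Q - {\<phi> u, \<phi> v} \<Longrightarrow> aff_dim Q = int (card (nbrs Q w))"
  using exceptional_pair.sP[OF inverse] .

text \<open>A relation between the two heights, so that it can also be read from \<open>Q\<close> to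
  \<open>P\<close>.\<close>

definition compatible :: "('a \<Rightarrow> real) \<Rightarrow> ('a \<Rightarrow> real) \<Rightarrow> bool"
  where "compatible h h' \<longleftrightarrow> (\<forall>x\<in>verts P. h' (\<phi> x) = h x)"

lemma compatible_exists: "compatible h (h \<circ> inv_into (verts P) \<phi>)"
  using inj by (simp add: compatible_def)

lemma score_compatible:
  assumes "compatible h h'"
  shows "score Q h' (verts Q - {\<phi> u, \<phi> v}) = score P h (verts P - {u, v})"
proof -
  have "card (lower_nbrs Q h' (\<phi> w)) = card (lower_nbrs P h w)" if w: "w \<in> verts P" for w
  proof -
    have "lower_nbrs Q h' (\<phi> w) = \<phi> ` lower_nbrs P h w"
      using assms iso w nbrs_verts[of _ P w] by (auto simp: lower_nbrs_def graph_iso_def compatible_def)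
    moreover have "inj_on \<phi> (lower_nbrs P h w)"
      using inj by (rule inj_on_subset) (use nbrs_subset_verts[of P w] in \<open>auto simp: lower_nbrs_def\<close>)
    ultimately show ?thesis
      by (simp add: card_image)
  qed
  moreover have "inj_on \<phi> (verts P - {u, v})"
    using inj by (rule inj_on_subset) auto
  ultimately show ?thesis
    unfolding score_def image_minus by (subst sum.reindex) auto
qed

lemma topped_compatible:
  assumes "compatible h h'" "topped P h v"
  shows "topped Q h' (\<phi> v)"
  using assms inj by (auto simp: topped_def compatible_def sur[symmetric] inj_on_def)

text \<open>Let \<open>U\<close> be the 2-face of \<open>Q\<close> at the simple vertex
  \<open>\<phi> x\<close> spanned by the images of the two edges of \<open>T\<close> at its top
  \<open>x\<close>. By tameness \<open>\<phi> x\<close> is the only tip of \<open>U\<close>, hence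
  its highest vertex. The vertices of \<open>P\<close> mapped into \<open>U\<close> are thus no
  higher than \<open>x\<close>, so they lie in the initial set \<open>T\<close>, and having two
  neighbours each among themselves they exhaust the polygon.\<close>

lemma recognise_polygon:
  assumes c: "compatible h h'" and tameQ: "tame Q h' (\<phi> u) (\<phi> v)" and h: "topped P h v"
    and T: "T \<in> polygons P" and init: "\<And>x y. x \<in> verts P \<Longrightarrow> x \<in> T \<Longrightarrow> y \<in> verts P \<Longrightarrow> y \<notin> T \<Longrightarrow> h x < h y"
    and x: "local_max P h T x" "\<And>y. y \<in> verts T \<Longrightarrow> h y \<le> h x" "x \<noteq> u" "x \<noteq> v"
  shows "\<exists>U\<in>polygons Q. verts U = \<phi> ` verts T"
proof -
  have TP: "T face_of P" "aff_dim T = 2"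
    using T by (auto simp: polygons_def)
  have xv: "x \<in> verts P" "x \<in> T" "\<phi> x \<in> verts Q" "\<phi> x \<in> verts Q - {\<phi> u, \<phi> v}"
    using x sur unfolding image_minus by (auto simp: local_max_def)
  have h': "topped Q h' (\<phi> v)"
    using topped_compatible[OF c h] .
  have "card (nbrs P x \<inter> T) = 2"
    using polygon_face_nbrs[OF P TP xv(1,2)] .
  then obtain y z where yz: "nbrs P x \<inter> T = {y, z}" "y \<noteq> z"
    unfolding card_2_iff by blast
  then have yzn: "y \<in> nbrs P x" "z \<in> nbrs P x" "y \<in> T" "z \<in> T"
    by auto
  then have yzP: "y \<in> verts P" "z \<in> verts P"
    using nbrs_verts by auto
  have yzQ: "\<phi> y \<in> nbrs Q (\<phi> x)" "\<phi> z \<in> nbrs Q (\<phi> x)" "\<phi> y \<noteq> \<phi> z"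
    using iso yzn xv(1) inj yz(2) yzP by (auto simp: graph_iso_def inj_on_def)
  obtain U where U: "U face_of Q" "aff_dim U = 2" "\<phi> x \<in> U" "nbrs Q (\<phi> x) \<inter> U = {\<phi> y, \<phi> z}"
    using simple_polygon_exists[OF Q xv(3) sQ[OF xv(4)] yzQ] by blast
  have UQ: "U \<in> polygons Q"
    using U by (simp add: polygons_def)
  have "h y < h x" "h z < h x"
    using x(1) yzn by (auto simp: local_max_def)
  then have lmU: "local_max Q h' U (\<phi> x)"
    unfolding local_max_def U(4) using xv U(3) c yzP by (auto simp: compatible_def)
  then have tip: "\<phi> x \<in> tips Q h' (verts Q - {\<phi> u, \<phi> v}) U"
    using xv by (simp add: tips_def)
  then have "card (tips Q h' (verts Q - {\<phi> u, \<phi> v}) U) \<noteq> 0"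
    using finite_tips[OF Q] by (metis card_0_eq empty_iff)
  then have reg: "regular Q h' (\<phi> u) (\<phi> v) U" and one: "card (tips Q h' (verts Q - {\<phi> u, \<phi> v}) U) = 1"
    using tameQ UQ by (auto simp: tame_def split: if_splits)
  obtain m where m: "m \<in> verts U" "local_max Q h' U m" "\<And>y. y \<in> verts U \<Longrightarrow> h' y \<le> h' m"
    using polygon_max_exists[OF Q UQ] h' by (auto simp: topped_def)
  have "m \<in> tips Q h' (verts Q - {\<phi> u, \<phi> v}) U"
    using m(2) reg by (auto simp: tips_def regular_def local_max_def)
  then have "m = \<phi> x"
    using one tip by (metis card_1_singletonE singletonD)
  define X where "X = {a \<in> verts P. \<phi> a \<in> U}"
  have XU: "\<phi> ` X = verts U"
    using sur verts_face[OF U(1)] by (auto simp: X_def)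
  have "X \<subseteq> verts T"
  proof
    fix a assume a: "a \<in> X"
    then have "\<phi> a \<in> verts U" "a \<in> verts P"
      using XU by (auto simp: X_def)
    then have "h' (\<phi> a) \<le> h' (\<phi> x)"
      using m(3) \<open>m = \<phi> x\<close> by blast
    then have "h a \<le> h x"
      using c \<open>a \<in> verts P\<close> xv by (simp add: compatible_def)
    then have "a \<in> T"
      using init[OF xv(1,2) \<open>a \<in> verts P\<close>] by fastforce
    then show "a \<in> verts T"
      using \<open>a \<in> verts P\<close> verts_face[OF TP(1)] by simp
  qed
  moreover have "x \<in> X"
    using xv U by (simp add: X_def)
  moreover have "2 \<le> card (nbrs P a \<inter> X)" if a: "a \<in> X" for a
  proof -
    have aP: "a \<in> verts P" "\<phi> a \<in> U"
      using a by (auto simp: X_def)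
    have "card (nbrs Q (\<phi> a) \<inter> U) = 2"
      using aP sur by (intro polygon_face_nbrs[OF Q U(1,2)]) auto
    moreover have "nbrs Q (\<phi> a) \<inter> U = \<phi> ` (nbrs P a \<inter> X)"
      using iso aP nbrs_verts[of _ P a] by (auto simp: graph_iso_def X_def)
    moreover have "card (\<phi> ` (nbrs P a \<inter> X)) \<le> card (nbrs P a \<inter> X)"
      using finite_nbrs[OF P] by (intro card_image_le) auto
    ultimately show ?thesis
      by simp
  qed
  ultimately have "X = verts T"
    using polygon_vertex_subset_eq[OF P T] by blast
  then show ?thesis
    using XU UQ by blast
qed

lemma regular_bottom:
  assumes b: "\<forall>x\<in>verts P. x \<noteq> u \<longrightarrow> h u < h x"
  shows "{T \<in> polygons P. regular P h u v T} = {T \<in> polygons P. v \<notin> T}"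
proof -
  have "\<not> local_max P h T u" if "T \<in> polygons P" for T
  proof
    assume l: "local_max P h T u"
    then have "card (nbrs P u \<inter> T) = 2"
      using polygon_face_nbrs[OF P] that by (auto simp: polygons_def local_max_def)
    then obtain y where "y \<in> nbrs P u \<inter> T"
      by (metis card.empty ex_in_conv zero_neq_numeral)
    then show False
      using l b nbrs_verts[of y P u] nbrs_neq[of y P u] unfolding local_max_def
      by (metis IntD1 less_asym)
  qed
  then show ?thesis
    by (auto simp: regular_def)
qed

lemma bottom_compatible:
  assumes "compatible h h'" "\<forall>x\<in>verts P. x \<noteq> u \<longrightarrow> h u < h x"
  shows "\<forall>x\<in>verts Q. x \<noteq> \<phi> u \<longrightarrow> h' (\<phi> u) < h' x"
proof (intro ballI impI)
  fix y assume "y \<in> verts Q" "y \<noteq> \<phi> u"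
  then obtain x where "x \<in> verts P" "x \<noteq> u" "y = \<phi> x"
    using sur by blast
  then show "h' (\<phi> u) < h' y"
    using assms u by (simp add: compatible_def)
qed

text \<open>For a geometric height of \<open>P\<close> with \<open>u\<close> at the bottom, the
  common score equals the number for \<open>P\<close> by tameness and is an upper bound for the
  number for \<open>Q\<close>.\<close>

lemma card_polygons_avoiding_le: "card {T \<in> polygons Q. \<phi> v \<notin> T} \<le> card {T \<in> polygons P. v \<notin> T}"
proof -
  have uf: "{u} face_of P"
    using u by (simp add: verts_def face_of_singleton)
  obtain h where "geometric_height P {u} u v h"
    using exists_geometric_height[OF P uf u _ v] uv by blast
  then have h: "inj_on h (verts P)" "\<forall>x\<in>verts P. x \<noteq> u \<longrightarrow> h u < h x"
    "\<And>F x y. F face_of P \<Longrightarrow> local_max P h F x \<Longrightarrow> local_max P h F y \<Longrightarrow> x = y"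
    and top: "topped P h v"
    using v by (auto simp: geometric_height_def topped_def)
  obtain h' where c: "compatible h h'"
    using compatible_exists by blast
  have "card {T \<in> polygons Q. \<phi> v \<notin> T} = card {T \<in> polygons Q. regular Q h' (\<phi> u) (\<phi> v) T}"
    using exceptional_pair.regular_bottom[OF inverse] bottom_compatible[OF c h(2)] by simp
  also have "\<dots> \<le> score Q h' (verts Q - {\<phi> u, \<phi> v})"
    using score_ge_regular[OF Q sQ topped_compatible[OF c top]] .
  also have "\<dots> = score P h (verts P - {u, v})"
    using score_compatible[OF c] .
  also have "\<dots> = card {T \<in> polygons P. regular P h u v T}"
    using tame_iff_score[OF P sP top] geometric_tame[OF P top h(3)] by simp
  also have "\<dots> = card {T \<in> polygons P. v \<notin> T}"
    using regular_bottom[OF h(2)] by simp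
  finally show ?thesis .
qed

lemma inverse_inverse: "x \<in> verts P \<Longrightarrow> inv_into (verts P) \<phi> (\<phi> x) = x"
  using inj by simp

lemma card_polygons_avoiding: "card {T \<in> polygons Q. \<phi> v \<notin> T} = card {T \<in> polygons P. v \<notin> T}"
  using card_polygons_avoiding_le exceptional_pair.card_polygons_avoiding_le[OF inverse] inverse_inverse[OF v]
  by simp

text \<open>With \<open>u\<close> at the bottom both numbers of regular 2-faces are known to agree.
  Hence the transported height is tame on \<open>Q\<close>, although it need not be
  linear-fractional there.\<close>

lemma recognise_polygon_through:
  assumes T: "T \<in> polygons P" "u \<in> T" "v \<notin> T"
  shows "\<exists>U\<in>polygons Q. verts U = \<phi> ` verts T"
proof -
  have TP: "T face_of P"
    using T by (simp add: polygons_def)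
  obtain h where "geometric_height P T u v h"
    using exists_geometric_height[OF P TP u T(2) v T(3)] by blast
  then have h: "inj_on h (verts P)" "\<forall>x\<in>verts P. x \<noteq> u \<longrightarrow> h u < h x"
    "\<And>x y. x \<in> verts P \<Longrightarrow> x \<in> T \<Longrightarrow> y \<in> verts P \<Longrightarrow> y \<notin> T \<Longrightarrow> h x < h y"
    "\<And>F x y. F face_of P \<Longrightarrow> local_max P h F x \<Longrightarrow> local_max P h F y \<Longrightarrow> x = y"
    and top: "topped P h v"
    using v by (auto simp: geometric_height_def topped_def)
  obtain h' where c: "compatible h h'"
    using compatible_exists by blast
  have "score Q h' (verts Q - {\<phi> u, \<phi> v}) = score P h (verts P - {u, v})"
    using score_compatible[OF c] .
  also have "\<dots> = card {T \<in> polygons P. regular P h u v T}"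
    using tame_iff_score[OF P sP top] geometric_tame[OF P top h(4)] by simp
  also have "\<dots> = card {T \<in> polygons Q. \<phi> v \<notin> T}"
    using regular_bottom[OF h(2)] card_polygons_avoiding by simp
  also have "\<dots> = card {T \<in> polygons Q. regular Q h' (\<phi> u) (\<phi> v) T}"
    using exceptional_pair.regular_bottom[OF inverse] bottom_compatible[OF c h(2)] by simp
  finally have tameQ: "tame Q h' (\<phi> u) (\<phi> v)"
    using tame_iff_score[OF Q sQ topped_compatible[OF c top]] by simp
  obtain x where x: "x \<in> verts T" "local_max P h T x" "\<And>y. y \<in> verts T \<Longrightarrow> h y \<le> h x"
    using polygon_max_exists[OF P T(1) h(1)] by blast
  have "x \<noteq> u"
    using regular_bottom[OF h(2)] T x(2) by (auto simp: regular_def)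
  moreover have "x \<noteq> v"
    using x T by (auto simp: local_max_def)
  ultimately show ?thesis
    using recognise_polygon[OF c tameQ top T(1) h(3) x(2,3)] by blast
qed

lemma mem_face_image:
  assumes "T face_of P" "U face_of Q" "verts U = \<phi> ` verts T" "a \<in> verts P"
  shows "\<phi> a \<in> U \<longleftrightarrow> a \<in> T"
proof -
  have "\<phi> a \<in> U \<longleftrightarrow> \<phi> a \<in> verts U"
    using assms(4) sur verts_face[OF assms(2)] by auto
  also have "\<dots> \<longleftrightarrow> a \<in> verts T"
    unfolding assms(3) using inj_on_image_mem_iff[OF inj assms(4) verts_face_subset[OF assms(1)]] .
  also have "\<dots> \<longleftrightarrow> a \<in> T"
    using assms(4) verts_face[OF assms(1)] by simp
  finally show ?thesis .
qed

lemma local_max_compatible: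
  assumes c: "compatible h h'" and T: "T face_of P" and U: "U face_of Q" "verts U = \<phi> ` verts T" and w: "w \<in> verts P"
  shows "local_max Q h' U (\<phi> w) \<longleftrightarrow> local_max P h T w"
proof -
  note mem = mem_face_image[OF T U]
  have "nbrs Q (\<phi> w) \<inter> U = \<phi> ` (nbrs P w \<inter> T)"
    using iso w mem nbrs_verts[of _ P w] by (auto simp: graph_iso_def)
  then show ?thesis
    using c w mem sur nbrs_verts[of _ P w] by (auto simp: local_max_def compatible_def)
qed

text \<open>These are the 2-faces missing from the count when \<open>u\<close> is not the minimum.
  They contain \<open>u\<close> and avoid \<open>v\<close>, so
  \<open>recognise_polygon_through\<close> already finds them in \<open>Q\<close>.\<close>

lemma card_polygons_peak_le:
  assumes c: "compatible h h'"
  shows "card {T \<in> polygons P. v \<notin> T \<and> local_max P h T u} \<le>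
    card {T \<in> polygons Q. \<phi> v \<notin> T \<and> local_max Q h' T (\<phi> u)}" (is "card ?A \<le> card ?B")
proof -
  have "\<exists>U\<in>polygons Q. verts U = \<phi> ` verts T" if "T \<in> ?A" for T
    using that recognise_polygon_through by (auto simp: local_max_def)
  then obtain f where f: "\<And>T. T \<in> ?A \<Longrightarrow> f T \<in> polygons Q \<and> verts (f T) = \<phi> ` verts T"
    by metis
  have "inj_on f ?A"
  proof (rule inj_onI)
    fix S T assume ST: "S \<in> ?A" "T \<in> ?A" "f S = f T"
    then have STP: "S face_of P" "T face_of P"
      by (auto simp: polygons_def)
    have "\<phi> ` verts S = \<phi> ` verts T"
      using f[OF ST(1)] f[OF ST(2)] ST(3) by simp
    then have "verts S = verts T"
      using inj_on_image_eq_iff[OF inj verts_face_subset verts_face_subset] STP by blast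
    then show "S = T"
      using face_eqI_verts[OF P STP] by blast
  qed
  moreover have "f ` ?A \<subseteq> ?B"
  proof
    fix U assume "U \<in> f ` ?A"
    then obtain T where T: "T \<in> ?A" "U = f T"
      by blast
    then have TP: "T face_of P" "v \<notin> T" "local_max P h T u"
      and UQ: "U \<in> polygons Q" "U face_of Q" "verts U = \<phi> ` verts T"
      using f by (auto simp: polygons_def)
    have "\<phi> v \<notin> U"
      using mem_face_image[OF TP(1) UQ(2,3) v] TP(2) by simp
    then show "U \<in> ?B"
      using local_max_compatible[OF c TP(1) UQ(2,3) u] TP(3) UQ(1) by blast
  qed
  moreover have "finite ?B"
    using finite_polygons[OF Q] by simp
  ultimately show ?thesis
    by (meson card_inj_on_le)
qed

lemma compatible_inverse:
  assumes "compatible h h'"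
  shows "exceptional_pair.compatible Q (inv_into (verts P) \<phi>) h' h"
  unfolding exceptional_pair.compatible_def[OF inverse]
  using assms inj by (auto simp: compatible_def sur[symmetric])

lemma card_polygons_peak:
  assumes c: "compatible h h'"
  shows "card {T \<in> polygons Q. \<phi> v \<notin> T \<and> local_max Q h' T (\<phi> u)} =
    card {T \<in> polygons P. v \<notin> T \<and> local_max P h T u}"
  using card_polygons_peak_le[OF c] inverse_inverse[OF v] inverse_inverse[OF u]
    exceptional_pair.card_polygons_peak_le[OF inverse compatible_inverse[OF c]]
  by simp

lemma card_regular_eq:
  "card {T \<in> polygons P. regular P h u v T} =
    card {T \<in> polygons P. v \<notin> T} - card {T \<in> polygons P. v \<notin> T \<and> local_max P h T u}"
proof -
  have "{T \<in> polygons P. regular P h u v T} =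
      {T \<in> polygons P. v \<notin> T} - {T \<in> polygons P. v \<notin> T \<and> local_max P h T u}"
    by (auto simp: regular_def)
  then show ?thesis
    using finite_polygons[OF P] by (simp add: card_Diff_subset Collect_mono_iff)
qed

lemma card_regular_compatible:
  assumes c: "compatible h h'"
  shows "card {T \<in> polygons Q. regular Q h' (\<phi> u) (\<phi> v) T} = card {T \<in> polygons P. regular P h u v T}"
  unfolding card_regular_eq exceptional_pair.card_regular_eq[OF inverse]
  using card_polygons_peak[OF c] card_polygons_avoiding by simp

text \<open>Since the number of regular 2-faces is now known for every height, the minimum may be
  any vertex of \<open>T\<close>, also when \<open>u\<close> is outside \<open>T\<close>.\<close>

lemma recognise_polygon_avoiding:
  assumes T: "T \<in> polygons P" "v \<notin> T"
  shows "\<exists>U\<in>polygons Q. verts U = \<phi> ` verts T"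
proof (cases "u \<in> T")
  case True
  then show ?thesis
    using recognise_polygon_through T by blast
next
  case False
  have TP: "T face_of P" "T \<noteq> {}"
    using T by (auto simp: polygons_def)
  then obtain z where "z \<in> verts T"
    using verts_nonempty face_of_polytope_polytope[OF P] by blast
  then have z: "z \<in> verts P" "z \<in> T"
    using TP by (auto simp: verts_face)
  obtain h where "geometric_height P T z v h"
    using exists_geometric_height[OF P TP(1) z v T(2)] by blast
  then have h: "inj_on h (verts P)" "\<forall>x\<in>verts P. x \<noteq> z \<longrightarrow> h z < h x"
    "\<And>x y. x \<in> verts P \<Longrightarrow> x \<in> T \<Longrightarrow> y \<in> verts P \<Longrightarrow> y \<notin> T \<Longrightarrow> h x < h y"
    "\<And>F x y. F face_of P \<Longrightarrow> local_max P h F x \<Longrightarrow> local_max P h F y \<Longrightarrow> x = y"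
    and top: "topped P h v"
    using v by (auto simp: geometric_height_def topped_def)
  obtain h' where c: "compatible h h'"
    using compatible_exists by blast
  have "score Q h' (verts Q - {\<phi> u, \<phi> v}) = card {T \<in> polygons P. regular P h u v T}"
    using score_compatible[OF c] tame_iff_score[OF P sP top] geometric_tame[OF P top h(4)] by simp
  then have tameQ: "tame Q h' (\<phi> u) (\<phi> v)"
    using tame_iff_score[OF Q sQ topped_compatible[OF c top]] card_regular_compatible[OF c] by simp
  obtain x where x: "x \<in> verts T" "local_max P h T x" "\<And>y. y \<in> verts T \<Longrightarrow> h y \<le> h x"
    using polygon_max_exists[OF P T(1) h(1)] by blast
  have "x \<noteq> u" "x \<noteq> v"
    using x T False by (auto simp: local_max_def)
  then show ?thesis
    using recognise_polygon[OF c tameQ top T(1) h(3) x(2,3)] by blast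
qed

lemma recognise_polygon_missing_one:
  assumes "T \<in> polygons P" "u \<notin> T \<or> v \<notin> T"
  shows "\<exists>U\<in>polygons Q. verts U = \<phi> ` verts T"
  using assms recognise_polygon_avoiding exceptional_pair.recognise_polygon_avoiding[OF swap] by blast

end

context exceptional_pair
begin

lemma recognise_polygon_back:
  assumes U: "U \<in> polygons Q" "\<phi> u \<notin> U \<or> \<phi> v \<notin> U"
  shows "\<exists>T\<in>polygons P. verts U = \<phi> ` verts T"
proof -
  obtain T where T: "T \<in> polygons P" "verts T = inv_into (verts P) \<phi> ` verts U"
    using exceptional_pair.recognise_polygon_missing_one[OF inverse U] by blast
  have "verts U \<subseteq> verts Q"
    using U by (auto simp: polygons_def verts_face)
  then have "\<phi> ` verts T = verts U"
    unfolding T(2) by (rule image_inv_into_cancel[OF sur])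
  then show ?thesis
    using T by blast
qed

text \<open>A 2-face through both exceptional vertices and a given edge is unique, so its image is found
  by elimination among the 2-faces through the image of that edge.\<close>

lemma transports: "transports P Q \<phi> (verts P - {u, v})"
  unfolding transports_def
proof (intro ballI allI impI)
  fix w w' x x' T
  assume ww: "w \<in> verts P - {u, v}" "w' \<in> verts P - {u, v}"
    and "w' \<in> nbrs P w \<and> x \<in> nbrs P w \<and> x \<noteq> w' \<and> x' \<in> nbrs P w' \<and> x' \<noteq> w \<and>
      T face_of P \<and> aff_dim T = 2 \<and> {w, w', x, x'} \<subseteq> T"
  then have n: "w' \<in> nbrs P w" "x \<in> nbrs P w" "x \<noteq> w'" "x' \<in> nbrs P w'" "x' \<noteq> w"
    and T: "T face_of P" "aff_dim T = 2" "w \<in> T" "w' \<in> T" "x \<in> T" "x' \<in> T"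
    by auto
  have wP: "w \<in> verts P" "w' \<in> verts P" and xP: "x \<in> verts P" "x' \<in> verts P"
    using ww n nbrs_verts by auto
  have wn: "w \<in> nbrs P w'"
    using n(1) nbrs_sym by metis
  have Q_nbr: "\<phi> b \<in> nbrs Q (\<phi> a)" if "b \<in> nbrs P a" "a \<in> verts P" for a b
    using that iso by (auto simp: graph_iso_def)
  have neq: "\<phi> a \<noteq> \<phi> b" if "a \<noteq> b" "a \<in> verts P" "b \<in> verts P" for a b
    using that inj by (auto simp: inj_on_def)
  have TP: "T \<in> polygons P"
    using T by (simp add: polygons_def)
  show "\<exists>U. U face_of Q \<and> aff_dim U = 2 \<and> {\<phi> w, \<phi> w', \<phi> x, \<phi> x'} \<subseteq> U"
  proof (cases "u \<notin> T \<or> v \<notin> T")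
    case True
    then obtain U where U: "U \<in> polygons Q" "verts U = \<phi> ` verts T"
      using recognise_polygon_missing_one[OF TP] by blast
    then have "U face_of Q" "aff_dim U = 2"
      by (auto simp: polygons_def)
    then show ?thesis
      using mem_face_image[OF T(1) _ U(2)] T wP xP by auto
  next
    case False
    then have uvT: "u \<in> T" "v \<in> T"
      by auto
    have wQ: "\<phi> w \<in> verts Q" "\<phi> w \<in> verts Q - {\<phi> u, \<phi> v}" "\<phi> w' \<in> verts Q"
      using ww sur unfolding image_minus by auto
    obtain U where U: "U face_of Q" "aff_dim U = 2" "\<phi> w \<in> U" "nbrs Q (\<phi> w) \<inter> U = {\<phi> w', \<phi> x}"
      using simple_polygon_exists[OF Q wQ(1) sQ[OF wQ(2)] Q_nbr[OF n(1) wP(1)] Q_nbr[OF n(2) wP(1)]]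
        neq[of w' x] n wP xP by metis
    have UQ: "U \<in> polygons Q" and inU: "\<phi> w' \<in> U" "\<phi> x \<in> U"
      using U by (auto simp: polygons_def)
    \<comment> \<open>If \<open>U\<close> missed one of the two, it would come from a 2-face of
      \<open>P\<close> that shares two edges at \<open>w\<close> with \<open>T\<close>, that is,
      from \<open>T\<close> itself, which contains both \<open>u\<close> and
      \<open>v\<close>.\<close>
    have uvU: "\<phi> u \<in> U \<and> \<phi> v \<in> U"
    proof (rule ccontr)
      assume "\<not> (\<phi> u \<in> U \<and> \<phi> v \<in> U)"
      then obtain S where S: "S \<in> polygons P" "verts U = \<phi> ` verts S"
        using recognise_polygon_back[OF UQ] by blast
      then have SP: "S face_of P" "aff_dim S = 2"
        by (auto simp: polygons_def)
      note mem = mem_face_image[OF SP(1) U(1) S(2)]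
      have "S = T"
        using mem[OF wP(1)] mem[OF wP(2)] mem[OF xP(1)] U(3) inU
        by (intro polygon_unique[OF P SP T(1,2) wP(1) _ T(3) n(1) _ T(4) n(2) _ T(5) n(3)[symmetric]]) auto
      then show False
        using mem[OF u] mem[OF v] uvT \<open>\<not> (\<phi> u \<in> U \<and> \<phi> v \<in> U)\<close> by auto
    qed
    have "card (nbrs Q (\<phi> w') \<inter> U) = 2"
      using polygon_face_nbrs[OF Q U(1,2) wQ(3) inU(1)] .
    then obtain a b where ab: "nbrs Q (\<phi> w') \<inter> U = {a, b}" "a \<noteq> b"
      unfolding card_2_iff by blast
    have "\<phi> w \<in> nbrs Q (\<phi> w') \<inter> U"
      using Q_nbr[OF wn wP(2)] U(3) by blast
    \<comment> \<open>The other neighbour of \<open>\<phi> w'\<close> in \<open>U\<close>; the aim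
      is to show that it is \<open>\<phi> x'\<close>.\<close>
    then obtain y where y: "y \<in> nbrs Q (\<phi> w')" "y \<in> U" "y \<noteq> \<phi> w"
      using ab by (metis IntD1 IntD2 insertI1 insert_commute)
    then obtain x'' where x'': "x'' \<in> nbrs P w'" "y = \<phi> x''"
      using iso wP(2) by (auto simp: graph_iso_def)
    have x''P: "x'' \<in> verts P" and x''w: "w \<noteq> x''"
      using x'' nbrs_verts y by auto
    obtain S where S: "S face_of P" "aff_dim S = 2" "w' \<in> S" "nbrs P w' \<inter> S = {w, x''}"
      using simple_polygon_exists[OF P wP(2) sP[OF ww(2)] wn x''(1) x''w] by blast
    have SP: "S \<in> polygons P" and inS: "w \<in> S" "x'' \<in> S"
      using S by (auto simp: polygons_def)
    have uvS: "u \<in> S \<and> v \<in> S"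
    proof (rule ccontr)
      assume "\<not> (u \<in> S \<and> v \<in> S)"
      then obtain R where R: "R \<in> polygons Q" "verts R = \<phi> ` verts S"
        using recognise_polygon_missing_one[OF SP] by blast
      then have RQ: "R face_of Q" "aff_dim R = 2"
        by (auto simp: polygons_def)
      note mem = mem_face_image[OF S(1) RQ(1) R(2)]
      have "R = U"
        using mem[OF wP(1)] mem[OF wP(2)] mem[OF x''P] inS S(3) U(3) inU y x'' neq[OF x''w wP(1) x''P]
          Q_nbr[OF wn wP(2)] Q_nbr[OF x''(1) wP(2)]
        by (intro polygon_unique[OF Q RQ U(1,2) wQ(3), of "\<phi> w" "\<phi> x''"]) auto
      then show False
        using mem[OF u] mem[OF v] uvU \<open>\<not> (u \<in> S \<and> v \<in> S)\<close> by auto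
    qed
    \<comment> \<open>Two distinct 2-faces meet in a face of dimension at most 1, which cannot have
      the three vertices \<open>u\<close>, \<open>v\<close>, \<open>w\<close>.\<close>
    have "S = T"
    proof (rule ccontr)
      assume ne: "S \<noteq> T"
      let ?I = "S \<inter> T"
      have I: "?I face_of P" "?I face_of S"
        using S(1) T(1) by (auto intro: face_of_Int face_of_subset dest: face_of_imp_subset)
      have "?I \<noteq> S"
      proof
        assume "?I = S"
        then have "S face_of T"
          using S(1) T(1) face_of_imp_subset by (metis I(1) face_of_subset inf_le2)
        then show False
          using face_of_aff_dim_lt[of T S] ne S(2) T(1,2) face_of_imp_convex by fastforce
      qed
      then have "aff_dim ?I < 2"
        using face_of_aff_dim_lt[OF face_of_imp_convex[OF S(1)] I(2)] S(2) by simp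
      moreover have pI: "polytope ?I"
        using I P face_of_polytope_polytope by blast
      moreover have vI: "{u, v, w} \<subseteq> verts ?I"
        using uvT uvS inS T u v wP by (auto simp: verts_face[OF I(1)])
      ultimately have c: "collinear ?I" "compact ?I" "convex ?I" "?I \<noteq> {}"
        using vI verts_subset by (auto simp: collinear_aff_dim polytope_imp_compact polytope_imp_convex)
      then obtain p q where "?I = closed_segment p q"
        using compact_convex_collinear_segment by blast
      then have "verts ?I = {p, q}"
        unfolding verts_def by (auto simp: extreme_point_of_segment)
      then have "{u, v, w} \<subseteq> {p, q}"
        using vI by simp
      moreover have "card {u, v, w} = 3"
        using uv ww by auto
      ultimately show False
        using card_mono[of "{p, q}" "{u, v, w}"] card_insert_le_m1[of 2 "{q}" p] by auto
    qed
    then have "x' \<in> nbrs P w' \<inter> S"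
      using n T by auto
    then have "x' = x''"
      using S(4) n(5) by auto
    then show ?thesis
      using U inU y x'' by auto
  qed
qed

theorem combinatorially_isomorphic:
  assumes "4 \<le> d"
  shows "combinatorially_isomorphic P Q"
proof (rule combinatorially_isomorphic_transports[OF P Q dP dQ _ iso])
  show "2 \<le> d"
    using assms by simp
  have "verts P - (verts P - {u, v}) = {u, v}"
    using u v by auto
  then show "card (verts P - (verts P - {u, v})) \<le> d - 2"
    using assms uv by simp
  show "transports P Q \<phi> (verts P - {u, v})"
    by (rule transports)
  show "transports Q P (inv_into (verts P) \<phi>) (\<phi> ` (verts P - {u, v}))"
    using exceptional_pair.transports[OF inverse] unfolding image_minus .
qed (use simple in auto)

end

theorem reconstructible_from_graph:
  assumes P: "d_polytope d P" and d: "4 \<le> d" and k: "1 \<le> k"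
    and few: "card (nonsimple_vertices d P) \<le> 2"
  shows "reconstructible k d P"
  unfolding reconstructible_def
proof (intro allI impI)
  fix Q :: "'a set"
  assume Q: "d_polytope d Q \<and> inclusion_isomorphic (skeleton k P) (skeleton k Q)"
  have pP: "polytope P" "aff_dim P = int d" and pQ: "polytope Q" "aff_dim Q = int d"
    using P Q by (auto simp: d_polytope_def)
  have "\<exists>\<phi>. graph_iso \<phi> P Q"
    by (rule skeleton_iso_graph_iso[OF pP(1) pQ(1) k conjunct2[OF Q]]) (rule exI)
  then obtain \<phi> where \<phi>: "graph_iso \<phi> P Q"
    by blast
  have sub: "nonsimple_vertices d P \<subseteq> verts P"
    by (auto simp: nonsimple_vertices_def verts_def)
  have "P \<noteq> {}"
    using pP d by auto
  then obtain a where a: "a \<in> verts P"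
    using verts_nonempty[OF pP(1)] by blast
  have "int d \<le> int (card (nbrs P a))"
    using aff_dim_le_card_nbrs[OF pP(1) a] pP(2) by simp
  then have "2 \<le> card (verts P)"
    using d card_mono[OF finite_verts[OF pP(1)] nbrs_subset_verts[of P a]] by linarith
  \<comment> \<open>With fewer than two nonsimple vertices, arbitrary vertices fill up the
    exceptional pair.\<close>
  then obtain B where B: "nonsimple_vertices d P \<subseteq> B" "B \<subseteq> verts P" "card B = 2"
    using exists_subset_between[OF few _ sub finite_verts[OF pP(1)]] by blast
  then obtain u v where uv: "B = {u, v}" "u \<noteq> v"
    by (auto simp: card_2_iff)
  interpret exceptional_pair d P Q \<phi> u v
  proof
    show "card (nbrs P w) = d" if "w \<in> verts P - {u, v}" for w
      using simple_vertex_card_nbrs[OF P] B that uv by blast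
  qed (use pP pQ \<phi> uv B in auto)
  show "combinatorially_isomorphic P Q"
    using combinatorially_isomorphic[OF d] .
qed

section \<open>Faces and tight inequalities\<close>

text \<open>The affine space \<open>L\<close> allows for polyhedra that are not full-dimensional.
  The inequalities form an indexed family, so that two indices may carry the same inequality, as the
  two floors of the flat polytope do below.\<close>

locale ineq_system =
  fixes L :: "'a::euclidean_space set" and J :: "'j set" and a :: "'j \<Rightarrow> 'a" and c :: "'j \<Rightarrow> real"
  assumes affine_L: "affine L" and finite_J: "finite J"
begin

definition slack :: "'j \<Rightarrow> 'a \<Rightarrow> real" where "slack j z = a j \<bullet> z + c j"

definition poly :: "'a set" where "poly = {z \<in> L. \<forall>j\<in>J. 0 \<le> slack j z}"

definition tight_at :: "'a \<Rightarrow> 'j set" where "tight_at z = {j \<in> J. slack j z = 0}"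

definition tight :: "'a set \<Rightarrow> 'j set" where "tight F = {j \<in> J. \<forall>z\<in>F. slack j z = 0}"

definition cell :: "'j set \<Rightarrow> 'a set" where "cell I = {z \<in> poly. \<forall>j\<in>I. slack j z = 0}"

lemma polyhedron_poly: "polyhedron poly"
proof -
  have "poly = L \<inter> \<Inter> ((\<lambda>j. {z. a j \<bullet> z \<ge> - c j}) ` J)"
    by (force simp: poly_def slack_def)
  moreover have "polyhedron \<dots>"
    using finite_J affine_L
    by (intro polyhedron_Int polyhedron_Inter) (auto simp: affine_imp_polyhedron polyhedron_halfspace_ge)
  ultimately show ?thesis
    by simp
qed

lemma cell_face:
  assumes "I \<subseteq> J"
  shows "cell I face_of poly"
proof (cases "I = {}")
  case True
  then show ?thesis
    using polyhedron_poly by (simp add: cell_def face_of_refl polyhedron_imp_convex)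
next
  case False
  have "poly \<inter> {z. a j \<bullet> z = - c j} face_of poly" if "j \<in> I" for j
    using that assms polyhedron_poly
    by (intro face_of_Int_supporting_hyperplane_ge) (force simp: poly_def slack_def polyhedron_imp_convex)+
  then have "\<Inter> ((\<lambda>j. poly \<inter> {z. a j \<bullet> z = - c j}) ` I) face_of poly"
    using False by (intro face_of_Inter) auto
  moreover have "cell I = \<Inter> ((\<lambda>j. poly \<inter> {z. a j \<bullet> z = - c j}) ` I)"
    using False by (auto simp: cell_def slack_def add_eq_0_iff2)
  ultimately show ?thesis
    by simp
qed

text \<open>Inequalities that are loose at \<open>z\<close> survive a small move, and those tight at
  \<open>z\<close> stay tight because they are tight at \<open>w\<close>.\<close>

lemma small_step:
  assumes z: "z \<in> poly" and w: "w \<in> L" "\<And>j. j \<in> tight_at z \<Longrightarrow> slack j w = 0"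
  shows "\<exists>\<delta>>0. z + \<delta> *\<^sub>R (w - z) \<in> cell (tight_at z)"
proof -
  let ?A = "J - tight_at z"
  have "finite ?A"
    using finite_J by simp
  moreover have "0 < slack j z" if "j \<in> ?A" for j
    using that z by (auto simp: poly_def tight_at_def order_less_le)
  ultimately have "\<exists>\<delta>>0. \<forall>j\<in>?A. 0 + \<delta> * 0 < slack j z + \<delta> * (slack j w - slack j z)"
    by (rule exists_positive_perturbation)
  then obtain \<delta> where \<delta>: "\<delta> > 0" "\<And>j. j \<in> ?A \<Longrightarrow> 0 < slack j z + \<delta> * (slack j w - slack j z)"
    by auto
  have e: "slack j (z + \<delta> *\<^sub>R (w - z)) = slack j z + \<delta> * (slack j w - slack j z)" for j
    by (simp add: slack_def inner_add_right inner_diff_right algebra_simps)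
  have 0: "slack j (z + \<delta> *\<^sub>R (w - z)) = 0" if "j \<in> tight_at z" for j
    unfolding e using that w(2) by (simp add: tight_at_def)
  have "(1 - \<delta>) *\<^sub>R z + \<delta> *\<^sub>R w \<in> L"
    using z w affine_L by (intro mem_affine) (auto simp: poly_def)
  then have "z + \<delta> *\<^sub>R (w - z) \<in> L"
    by (simp add: algebra_simps)
  moreover have "0 \<le> slack j (z + \<delta> *\<^sub>R (w - z))" if "j \<in> J" for j
    using 0 \<delta>(2)[of j] that e by (cases "j \<in> tight_at z") auto
  ultimately have "z + \<delta> *\<^sub>R (w - z) \<in> cell (tight_at z)"
    using 0 by (auto simp: cell_def poly_def)
  then show ?thesis
    using \<delta>(1) by blast
qed

text \<open>The segment from \<open>w\<close> to \<open>z\<close> can be prolonged a little beyond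
  \<open>z\<close>, towards the mirror image \<open>2 *\<^sub>R z - w\<close>, inside the
  polyhedron. Then \<open>z\<close> is an inner point of a segment, and the face property gives
  \<open>w \<in> F\<close>.\<close>

lemma cell_subset_face:
  assumes F: "F face_of poly" and z: "z \<in> F"
  shows "cell (tight_at z) \<subseteq> F"
proof
  fix w assume w: "w \<in> cell (tight_at z)"
  have zp: "z \<in> poly"
    using F z face_of_imp_subset by blast
  show "w \<in> F"
  proof (cases "w = z")
    case False
    have "2 *\<^sub>R z + (- 1) *\<^sub>R w \<in> L"
      using w zp affine_L by (intro mem_affine) (auto simp: cell_def poly_def)
    then have "2 *\<^sub>R z - w \<in> L"
      by simp
    moreover have "slack j (2 *\<^sub>R z - w) = 0" if "j \<in> tight_at z" for j
      using that w by (auto simp: cell_def tight_at_def slack_def inner_diff_right)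
    ultimately obtain \<delta> where \<delta>: "\<delta> > 0" "z + \<delta> *\<^sub>R (2 *\<^sub>R z - w - z) \<in> cell (tight_at z)"
      using small_step[OF zp] by blast
    define u where "u = z + \<delta> *\<^sub>R (2 *\<^sub>R z - w - z)"
    have u: "u = z + \<delta> *\<^sub>R (z - w)"
      by (simp add: u_def algebra_simps scaleR_2)
    have "z \<in> open_segment w u"
      unfolding in_segment
    proof (intro conjI exI[of _ "1 / (1 + \<delta>)"])
      show "w \<noteq> u"
      proof
        assume "w = u"
        then have "(1 + \<delta>) *\<^sub>R (z - w) = 0"
          by (simp add: u algebra_simps)
        then show False
          using False \<delta> by auto
      qed
      have "(1 + \<delta>) *\<^sub>R ((1 - 1 / (1 + \<delta>)) *\<^sub>R w + (1 / (1 + \<delta>)) *\<^sub>R u) = (1 + \<delta>) *\<^sub>R z"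
        using \<delta> by (simp add: u scaleR_add_right field_simps)
      then show "z = (1 - 1 / (1 + \<delta>)) *\<^sub>R w + (1 / (1 + \<delta>)) *\<^sub>R u"
        using \<delta> by (metis add_pos_pos less_irrefl scaleR_cancel_left zero_less_one)
    qed (use \<delta> in auto)
    moreover have "u \<in> poly" "w \<in> poly"
      using w \<delta> by (auto simp: u_def cell_def)
    ultimately show ?thesis
      using F z unfolding face_of_def by blast
  qed (use z in simp)
qed

text \<open>A relative interior point of \<open>F\<close> has no other tight inequalities than those
  tight on all of \<open>F\<close>.\<close>

lemma face_cell:
  assumes F: "F face_of poly" "F \<noteq> {}"
  shows "\<exists>z\<in>F. tight_at z = tight F" "F = cell (tight F)"
proof -
  have "rel_interior F \<noteq> {}"
    using F face_of_imp_convex rel_interior_eq_empty by blast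
  then obtain z where z: "z \<in> rel_interior F"
    by blast
  then have zF: "z \<in> F"
    using rel_interior_subset by blast
  then have zp: "z \<in> poly"
    using F face_of_imp_subset by blast
  have "z \<in> cell (tight_at z)"
    using zp by (auto simp: cell_def tight_at_def)
  then have "F \<subseteq> cell (tight_at z)"
    using z F face_of_imp_subset by (intro subset_of_face_of[OF cell_face]) (auto simp: tight_at_def)
  then have e: "F = cell (tight_at z)"
    using cell_subset_face[OF F(1) zF] by blast
  have t: "tight_at z = tight F"
    using zF e by (auto simp: tight_at_def tight_def cell_def)
  then show "\<exists>z\<in>F. tight_at z = tight F"
    using zF by blast
  show "F = cell (tight F)"
    using e t by simp
qed

lemma tight_cell:
  assumes "z \<in> poly"
  shows "tight (cell (tight_at z)) = tight_at z" "cell (tight_at z) face_of poly" "cell (tight_at z) \<noteq> {}"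
proof -
  have "z \<in> cell (tight_at z)"
    using assms by (auto simp: cell_def tight_at_def)
  then show "tight (cell (tight_at z)) = tight_at z" "cell (tight_at z) \<noteq> {}"
    by (auto simp: tight_at_def tight_def cell_def)
  show "cell (tight_at z) face_of poly"
    by (rule cell_face) (auto simp: tight_at_def)
qed

lemma face_subset_iff_tight:
  assumes "F face_of poly" "F \<noteq> {}" "G face_of poly" "G \<noteq> {}"
  shows "F \<subseteq> G \<longleftrightarrow> tight G \<subseteq> tight F"
proof
  assume "tight G \<subseteq> tight F"
  then have "cell (tight F) \<subseteq> cell (tight G)"
    by (auto simp: cell_def)
  then show "F \<subseteq> G"
    using face_cell(2) assms by metis
qed (auto simp: tight_def)

lemma aff_dim_affine_Int_hyperplanes:
  assumes "affine M" "z \<in> M" "finite K"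
  shows "affine {x \<in> M. \<forall>j\<in>K. slack j x = slack j z} \<and> 
    aff_dim M - int (card K) \<le> aff_dim {x \<in> M. \<forall>j\<in>K. slack j x = slack j z}"
  using assms(3)
proof (induction K rule: finite_induct)
  case empty
  then show ?case
    using assms by simp
next
  case (insert k K)
  let ?N = "{x \<in> M. \<forall>j\<in>K. slack j x = slack j z}"
  have e: "{x \<in> M. \<forall>j\<in>insert k K. slack j x = slack j z} = ?N \<inter> {x. a k \<bullet> x = a k \<bullet> z}"
    by (auto simp: slack_def)
  have "z \<in> ?N \<inter> {x. a k \<bullet> x = a k \<bullet> z}"
    using assms by simp
  then have "aff_dim ?N - 1 \<le> aff_dim (?N \<inter> {x. a k \<bullet> x = a k \<bullet> z})"
    using insert.IH by (subst aff_dim_affine_Int_hyperplane) auto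
  moreover have "affine (?N \<inter> {x. a k \<bullet> x = a k \<bullet> z})"
    using insert.IH by (auto intro: affine_Int affine_hyperplane)
  ultimately show ?case
    unfolding e using insert by simp
qed

text \<open>Each tight equation lowers the dimension by at most one, and near a generic point of
  \<open>F\<close> the solutions of these equations lie in \<open>F\<close>.\<close>

lemma aff_dim_face_ge:
  assumes F: "F face_of poly" "F \<noteq> {}"
  shows "aff_dim L - int (card (tight F)) \<le> aff_dim F"
proof -
  obtain z where z: "z \<in> F" "tight_at z = tight F"
    using face_cell(1)[OF F] by blast
  have zp: "z \<in> poly"
    using F z face_of_imp_subset by blast
  let ?M = "{x \<in> L. \<forall>j\<in>tight F. slack j x = slack j z}"
  have "z \<in> L" "finite (tight F)"
    using zp finite_J by (auto simp: poly_def tight_def)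
  then have "aff_dim L - int (card (tight F)) \<le> aff_dim ?M"
    using aff_dim_affine_Int_hyperplanes[OF affine_L] by blast
  also have "?M \<subseteq> affine hull F"
  proof
    fix w assume w: "w \<in> ?M"
    have "slack j w = 0" if "j \<in> tight_at z" for j
    proof -
      have "slack j w = slack j z"
        using w that unfolding z(2) by blast
      then show ?thesis
        using that by (simp add: tight_at_def)
    qed
    then obtain \<delta> where \<delta>: "\<delta> > 0" "z + \<delta> *\<^sub>R (w - z) \<in> cell (tight_at z)"
      using small_step[OF zp, of w] w by blast
    then have "z + \<delta> *\<^sub>R (w - z) \<in> F"
      using face_cell(2)[OF F] z by simp
    \<comment> \<open>The point \<open>w\<close> is recovered by extrapolating the small
      step.\<close>
    then have "(1 - 1 / \<delta>) *\<^sub>R z + (1 / \<delta>) *\<^sub>R (z + \<delta> *\<^sub>R (w - z)) \<in> affine hull F"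
      using z(1) by (intro mem_affine affine_affine_hull hull_inc) auto
    moreover have "(1 - 1 / \<delta>) *\<^sub>R z + (1 / \<delta>) *\<^sub>R (z + \<delta> *\<^sub>R (w - z)) = w"
      using \<delta>(1) by (simp add: scaleR_add_right scaleR_left_diff_distrib)
    ultimately show "w \<in> affine hull F"
      by metis
  qed
  then have "aff_dim ?M \<le> aff_dim F"
    using aff_dim_subset[of ?M "affine hull F"] by simp
  finally show ?thesis .
qed

text \<open>An edge at \<open>z\<close> loses a tight inequality, but by the dimension bound keeps
  at least \<open>d - 1\<close>. As at most \<open>d\<close> are tight at \<open>z\<close>, it loses
  exactly one and is determined by it.\<close>

lemma card_edges_le:
  assumes b: "bounded poly" and z: "z \<in> verts poly" and d: "aff_dim L = int d" and I: "card (tight_at z) \<le> d"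
  shows "card {e. e edge_of poly \<and> z \<in> e} \<le> d"
proof -
  have zp: "z \<in> poly"
    using z verts_subset by blast
  have fin: "finite (tight_at z)"
    using finite_J by (simp add: tight_at_def)
  have "tight e \<in> (\<lambda>j. tight_at z - {j}) ` tight_at z" if "e edge_of poly" "z \<in> e" for e
  proof -
    have e: "e face_of poly" "e \<noteq> {}" "aff_dim e = 1"
      using that by (auto simp: edge_of_def)
    have sub: "tight e \<subseteq> tight_at z"
      using that by (auto simp: tight_def tight_at_def)
    have "tight e \<noteq> tight_at z"
    proof
      assume "tight e = tight_at z"
      then have "e \<subseteq> {z}"
        using face_cell(2)[OF e(1,2)] cell_subset_face[of "{z}" z] z
        by (auto simp: verts_def face_of_singleton)
      then show False
        using e aff_dim_subset[of e "{z}"] by simp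
    qed
    then have lt: "card (tight e) < card (tight_at z)"
      using sub fin by (intro psubset_card_mono) auto
    moreover have "int d - 1 \<le> int (card (tight e))"
      using aff_dim_face_ge[OF e(1,2)] e(3) d by simp
    ultimately have "card (tight_at z - tight e) = 1"
      using I sub fin by (subst card_Diff_subset) (auto intro: finite_subset)
    then obtain j where "tight_at z - tight e = {j}"
      by (auto simp: card_1_singleton_iff)
    then have "j \<in> tight_at z" "tight e = tight_at z - {j}"
      using sub by auto
    then show ?thesis
      by blast
  qed
  moreover have "inj_on tight {e. e edge_of poly \<and> z \<in> e}"
    using face_cell(2) by (intro inj_onI) (metis (no_types, lifting) edge_of_def empty_iff mem_Collect_eq)
  ultimately have "card {e. e edge_of poly \<and> z \<in> e} \<le> card ((\<lambda>j. tight_at z - {j}) ` tight_at z)"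
    using fin by (intro card_inj_on_le[of tight]) auto
  also have "\<dots> \<le> card (tight_at z)"
    using fin by (rule card_image_le)
  finally show ?thesis
    using I by simp
qed

end

section \<open>Bending a facet\<close>

datatype wall = WallP nat | WallQ nat | FloorP | FloorQ

abbreviation floors :: "wall set" where "floors \<equiv> {FloorP, FloorQ}"

text \<open>In the flat polytope both floors are the same inequality and so are tight together; this
  is the effect of flattening on a tight set.\<close>

definition merge_floors :: "wall set \<Rightarrow> wall set"
  where "merge_floors I = (if I \<inter> floors = {} then I else I \<union> floors)"

lemma merge_floors_mono: "I \<subseteq> K \<Longrightarrow> merge_floors I \<subseteq> merge_floors K"
  by (auto simp: merge_floors_def)

lemma wall_subsetI:
  assumes "\<And>i. WallP i \<in> I \<Longrightarrow> WallP i \<in> K" "\<And>i. WallQ i \<in> I \<Longrightarrow> WallQ i \<in> K"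
    "FloorP \<in> I \<Longrightarrow> FloorP \<in> K" "FloorQ \<in> I \<Longrightarrow> FloorQ \<in> K"
  shows "I \<subseteq> K"
  using assms by (metis subsetI wall.exhaust)

lemma merge_floors_subset_floors: "merge_floors I \<subseteq> floors \<longleftrightarrow> I \<subseteq> floors"
  by (auto simp: merge_floors_def)

text \<open>With \<open>n = d - 1\<close>, write \<open>x i\<close> (\<open>i < n\<close>), \<open>t\<close> and \<open>y = 1 - \<Sum>x - t\<close> for the barycentric
  coordinates of the simplex spanned by \<open>0\<close> and the vectors \<open>b i\<close>.  The polytope for the parameter
  \<open>e\<close> is given by \<open>x i \<ge> 0\<close>, \<open>x i + y - i t \<ge> 0\<close> and \<open>t \<ge> e \<bar>y\<bar>\<close>.  For \<open>e = 0\<close> the last inequality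
  defines a facet, a bipyramid over the simplex spanned by the \<open>b i\<close> with \<open>i < n\<close>; for small
  \<open>e > 0\<close> this facet is bent along that simplex into two facets.\<close>

locale bent_system =
  fixes n :: nat and b :: "nat \<Rightarrow> 'a::euclidean_space"
  assumes n: "3 \<le> n" and inj_b: "inj_on b {..n}" and b_Basis: "b ` {..n} \<subseteq> Basis"
begin

definition ambient :: "'a set" where "ambient = span (b ` {..n})"

definition walls :: "wall set" where "walls = WallP ` {..<n} \<union> WallQ ` {..<n} \<union> floors"

definition y_dir :: 'a where "y_dir = - (\<Sum>k\<le>n. b k)"

definition y_coord :: "'a \<Rightarrow> real" where "y_coord z = 1 + y_dir \<bullet> z"

fun normal :: "real \<Rightarrow> wall \<Rightarrow> 'a" where
  "normal e (WallP i) = b i"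
| "normal e (WallQ i) = b i + y_dir - real i *\<^sub>R b n"
| "normal e FloorP = b n - e *\<^sub>R y_dir"
| "normal e FloorQ = b n + e *\<^sub>R y_dir"

fun offset :: "real \<Rightarrow> wall \<Rightarrow> real" where
  "offset e (WallP i) = 0"
| "offset e (WallQ i) = 1"
| "offset e FloorP = - e"
| "offset e FloorQ = e"

abbreviation Poly :: "real \<Rightarrow> 'a set"
  where "Poly e \<equiv> ineq_system.poly ambient walls (normal e) (offset e)"

abbreviation Tight_at :: "real \<Rightarrow> 'a \<Rightarrow> wall set"
  where "Tight_at e \<equiv> ineq_system.tight_at walls (normal e) (offset e)"

abbreviation Tight :: "real \<Rightarrow> 'a set \<Rightarrow> wall set"
  where "Tight e \<equiv> ineq_system.tight walls (normal e) (offset e)"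

abbreviation Cell :: "real \<Rightarrow> wall set \<Rightarrow> 'a set"
  where "Cell e \<equiv> ineq_system.cell ambient walls (normal e) (offset e)"

lemma subspace_ambient: "subspace ambient"
  by (simp add: ambient_def)

lemma sys: "ineq_system ambient walls"
  by unfold_locales (auto simp: walls_def subspace_ambient subspace_imp_affine)

lemma inner_b: "i \<le> n \<Longrightarrow> j \<le> n \<Longrightarrow> b i \<bullet> b j = (if i = j then 1 else 0)"
  using b_Basis inj_b by (auto simp: inner_Basis image_subset_iff inj_on_def)

lemma y_coord_eq: "y_coord z = 1 - (\<Sum>k<n. z \<bullet> b k) - z \<bullet> b n"
proof -
  have "y_dir \<bullet> z = - (\<Sum>k\<le>n. z \<bullet> b k)"
    by (simp add: y_dir_def inner_sum_right inner_commute[of _ z])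
  also have "(\<Sum>k\<le>n. z \<bullet> b k) = (\<Sum>k<n. z \<bullet> b k) + z \<bullet> b n"
    by (simp add: lessThan_Suc_atMost[symmetric])
  finally show ?thesis
    by (simp add: y_coord_def)
qed

abbreviation Slack :: "real \<Rightarrow> wall \<Rightarrow> 'a \<Rightarrow> real"
  where "Slack e \<equiv> ineq_system.slack (normal e) (offset e)"

lemma Slack:
  "Slack e (WallP i) z = z \<bullet> b i"
  "Slack e (WallQ i) z = z \<bullet> b i + y_coord z - i * (z \<bullet> b n)"
  "Slack e FloorP z = z \<bullet> b n - e * y_coord z"
  "Slack e FloorQ z = z \<bullet> b n + e * y_coord z"
  by (simp_all add: ineq_system.slack_def[OF sys] y_coord_def inner_add_left inner_diff_left
      inner_commute algebra_simps)

lemma ball_walls: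
  "(\<forall>j\<in>walls. R j) \<longleftrightarrow> (\<forall>i<n. R (WallP i) \<and> R (WallQ i)) \<and> R FloorP \<and> R FloorQ"
  unfolding walls_def by auto

lemma mem_Poly: "z \<in> Poly e \<longleftrightarrow> z \<in> ambient \<and> (\<forall>i<n. 0 \<le> z \<bullet> b i \<and> 0 \<le> z \<bullet> b i + y_coord z - i * (z \<bullet> b n)) \<and>
    0 \<le> z \<bullet> b n - e * y_coord z \<and> 0 \<le> z \<bullet> b n + e * y_coord z"
  unfolding ineq_system.poly_def[OF sys] mem_Collect_eq ball_walls Slack ..

lemma mem_walls: "WallP i \<in> walls \<longleftrightarrow> i < n" "WallQ i \<in> walls \<longleftrightarrow> i < n" "FloorP \<in> walls" "FloorQ \<in> walls"
  by (auto simp: walls_def)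

lemma mem_Tight_at:
  "WallP i \<in> Tight_at e z \<longleftrightarrow> i < n \<and> z \<bullet> b i = 0"
  "WallQ i \<in> Tight_at e z \<longleftrightarrow> i < n \<and> z \<bullet> b i + y_coord z - i * (z \<bullet> b n) = 0"
  "FloorP \<in> Tight_at e z \<longleftrightarrow> z \<bullet> b n - e * y_coord z = 0"
  "FloorQ \<in> Tight_at e z \<longleftrightarrow> z \<bullet> b n + e * y_coord z = 0"
  by (simp_all add: ineq_system.tight_at_def[OF sys] Slack mem_walls)

text \<open>All slacks are homogeneous in \<open>x\<close>, \<open>t\<close>, \<open>y\<close>, so
  these may be prescribed up to a positive factor, which is used to make their sum 1.\<close>

lemma point_exists:
  assumes \<sigma>: "0 < (\<Sum>i<n. x i) + t + y"
  shows "\<exists>z\<in>ambient. \<exists>\<kappa>>0. (\<forall>i<n. z \<bullet> b i = \<kappa> * x i) \<and> z \<bullet> b n = \<kappa> * t \<and> y_coord z = \<kappa> * y"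
proof -
  define s where "s = (\<Sum>i<n. x i) + t + y"
  define g where "g i = (if i < n then x i else t) / s" for i
  define z where "z = (\<Sum>i\<le>n. g i *\<^sub>R b i)"
  have z: "z \<in> ambient"
    unfolding z_def ambient_def by (intro span_sum span_scale span_base) auto
  have zb: "z \<bullet> b j = g j" if "j \<le> n" for j
  proof -
    have "z \<bullet> b j = (\<Sum>i\<le>n. if i = j then g i else 0)"
      unfolding z_def inner_sum_left using that by (intro sum.cong) (auto simp: inner_b)
    then show ?thesis
      using that by simp
  qed
  have "y_coord z = 1 - (\<Sum>k<n. x k / s) - t / s"
    unfolding y_coord_eq by (simp add: zb g_def)
  also have "\<dots> = (s - (\<Sum>k<n. x k) - t) / s"
    using \<sigma>[folded s_def] by (simp add: sum_divide_distrib[symmetric] diff_divide_distrib)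
  also have "\<dots> = y / s"
    by (simp add: s_def)
  finally have "y_coord z = (1 / s) * y"
    by simp
  moreover have "1 / s > 0"
    using \<sigma> by (simp add: s_def)
  ultimately show ?thesis
    using z zb by (intro bexI[OF _ z] exI[of _ "1 / s"]) (auto simp: g_def)
qed

lemma sum_coords: "(\<Sum>k<n. z \<bullet> b k) + z \<bullet> b n + y_coord z = 1"
  by (simp add: y_coord_eq)

text \<open>The walls only see the point \<open>(t, y)\<close> through the signs of \<open>y - i t\<close>, so \<open>t\<close> can be changed
  as long as these signs are kept.\<close>

lemma change_t:
  fixes t' :: real
  assumes z: "\<forall>i<n. 0 \<le> z \<bullet> b i \<and> 0 \<le> z \<bullet> b i + y_coord z - i * (z \<bullet> b n)"
    and y: "y_coord z \<noteq> 0" and t: "0 \<le> z \<bullet> b n" "0 \<le> t'"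
    and small: "y_coord z > 0 \<Longrightarrow> n * (z \<bullet> b n) \<le> y_coord z \<and> n * t' \<le> y_coord z"
  shows "\<exists>w\<in>ambient. \<exists>\<kappa>>0. w \<bullet> b n = \<kappa> * t' \<and> y_coord w = \<kappa> * y_coord z \<and>
    (\<forall>i<n. 0 \<le> w \<bullet> b i \<and> 0 \<le> w \<bullet> b i + y_coord w - i * (w \<bullet> b n) \<and>
      (w \<bullet> b i = 0 \<longleftrightarrow> z \<bullet> b i = 0) \<and>
      (w \<bullet> b i + y_coord w - i * (w \<bullet> b n) = 0 \<longleftrightarrow> z \<bullet> b i + y_coord z - i * (z \<bullet> b n) = 0))"
proof -
  define y0 where "y0 = y_coord z"
  define t0 where "t0 = z \<bullet> b n"
  \<comment> \<open>For \<open>y > 0\<close> every \<open>WallQ i\<close> has larger slack than zero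
    already, so \<open>x i\<close> is kept. For \<open>y < 0\<close> every \<open>WallP i\<close> is
    loose, and the shift preserves the slack of \<open>WallQ i\<close>.\<close>
  define x where "x i = (if 0 < y0 then z \<bullet> b i else z \<bullet> b i + real i * (t' - t0))" for i
  have key: "0 \<le> x i \<and> 0 \<le> x i + y0 - i * t' \<and> (x i = 0 \<longleftrightarrow> z \<bullet> b i = 0) \<and>
      (x i + y0 - i * t' = 0 \<longleftrightarrow> z \<bullet> b i + y0 - i * t0 = 0)" if i: "i < n" for i
  proof (cases "0 < y0")
    case True
    have "i * s < y0" if "n * s \<le> y0" "0 \<le> s" for s :: real
    proof (cases "s = 0")
      case False
      then have "real i * s < real n * s"
        using that i by simp
      then show ?thesis
        using that by simp
    qed (use True in simp)
    then have "i * t0 < y0" "i * t' < y0"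
      using small t True by (auto simp: y0_def t0_def)
    then show ?thesis
      using z i True by (auto simp: x_def y0_def t0_def)
  next
    case False
    then have "y0 < 0"
      using y by (simp add: y0_def)
    have "0 \<le> i * t0" "0 \<le> i * t'"
      using t by (auto simp: t0_def)
    moreover have "0 \<le> z \<bullet> b i + y0 - i * t0"
      using z i by (simp add: y0_def t0_def)
    moreover have "x i = z \<bullet> b i + i * t' - i * t0"
      using False by (simp add: x_def algebra_simps)
    ultimately show ?thesis
      using \<open>y0 < 0\<close> by auto
  qed
  have "0 < (\<Sum>i<n. x i) + t' + y0"
  proof (cases "0 < y0")
    case True
    have "0 \<le> (\<Sum>i<n. x i)"
      using key by (intro sum_nonneg) auto
    then show ?thesis
      using True t by simp
  next
    case False
    then have "y0 < 0"
      using y by (simp add: y0_def)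
    have "- y0 \<le> x i" if "i < n" for i
    proof -
      have "0 \<le> real i * t'"
        using t by simp
      then show ?thesis
        using key[OF that] by linarith
    qed
    then have "(\<Sum>i<n. - y0) \<le> (\<Sum>i<n. x i)"
      by (intro sum_mono) auto
    moreover have "(\<Sum>i<n. - y0) = real n * (- y0)"
      by simp
    moreover have "3 * (- y0) \<le> real n * (- y0)"
      using n \<open>y0 < 0\<close> by (intro mult_right_mono) auto
    ultimately show ?thesis
      using t \<open>y0 < 0\<close> by linarith
  qed
  then obtain w \<kappa> where w: "w \<in> ambient" "\<kappa> > 0" "\<And>i. i < n \<Longrightarrow> w \<bullet> b i = \<kappa> * x i" "w \<bullet> b n = \<kappa> * t'"
    "y_coord w = \<kappa> * y0"
    using point_exists[of x t' y0] by blast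
  have e: "w \<bullet> b i + y_coord w - i * (w \<bullet> b n) = \<kappa> * (x i + y0 - i * t')" if "i < n" for i
    using w that by (simp add: algebra_simps)
  have "0 \<le> w \<bullet> b i \<and> 0 \<le> w \<bullet> b i + y_coord w - i * (w \<bullet> b n) \<and>
      (w \<bullet> b i = 0 \<longleftrightarrow> z \<bullet> b i = 0) \<and>
      (w \<bullet> b i + y_coord w - i * (w \<bullet> b n) = 0 \<longleftrightarrow> z \<bullet> b i + y_coord z - i * (z \<bullet> b n) = 0)" if i: "i < n" for i
    using key[OF i] \<open>\<kappa> > 0\<close> unfolding e[OF i] unfolding w(3)[OF i] y0_def[symmetric] t0_def[symmetric]
    by (simp add: zero_le_mult_iff)
  then show ?thesis
    using w unfolding y0_def[symmetric] by blast
qed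

text \<open>The factor 2 leaves room for the height \<open>t = 2 * eps * \<bar>y\<bar>\<close> in
  \<open>bend_point\<close>: even there \<open>n * t \<le> y\<close> for positive \<open>y\<close>,
  as \<open>change_t\<close> requires.\<close>

definition eps :: real where "eps = 1 / (2 * real n)"

lemma eps: "0 < eps" "real n * (2 * eps) = 1" "real n * eps \<le> 1"
  using n by (auto simp: eps_def)

section \<open>Moving points between the flat and the bent polytope\<close>

lemma Tight_atI:
  assumes "\<And>i. i < n \<Longrightarrow> w \<bullet> b i = 0 \<longleftrightarrow> z \<bullet> b i = 0"
    "\<And>i. i < n \<Longrightarrow> w \<bullet> b i + y_coord w - i * (w \<bullet> b n) = 0 \<longleftrightarrow> z \<bullet> b i + y_coord z - i * (z \<bullet> b n) = 0"
    "FloorP \<in> Tight_at e' w \<longleftrightarrow> FloorP \<in> merge_floors (Tight_at e z)"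
    "FloorQ \<in> Tight_at e' w \<longleftrightarrow> FloorQ \<in> merge_floors (Tight_at e z)"
  shows "Tight_at e' w = merge_floors (Tight_at e z)"
proof (rule set_eqI)
  fix j show "j \<in> Tight_at e' w \<longleftrightarrow> j \<in> merge_floors (Tight_at e z)"
    using assms by (cases j) (auto simp: merge_floors_def mem_Tight_at)
qed

lemma flatten_point:
  assumes z: "z \<in> Poly eps"
  shows "\<exists>w\<in>Poly 0. Tight_at 0 w = merge_floors (Tight_at eps z)"
proof -
  define y where "y = y_coord z"
  define t where "t = z \<bullet> b n"
  have zP: "z \<in> ambient" "\<forall>i<n. 0 \<le> z \<bullet> b i \<and> 0 \<le> z \<bullet> b i + y_coord z - i * (z \<bullet> b n)"
    "0 \<le> t - eps * y" "0 \<le> t + eps * y"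
    using z by (auto simp: mem_Poly y_def t_def)
  have t0: "0 \<le> t"
    using zP by simp
  show ?thesis
  \<comment> \<open>A point on exactly one floor is lowered to \<open>t = 0\<close>; all other
    points can stay.\<close>
  proof (cases "(t - eps * y = 0 \<or> t + eps * y = 0) \<and> y \<noteq> 0")
    case False
    have "z \<in> Poly 0"
      using zP t0 by (auto simp: mem_Poly t_def)
    moreover have "Tight_at 0 z = merge_floors (Tight_at eps z)"
    proof (rule Tight_atI)
      show "FloorP \<in> Tight_at 0 z \<longleftrightarrow> FloorP \<in> merge_floors (Tight_at eps z)"
        "FloorQ \<in> Tight_at 0 z \<longleftrightarrow> FloorQ \<in> merge_floors (Tight_at eps z)"
        using False zP eps(1) unfolding t_def y_def by (auto simp: merge_floors_def mem_Tight_at)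
    qed auto
    ultimately show ?thesis
      by blast
  next
    case True
    have "n * t \<le> y" if "y > 0"
    proof -
      have "t = eps * y"
        using True zP mult_pos_pos[OF eps(1) that] by linarith
      then show ?thesis
        using mult_right_mono[OF eps(3), of y] that by (simp add: mult.assoc)
    qed
    then obtain w \<kappa> where w: "w \<in> ambient" "\<kappa> > 0" "w \<bullet> b n = \<kappa> * 0" "y_coord w = \<kappa> * y_coord z"
      and wi: "\<forall>i<n. 0 \<le> w \<bullet> b i \<and> 0 \<le> w \<bullet> b i + y_coord w - i * (w \<bullet> b n) \<and>
      (w \<bullet> b i = 0 \<longleftrightarrow> z \<bullet> b i = 0) \<and>
      (w \<bullet> b i + y_coord w - i * (w \<bullet> b n) = 0 \<longleftrightarrow> z \<bullet> b i + y_coord z - i * (z \<bullet> b n) = 0)"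
      using change_t[OF zP(2), of 0] True t0 unfolding y_def t_def by auto
    have "w \<in> Poly 0"
      using w wi by (simp add: mem_Poly)
    moreover have "Tight_at 0 w = merge_floors (Tight_at eps z)"
    proof (rule Tight_atI)
      show "FloorP \<in> Tight_at 0 w \<longleftrightarrow> FloorP \<in> merge_floors (Tight_at eps z)"
        "FloorQ \<in> Tight_at 0 w \<longleftrightarrow> FloorQ \<in> merge_floors (Tight_at eps z)"
        using True w unfolding t_def y_def by (auto simp: merge_floors_def mem_Tight_at)
    qed (use wi in blast)+
    ultimately show ?thesis
      by blast
  qed
qed

lemma bend_point:
  assumes z: "z \<in> Poly 0"
  shows "\<exists>w\<in>Poly eps. merge_floors (Tight_at eps w) = Tight_at 0 z"
proof -
  define y where "y = y_coord z"
  define t where "t = z \<bullet> b n"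
  have zP: "z \<in> ambient" "\<forall>i<n. 0 \<le> z \<bullet> b i \<and> 0 \<le> z \<bullet> b i + y_coord z - i * (z \<bullet> b n)" and t0: "0 \<le> t"
    using z by (auto simp: mem_Poly t_def)
  show ?thesis
  \<comment> \<open>Here the point is already above both floors of the bent polytope, or has
    \<open>y = 0\<close>, where the floors of the two polytopes agree.\<close>
  proof (cases "y = 0 \<or> t > eps * \<bar>y\<bar>")
    case True
    have yy: "eps * y \<le> eps * \<bar>y\<bar>" "- (eps * y) \<le> eps * \<bar>y\<bar>"
      using mult_left_mono[of y "\<bar>y\<bar>" eps] mult_left_mono[of "- y" "\<bar>y\<bar>" eps] eps(1) by simp_all
    have fl: "(t - eps * y = 0 \<longleftrightarrow> t = 0) \<and> (t + eps * y = 0 \<longleftrightarrow> t = 0)"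
    proof (cases "y = 0")
      case False
      then have "eps * \<bar>y\<bar> < t" "0 \<le> eps * \<bar>y\<bar>"
        using True eps(1) by auto
      then show ?thesis
        using yy by linarith
    qed simp
    have "z \<in> Poly eps"
      using zP t0 True yy unfolding mem_Poly y_def[symmetric] t_def[symmetric] by auto
    moreover have "merge_floors (Tight_at eps z) = Tight_at 0 z"
    proof (rule Tight_atI[symmetric])
      show "FloorP \<in> Tight_at 0 z \<longleftrightarrow> FloorP \<in> merge_floors (Tight_at eps z)"
        "FloorQ \<in> Tight_at 0 z \<longleftrightarrow> FloorQ \<in> merge_floors (Tight_at eps z)"
        using fl by (auto simp: merge_floors_def mem_Tight_at y_def[symmetric] t_def[symmetric])
    qed auto
    ultimately show ?thesis
      by blast
  next
    case False
    then have y: "y \<noteq> 0" and t: "t \<le> eps * \<bar>y\<bar>"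
      by auto
    define p where "p = eps * \<bar>y\<bar>"
    \<comment> \<open>A point of the flat floor is raised exactly to the bent floor; one strictly
      above the flat floor must end strictly above the bent one, hence the larger value.\<close>
    define t' where "t' = (if t = 0 then p else 2 * p)"
    have ey: "0 < p"
      using y eps(1) by (simp add: p_def)
    have py: "p = eps * y \<or> p = - (eps * y)"
      by (simp add: p_def abs_if)
    have t': "0 \<le> t'" "t' \<le> 2 * p"
      using ey by (simp_all add: t'_def)
    have "n * t \<le> y \<and> n * t' \<le> y" if "y > 0"
    proof -
      have "n * s \<le> y" if "s \<le> 2 * (eps * y)" for s :: real
      proof -
        have "n * s \<le> n * (2 * (eps * y))"
          using that by (intro mult_left_mono) auto
        also have "\<dots> = (n * (2 * eps)) * y"
          by (simp add: algebra_simps)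
        finally show ?thesis
          using eps(2) by simp
      qed
      moreover have "t \<le> 2 * (eps * y)" "t' \<le> 2 * (eps * y)"
        using t t' ey that by (simp_all add: p_def)
      ultimately show ?thesis
        by blast
    qed
    then obtain w \<kappa> where w: "w \<in> ambient" "\<kappa> > 0" "w \<bullet> b n = \<kappa> * t'" "y_coord w = \<kappa> * y_coord z"
      and wi: "\<forall>i<n. 0 \<le> w \<bullet> b i \<and> 0 \<le> w \<bullet> b i + y_coord w - i * (w \<bullet> b n) \<and>
      (w \<bullet> b i = 0 \<longleftrightarrow> z \<bullet> b i = 0) \<and>
      (w \<bullet> b i + y_coord w - i * (w \<bullet> b n) = 0 \<longleftrightarrow> z \<bullet> b i + y_coord z - i * (z \<bullet> b n) = 0)"
      using change_t[OF zP(2), of t'] y t0 t'(1) unfolding y_def t_def by blast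
    have fl: "w \<bullet> b n - eps * y_coord w = \<kappa> * (t' - eps * y)" "w \<bullet> b n + eps * y_coord w = \<kappa> * (t' + eps * y)"
      using w unfolding y_def by (auto simp: algebra_simps)
    have pos: "0 \<le> t' - eps * y" "0 \<le> t' + eps * y"
    proof -
      have "p \<le> t'" "eps * y \<le> p" "- (eps * y) \<le> p"
        using ey py by (auto simp: t'_def)
      then show "0 \<le> t' - eps * y" "0 \<le> t' + eps * y"
        by linarith+
    qed
    have "w \<in> Poly eps"
      unfolding mem_Poly fl using w wi pos by simp
    moreover have "merge_floors (Tight_at eps w) = Tight_at 0 z"
    proof -
      have "(t' - eps * y = 0 \<or> t' + eps * y = 0) \<longleftrightarrow> t = 0"
        using ey py by (cases "t = 0") (auto simp: t'_def)
      then have "FloorP \<in> Tight_at 0 z \<longleftrightarrow> FloorP \<in> merge_floors (Tight_at eps w)"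
        "FloorQ \<in> Tight_at 0 z \<longleftrightarrow> FloorQ \<in> merge_floors (Tight_at eps w)"
        using w(2) by (auto simp: merge_floors_def mem_Tight_at fl t_def[symmetric])
      then show ?thesis
        using wi by (intro Tight_atI[symmetric]) auto
    qed
    ultimately show ?thesis
      by blast
  qed
qed

text \<open>If only \<open>FloorP\<close> is tight then \<open>y > 0\<close> and
  \<open>t = eps * y\<close>, so that \<open>i * t < y\<close>. The counterpart
  \<open>WallP_loose\<close> uses that \<open>y < 0\<close> forces \<open>x i\<close> to be
  positive.\<close>

lemma WallQ_loose:
  assumes "u \<in> Poly eps" "FloorP \<in> Tight_at eps u" "FloorQ \<notin> Tight_at eps u"
  shows "WallQ i \<notin> Tight_at eps u"
proof
  assume q: "WallQ i \<in> Tight_at eps u"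
  then have i: "i < n"
    by (simp add: mem_Tight_at)
  have t: "u \<bullet> b n = eps * y_coord u" "0 \<le> eps * y_coord u + eps * y_coord u"
    "eps * y_coord u + eps * y_coord u \<noteq> 0" "0 \<le> u \<bullet> b i" 
    "u \<bullet> b i + y_coord u - i * (eps * y_coord u) = 0"
    using assms q i by (auto simp: mem_Poly mem_Tight_at)
  then have y: "0 < eps * y_coord u" "0 < y_coord u"
    using eps(1) by (auto simp: zero_le_mult_iff)
  have "real i * (eps * y_coord u) < real n * (eps * y_coord u)"
    using i y by (intro mult_strict_right_mono) auto
  also have "\<dots> = (n * eps) * y_coord u"
    by simp
  also have "\<dots> \<le> y_coord u"
    using eps(3) y by (simp add: mult_le_cancel_right1)
  finally show False
    using t by simp
qed

lemma WallP_loose: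
  assumes "u \<in> Poly eps" "FloorQ \<in> Tight_at eps u" "FloorP \<notin> Tight_at eps u"
  shows "WallP i \<notin> Tight_at eps u"
proof
  assume q: "WallP i \<in> Tight_at eps u"
  then have i: "i < n"
    by (simp add: mem_Tight_at)
  have t: "u \<bullet> b n = - (eps * y_coord u)" "u \<bullet> b n \<noteq> eps * y_coord u" "eps * y_coord u \<le> u \<bullet> b n"
    "0 \<le> y_coord u - i * (u \<bullet> b n)"
    using assms q i by (auto simp: mem_Poly mem_Tight_at)
  have y: "eps * y_coord u < 0"
  proof (rule order_le_neq_trans)
    show "eps * y_coord u \<noteq> 0"
      using t(1,2) by (metis minus_zero)
  qed (use t(1,3) in linarith)
  then have "0 < u \<bullet> b n"
    using t(1) by linarith
  have "y_coord u < 0"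
    using y eps(1) by (simp add: mult_less_0_iff)
  moreover have "0 \<le> real i * (u \<bullet> b n)"
    using \<open>0 < u \<bullet> b n\<close> by simp
  ultimately show False
    using t by simp
qed

text \<open>Merging forgets which floor is tight, but a tight wall recalls it: with only
  \<open>FloorP\<close> tight no \<open>WallQ i\<close> is tight, with only \<open>FloorQ\<close>
  tight no \<open>WallP i\<close> is, and with both tight \<open>WallP i\<close> and
  \<open>WallQ i\<close> occur together.\<close>

lemma merge_floors_subset_iff:
  assumes z: "z \<in> Poly eps" and w: "w \<in> Poly eps" and nf: "\<not> Tight_at eps z \<subseteq> floors"
  shows "merge_floors (Tight_at eps z) \<subseteq> merge_floors (Tight_at eps w) \<longleftrightarrow> Tight_at eps z \<subseteq> Tight_at eps w"
proof
  assume m: "merge_floors (Tight_at eps z) \<subseteq> merge_floors (Tight_at eps w)"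
  have both: "WallP i \<in> Tight_at eps u \<longleftrightarrow> WallQ i \<in> Tight_at eps u"
    if "FloorP \<in> Tight_at eps u" "FloorQ \<in> Tight_at eps u" for u i
  proof -
    have "u \<bullet> b n = 0" "y_coord u = 0"
      using that eps(1) by (auto simp: mem_Tight_at)
    then show ?thesis
      by (simp add: mem_Tight_at)
  qed
  obtain j where j: "j \<in> Tight_at eps z" "j \<notin> floors"
    using nf by blast
  have walls_sub: "k \<in> Tight_at eps w" if "k \<in> Tight_at eps z" "k \<notin> floors" for k
    using m that by (auto simp: merge_floors_def split: if_splits)
  have fl: "FloorP \<in> Tight_at eps w \<or> FloorQ \<in> Tight_at eps w" 
    if "FloorP \<in> Tight_at eps z \<or> FloorQ \<in> Tight_at eps z"
    using m that by (auto simp: merge_floors_def split: if_splits)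
  have "\<exists>i. WallP i \<in> Tight_at eps z \<or> WallQ i \<in> Tight_at eps z"
    using j by (cases j) auto
  then obtain i where i: "WallP i \<in> Tight_at eps z \<or> WallQ i \<in> Tight_at eps z"
    by blast
  have "FloorP \<in> Tight_at eps w" if "FloorP \<in> Tight_at eps z"
  proof (rule ccontr)
    assume a: "FloorP \<notin> Tight_at eps w"
    then have "WallP i \<notin> Tight_at eps w"
      using fl that WallP_loose[OF w] by blast
    then have "WallP i \<notin> Tight_at eps z"
      using walls_sub by blast
    then show False
      using i WallQ_loose[OF z that] both[OF that] by blast
  qed
  moreover have "FloorQ \<in> Tight_at eps w" if "FloorQ \<in> Tight_at eps z"
  proof (rule ccontr)
    assume a: "FloorQ \<notin> Tight_at eps w"
    then have "WallQ i \<notin> Tight_at eps w"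
      using fl that WallQ_loose[OF w] by blast
    then have "WallQ i \<notin> Tight_at eps z"
      using walls_sub by blast
    then show False
      using i WallP_loose[OF z that] both[OF _ that] by blast
  qed
  ultimately show "Tight_at eps z \<subseteq> Tight_at eps w"
    using walls_sub by blast
qed (rule merge_floors_mono)

section \<open>Boundedness and dimension\<close>

lemma bounded_Poly:
  assumes e: "0 \<le> e"
  shows "bounded (Poly e)"
proof -
  have "norm z \<le> 2 * real DIM('a)" if z: "z \<in> Poly e" for z
  proof -
    define y where "y = y_coord z"
    have zP: "z \<in> ambient" "\<And>i. i < n \<Longrightarrow> 0 \<le> z \<bullet> b i" "\<And>i. i < n \<Longrightarrow> 0 \<le> z \<bullet> b i + y - i * (z \<bullet> b n)"
      "0 \<le> z \<bullet> b n"
      using z by (auto simp: mem_Poly y_def)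
    have s: "(\<Sum>k<n. z \<bullet> b k) + z \<bullet> b n + y = 1"
      using sum_coords by (simp add: y_def)
    have sum0: "0 \<le> (\<Sum>k<n. z \<bullet> b k)"
      using zP by (intro sum_nonneg) auto
    \<comment> \<open>For \<open>y < 0\<close> the walls give \<open>x i \<ge> - y\<close> for all
      \<open>i\<close>, so the left side is at least \<open>- 2 * y\<close>; it equals
      \<open>1 - y\<close>, hence \<open>- y \<le> 1\<close>.\<close>
    have "(\<Sum>k<n. z \<bullet> b k) + z \<bullet> b n \<le> 2"
    proof (cases "0 \<le> y")
      case False
      have "- y \<le> z \<bullet> b i" if "i < n" for i
      proof -
        have "0 \<le> real i * (z \<bullet> b n)"
          using zP(4) by simp
        then show ?thesis
          using zP(3)[OF that] by linarith
      qed
      then have "(\<Sum>i<n. - y) \<le> (\<Sum>k<n. z \<bullet> b k)"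
        by (intro sum_mono) auto
      moreover have "(\<Sum>i<n. - y) = real n * (- y)"
        by simp
      moreover have "2 * (- y) \<le> real n * (- y)"
        using n False by (intro mult_right_mono) auto
      ultimately show ?thesis
        using s zP(4) by linarith
    qed (use s in simp)
    moreover have "z \<bullet> b i \<le> (\<Sum>k<n. z \<bullet> b k)" if "i < n" for i
      using that zP by (intro member_le_sum) auto
    ultimately have le2: "\<bar>z \<bullet> b i\<bar> \<le> 2" if "i \<le> n" for i
      using that zP sum0 by (cases "i = n") (force simp: order_le_less)+
    have "\<bar>z \<bullet> c\<bar> \<le> 2" if c: "c \<in> Basis" for c
    proof (cases "c \<in> b ` {..n}")
      case False
      have "z \<bullet> c = 0"
        using zP(1) unfolding ambient_def
      proof (induction z rule: span_induct_alt)
        case (step r x u)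
        then have "x \<bullet> c = 0"
          using False c b_Basis by (metis image_subset_iff inner_not_same_Basis image_iff)
        then show ?case
          using step by (simp add: inner_add_left)
      qed simp
      then show ?thesis
        by simp
    qed (use le2 in auto)
    then have "(\<Sum>c\<in>Basis. \<bar>z \<bullet> c\<bar>) \<le> (\<Sum>c\<in>(Basis::'a set). 2)"
      by (intro sum_mono) auto
    then show ?thesis
      using norm_le_l1[of z] by simp
  qed
  then show ?thesis
    unfolding bounded_iff by blast
qed

lemma polytope_Poly: "0 \<le> e \<Longrightarrow> polytope (Poly e)"
  by (simp add: polytope_eq_bounded_polyhedron bounded_Poly ineq_system.polyhedron_poly[OF sys])

lemma aff_dim_ambient: "aff_dim ambient = int (n + 1)"
proof -
  have "independent (b ` {..n})"
    using b_Basis independent_Basis independent_mono by blast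
  then have "dim ambient = card (b ` {..n})"
    by (simp add: ambient_def dim_eq_card_independent)
  then show ?thesis
    using subspace_ambient inj_b by (simp add: aff_dim_subspace card_image)
qed

lemma interior_point: "\<exists>z\<in>Poly e. Tight_at e z = {}" if e: "e = 0 \<or> e = eps"
proof -
  \<comment> \<open>The value \<open>n + 1\<close> for \<open>x i\<close> exceeds every
    \<open>i * t\<close> with \<open>t = 1\<close>, and for \<open>y = 0\<close> both floors reduce
    to \<open>t \<ge> 0\<close>.\<close>
  have "0 < (\<Sum>i<n. real n + 1) + 1 + (0::real)"
    by (intro add_pos_nonneg add_nonneg_pos sum_nonneg) auto
  then obtain z \<kappa> where z: "z \<in> ambient" "\<kappa> > 0" "\<And>i. i < n \<Longrightarrow> z \<bullet> b i = \<kappa> * (real n + 1)" "z \<bullet> b n = \<kappa> * 1"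
    "y_coord z = \<kappa> * 0"
    using point_exists[of "\<lambda>i. real n + 1" 1 0] by blast
  have pos: "0 < z \<bullet> b i + y_coord z - i * (z \<bullet> b n)" "0 < z \<bullet> b i" if "i < n" for i
  proof -
    have "z \<bullet> b i + y_coord z - i * (z \<bullet> b n) = \<kappa> * (real n + 1 - real i)"
      using z that by (simp add: algebra_simps)
    then show "0 < z \<bullet> b i + y_coord z - i * (z \<bullet> b n)" "0 < z \<bullet> b i"
      using z that by auto
  qed
  have y: "y_coord z = 0" and t: "0 < z \<bullet> b n"
    using z by simp_all
  have "z \<in> Poly e"
    unfolding mem_Poly using z(1) y t pos by (simp add: less_imp_le)
  moreover have "j \<notin> Tight_at e z" for j
  proof (cases j)
    case (WallP i)
    then show ?thesis
      using pos(2)[of i] by (auto simp: mem_Tight_at)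
  next
    case (WallQ i)
    then show ?thesis
      using pos(1)[of i] by (auto simp: mem_Tight_at)
  qed (use y t in \<open>simp_all add: mem_Tight_at\<close>)
  ultimately show ?thesis
    by blast
qed

lemma aff_dim_Poly: 
  assumes e: "e = 0 \<or> e = eps"
  shows "aff_dim (Poly e) = int (n + 1)"
proof -
  obtain z where z: "z \<in> Poly e" "Tight_at e z = {}"
    using interior_point[OF e] by blast
  have "Poly e face_of Poly e"
    using ineq_system.polyhedron_poly[OF sys] by (simp add: face_of_refl polyhedron_imp_convex)
  moreover have "Tight e (Poly e) = {}"
    using z by (auto simp: ineq_system.tight_def[OF sys] ineq_system.tight_at_def[OF sys])
  ultimately have "int (n + 1) \<le> aff_dim (Poly e)"
    using ineq_system.aff_dim_face_ge[OF sys, of "Poly e" "normal e" "offset e"] z(1) aff_dim_ambient by auto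
  moreover have "aff_dim (Poly e) \<le> aff_dim ambient"
    by (intro aff_dim_subset) (auto simp: mem_Poly)
  ultimately show ?thesis
    using aff_dim_ambient by simp
qed

end

section \<open>Order isomorphism of the faces that bending preserves\<close>

context bent_system
begin

text \<open>Leaving out the polytope itself makes this family closed under taking faces of its members.\<close>

definition low_faces :: "real \<Rightarrow> 'a set set"
  where "low_faces e = {F. F face_of Poly e \<and> (F \<noteq> {} \<longrightarrow> \<not> Tight e F \<subseteq> floors)}"

text \<open>Faces are identified with their tight sets; by \<open>flatten_point\<close> the merged
  set is again the tight set of a point.\<close>

definition flatten :: "'a set \<Rightarrow> 'a set"
  where "flatten F = (if F = {} then {} else Cell 0 (merge_floors (Tight eps F)))"

lemma low_faces_down: "F \<in> low_faces e \<Longrightarrow> G face_of F \<Longrightarrow> G \<in> low_faces e"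
proof -
  assume F: "F \<in> low_faces e" and G: "G face_of F"
  then have "G \<subseteq> F"
    using face_of_imp_subset by blast
  then have "Tight e F \<subseteq> Tight e G" "G \<noteq> {} \<longrightarrow> F \<noteq> {}"
    by (auto simp: ineq_system.tight_def[OF sys])
  then show "G \<in> low_faces e"
    using F G by (auto simp: low_faces_def intro: face_of_trans)
qed

lemma flatten_nonempty:
  assumes F: "F \<in> low_faces eps" "F \<noteq> {}"
  shows "flatten F face_of Poly 0" "flatten F \<noteq> {}" "Tight 0 (flatten F) = merge_floors (Tight eps F)"
    "flatten F \<in> low_faces 0" "\<exists>z\<in>Poly eps. Tight_at eps z = Tight eps F"
proof -
  have FP: "F face_of Poly eps" "\<not> Tight eps F \<subseteq> floors"
    using F by (auto simp: low_faces_def)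
  obtain z where z: "z \<in> F" "Tight_at eps z = Tight eps F"
    using ineq_system.face_cell(1)[OF sys FP(1) F(2)] by blast
  have zP: "z \<in> Poly eps"
    using z FP face_of_imp_subset by blast
  then obtain w where w: "w \<in> Poly 0" "Tight_at 0 w = merge_floors (Tight_at eps z)"
    using flatten_point by blast
  have e: "flatten F = Cell 0 (Tight_at 0 w)"
    using F w z by (simp add: flatten_def)
  show "flatten F face_of Poly 0" "flatten F \<noteq> {}" "Tight 0 (flatten F) = merge_floors (Tight eps F)"
    unfolding e using ineq_system.tight_cell[OF sys w(1)] w(2) z(2) by auto
  then show "flatten F \<in> low_faces 0"
    using FP by (simp add: low_faces_def merge_floors_subset_floors)
  show "\<exists>z\<in>Poly eps. Tight_at eps z = Tight eps F"
    using zP z by blast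
qed

lemma flatten_subset_iff:
  assumes F: "F \<in> low_faces eps" and G: "G \<in> low_faces eps"
  shows "F \<subseteq> G \<longleftrightarrow> flatten F \<subseteq> flatten G"
proof -
  consider "F = {}" | "F \<noteq> {}" "G = {}" | "F \<noteq> {}" "G \<noteq> {}"
    by blast
  then show ?thesis
  proof cases
    case 1
    then show ?thesis
      by (simp add: flatten_def)
  next
    case 2
    then show ?thesis
      using flatten_nonempty(2)[OF F] by (simp add: flatten_def)
  next
    case 3
    note f = flatten_nonempty[OF F 3(1)] and g = flatten_nonempty[OF G 3(2)]
    obtain z w where z: "z \<in> Poly eps" "Tight_at eps z = Tight eps F" and w: "w \<in> Poly eps" "Tight_at eps w = Tight eps G"
      using f(5) g(5) by blast
    have nf: "\<not> Tight_at eps w \<subseteq> floors"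
      using G 3 w by (auto simp: low_faces_def)
    have "F \<subseteq> G \<longleftrightarrow> Tight eps G \<subseteq> Tight eps F"
      using F G 3 by (intro ineq_system.face_subset_iff_tight[OF sys]) (auto simp: low_faces_def)
    also have "\<dots> \<longleftrightarrow> merge_floors (Tight eps G) \<subseteq> merge_floors (Tight eps F)"
      using merge_floors_subset_iff[OF w(1) z(1) nf] w(2) z(2) by simp
    also have "\<dots> \<longleftrightarrow> flatten F \<subseteq> flatten G"
      unfolding f(3)[symmetric] g(3)[symmetric]
      by (rule ineq_system.face_subset_iff_tight[OF sys f(1,2) g(1,2), symmetric])
    finally show ?thesis .
  qed
qed

lemma bij_flatten: "bij_betw flatten (low_faces eps) (low_faces 0)"
  unfolding bij_betw_def
proof
  show "inj_on flatten (low_faces eps)"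
  proof (rule inj_onI)
    fix F G assume "F \<in> low_faces eps" "G \<in> low_faces eps" "flatten F = flatten G"
    then show "F = G"
      using flatten_subset_iff by (metis order_refl subset_antisym)
  qed
  show "flatten ` low_faces eps = low_faces 0"
  proof (intro equalityI subsetI)
    fix G assume "G \<in> flatten ` low_faces eps"
    then obtain F where F: "F \<in> low_faces eps" "G = flatten F"
      by blast
    show "G \<in> low_faces 0"
    proof (cases "F = {}")
      case True
      then show ?thesis
        using F by (simp add: flatten_def low_faces_def)
    next
      case False
      then show ?thesis
        using F flatten_nonempty(4) by blast
    qed
  next
    fix G assume G: "G \<in> low_faces 0"
    show "G \<in> flatten ` low_faces eps"
    proof (cases "G = {}")
      case True
      then have "{} \<in> low_faces eps" "G = flatten {}"
        by (auto simp: flatten_def low_faces_def)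
      then show ?thesis
        by blast
    next
      case False
      have GP: "G face_of Poly 0" "\<not> Tight 0 G \<subseteq> floors"
        using G False by (auto simp: low_faces_def)
      obtain z where z: "z \<in> G" "Tight_at 0 z = Tight 0 G"
        using ineq_system.face_cell(1)[OF sys GP(1) False] by blast
      have zP: "z \<in> Poly 0"
        using z GP face_of_imp_subset by blast
      then obtain w where w: "w \<in> Poly eps" "merge_floors (Tight_at eps w) = Tight_at 0 z"
        using bend_point by blast
      define F where "F = Cell eps (Tight_at eps w)"
      have F: "Tight eps F = Tight_at eps w" "F face_of Poly eps" "F \<noteq> {}"
        unfolding F_def using ineq_system.tight_cell[OF sys w(1)] by auto
      have "\<not> Tight eps F \<subseteq> floors"
        using GP(2) unfolding F(1) z(2)[symmetric] w(2)[symmetric] by (simp add: merge_floors_subset_floors)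
      then have "F \<in> low_faces eps"
        using F by (simp add: low_faces_def)
      moreover have "flatten F = G"
        using F w z ineq_system.face_cell(2)[OF sys GP(1) False] by (simp add: flatten_def)
      ultimately show ?thesis
        by blast
    qed
  qed
qed

lemma aff_dim_flatten:
  assumes "F \<in> low_faces eps"
  shows "aff_dim (flatten F) = aff_dim F"
proof (rule aff_dim_order_iso[OF _ _ _ _ low_faces_down low_faces_down bij_flatten flatten_subset_iff assms])
  show "polytope (Poly eps)" "polytope (Poly 0)"
    using eps(1) by (simp_all add: polytope_Poly)
qed (auto simp: low_faces_def faces_def)

text \<open>A nonempty face outside \<open>low_faces\<close> has at most the two floors tight, so
  its dimension is at least \<open>n - 1\<close>, which exceeds \<open>k\<close>.\<close>

lemma skeleton_low_faces:
  assumes k: "k + 2 \<le> n" and e: "e = 0 \<or> e = eps"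
  shows "skeleton k (Poly e) = {F \<in> low_faces e. aff_dim F \<le> int k}"
proof -
  have "F \<in> low_faces e" if F: "F face_of Poly e" "aff_dim F \<le> int k" for F
  proof (rule ccontr)
    assume "F \<notin> low_faces e"
    then have t: "F \<noteq> {}" "Tight e F \<subseteq> floors"
      using F by (auto simp: low_faces_def)
    have "card (Tight e F) \<le> card floors"
      using t(2) by (intro card_mono) auto
    then have "card (Tight e F) \<le> 2"
      by simp
    moreover have "int (n + 1) - int (card (Tight e F)) \<le> aff_dim F"
      using ineq_system.aff_dim_face_ge[OF sys F(1) t(1)] aff_dim_ambient by simp
    ultimately show False
      using F(2) k by linarith
  qed
  then show ?thesis
    by (auto simp: skeleton_def faces_def low_faces_def)
qed

lemma skeleton_iso:
  assumes k: "k + 2 \<le> n"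
  shows "inclusion_isomorphic (skeleton k (Poly eps)) (skeleton k (Poly 0))"
proof -
  have e: "skeleton k (Poly eps) = {F \<in> low_faces eps. aff_dim F \<le> int k}"
    "skeleton k (Poly 0) = {F \<in> low_faces 0. aff_dim F \<le> int k}"
    using skeleton_low_faces[OF k] by auto
  have "bij_betw flatten {F \<in> low_faces eps. aff_dim F \<le> int k} {F \<in> low_faces 0. aff_dim F \<le> int k}"
    unfolding bij_betw_def
  proof
    show "inj_on flatten {F \<in> low_faces eps. aff_dim F \<le> int k}"
      using bij_flatten by (auto simp: bij_betw_def intro: inj_on_subset)
    have im: "flatten ` low_faces eps = low_faces 0"
      using bij_flatten by (simp add: bij_betw_def)
    show "flatten ` {F \<in> low_faces eps. aff_dim F \<le> int k} = {F \<in> low_faces 0. aff_dim F \<le> int k}"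
    proof (intro equalityI subsetI)
      fix G assume "G \<in> flatten ` {F \<in> low_faces eps. aff_dim F \<le> int k}"
      then obtain F where "F \<in> low_faces eps" "aff_dim F \<le> int k" "G = flatten F"
        by blast
      then show "G \<in> {F \<in> low_faces 0. aff_dim F \<le> int k}"
        using im aff_dim_flatten[of F] by auto
    next
      fix G assume G: "G \<in> {F \<in> low_faces 0. aff_dim F \<le> int k}"
      then obtain F where "F \<in> low_faces eps" "G = flatten F"
        using im by blast
      then show "G \<in> flatten ` {F \<in> low_faces eps. aff_dim F \<le> int k}"
        using G aff_dim_flatten[of F] by simp
    qed
  qed
  then show ?thesis
    unfolding inclusion_isomorphic_def e using flatten_subset_iff by blast
qed

section \<open>Counting faces and nonsimple vertices\<close>

lemma small_index:
  assumes "i < n"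
  shows "real i * eps < 1"
proof -
  have "real i * eps < real n * eps"
    using assms eps(1) by (intro mult_strict_right_mono) auto
  then show ?thesis
    using eps(3) by linarith
qed

lemma floor_points:
  "\<exists>z\<in>Poly eps. Tight_at eps z = {FloorP}" "\<exists>z\<in>Poly eps. Tight_at eps z = {FloorQ}"
proof -
  \<comment> \<open>Up to scaling, \<open>x = 1\<close>, \<open>t = eps\<close>,
    \<open>y = 1\<close> gives a point with only \<open>FloorP\<close> tight; for
    \<open>FloorQ\<close> below \<open>y = -1\<close>, and \<open>x = 2\<close> makes up for the
    negative \<open>y\<close> in the walls.\<close>
  have "0 < (\<Sum>i<n. 1) + eps + (1::real)"
    using eps(1) by (intro add_pos_pos add_nonneg_pos) auto
  then obtain z \<kappa> where z: "z \<in> ambient" "\<kappa> > 0" "\<And>i. i < n \<Longrightarrow> z \<bullet> b i = \<kappa> * 1" "z \<bullet> b n = \<kappa> * eps"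
    "y_coord z = \<kappa> * 1"
    using point_exists[of "\<lambda>i. 1" eps 1] by blast
  have q: "0 < z \<bullet> b i + y_coord z - i * (z \<bullet> b n)" if "i < n" for i
  proof -
    have "z \<bullet> b i + y_coord z - i * (z \<bullet> b n) = \<kappa> * (2 - real i * eps)"
      using z(3)[OF that] z(4,5) by (simp add: algebra_simps)
    then show ?thesis
      using z(2) small_index[OF that] by simp
  qed
  have fl: "z \<bullet> b n - eps * y_coord z = 0" "0 < z \<bullet> b n + eps * y_coord z" "\<And>i. i < n \<Longrightarrow> 0 < z \<bullet> b i"
    using z eps(1) by (simp_all add: add_pos_pos)
  have "z \<in> Poly eps"
    unfolding mem_Poly using z(1) fl q by (simp add: less_imp_le)
  moreover have "j \<in> Tight_at eps z \<longleftrightarrow> j \<in> {FloorP}" for j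
    using q fl by (cases j) (fastforce simp: mem_Tight_at)+
  ultimately show "\<exists>z\<in>Poly eps. Tight_at eps z = {FloorP}"
    by blast
next
  have "(\<Sum>i<n. 2) = 2 * real n"
    by simp
  then have "0 < (\<Sum>i<n. 2) + eps + (- 1::real)"
    using eps(1) n by simp
  then obtain z \<kappa> where z: "z \<in> ambient" "\<kappa> > 0" "\<And>i. i < n \<Longrightarrow> z \<bullet> b i = \<kappa> * 2" "z \<bullet> b n = \<kappa> * eps"
    "y_coord z = \<kappa> * (- 1)"
    using point_exists[of "\<lambda>i. 2" eps "- 1"] by blast
  have q: "0 < z \<bullet> b i + y_coord z - i * (z \<bullet> b n)" if "i < n" for i
  proof -
    have "z \<bullet> b i + y_coord z - i * (z \<bullet> b n) = \<kappa> * (1 - real i * eps)"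
      using z(3)[OF that] z(4,5) by (simp add: algebra_simps)
    then show ?thesis
      using z(2) small_index[OF that] by simp
  qed
  have fl: "z \<bullet> b n + eps * y_coord z = 0" "0 < z \<bullet> b n - eps * y_coord z" "\<And>i. i < n \<Longrightarrow> 0 < z \<bullet> b i"
    using z eps(1) by (simp_all add: add_pos_pos)
  have "z \<in> Poly eps"
    unfolding mem_Poly using z(1) fl q by (simp add: less_imp_le)
  moreover have "j \<in> Tight_at eps z \<longleftrightarrow> j \<in> {FloorQ}" for j
    using q fl by (cases j) (fastforce simp: mem_Tight_at)+
  ultimately show "\<exists>z\<in>Poly eps. Tight_at eps z = {FloorQ}"
    by blast
qed

lemma face_with_tight:
  assumes "\<exists>z\<in>Poly e. Tight_at e z = I"
  shows "Cell e I face_of Poly e" "Cell e I \<noteq> {}" "Tight e (Cell e I) = I"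
  using assms ineq_system.tight_cell[OF sys] by blast+

text \<open>Beyond \<open>low_faces\<close>, the flat polytope has at most two faces, as its floors
  are tight together: itself and the floor. The bent one has at least three: itself and two
  floors.\<close>

lemma card_faces_less: "card (faces (Poly 0)) < card (faces (Poly eps))"
proof -
  have fin: "finite (faces (Poly e))" if "0 \<le> e" for e
    using finite_polytope_faces[OF polytope_Poly[OF that]] by (simp add: faces_def)
  have finl: "finite (low_faces e)" if "0 \<le> e" for e
    using fin[OF that] by (rule rev_finite_subset) (auto simp: low_faces_def faces_def)
  let ?G = "{Cell 0 {}, Cell 0 floors}"
  have "faces (Poly 0) \<subseteq> low_faces 0 \<union> ?G"
  proof
    fix F assume "F \<in> faces (Poly 0)"
    then have F: "F face_of Poly 0"
      by (simp add: faces_def)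
    show "F \<in> low_faces 0 \<union> ?G"
    proof (cases "F = {} \<or> \<not> Tight 0 F \<subseteq> floors")
      case True
      then show ?thesis
        using F by (auto simp: low_faces_def)
    next
      case False
      then obtain z where z: "z \<in> F" "Tight_at 0 z = Tight 0 F"
        using ineq_system.face_cell(1)[OF sys F] by blast
      have "FloorP \<in> Tight 0 F \<longleftrightarrow> FloorQ \<in> Tight 0 F"
        unfolding z(2)[symmetric] by (simp add: mem_Tight_at)
      then have "Tight 0 F = {} \<or> Tight 0 F = floors"
        using False by blast
      then show ?thesis
        using ineq_system.face_cell(2)[OF sys F] False by auto
    qed
  qed
  then have "card (faces (Poly 0)) \<le> card (low_faces 0 \<union> ?G)"
    using finl by (intro card_mono) auto
  also have "\<dots> \<le> card (low_faces 0) + card ?G"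
    by (rule card_Un_le)
  also have "card ?G \<le> 2"
    using card_insert_le_m1[of 2 "{Cell 0 floors}" "Cell 0 {}"] by simp
  also have "card (low_faces 0) = card (low_faces eps)"
    using bij_betw_same_card[OF bij_flatten] by simp
  finally have le: "card (faces (Poly 0)) \<le> card (low_faces eps) + 2"
    by simp
  let ?E = "{Cell eps {}, Cell eps {FloorP}, Cell eps {FloorQ}}"
  have ip: "\<exists>z\<in>Poly eps. Tight_at eps z = {}"
    using interior_point by blast
  note c = face_with_tight[OF ip] face_with_tight[OF floor_points(1)] face_with_tight[OF floor_points(2)]
  have "Cell eps {} \<noteq> Cell eps {FloorP}" "Cell eps {} \<noteq> Cell eps {FloorQ}" "Cell eps {FloorP} \<noteq> Cell eps {FloorQ}"
    using c(3,6,9) by (metis insert_not_empty singleton_insert_inj_eq' wall.distinct)+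
  then have "card ?E = 3"
    by simp
  moreover have "?E \<inter> low_faces eps = {}"
    using c by (auto simp: low_faces_def)
  moreover have "?E \<union> low_faces eps \<subseteq> faces (Poly eps)"
    using c by (auto simp: low_faces_def faces_def)
  ultimately have "3 + card (low_faces eps) \<le> card (faces (Poly eps))"
    using finl[of eps] fin[of eps] eps(1) card_mono[of "faces (Poly eps)" "?E \<union> low_faces eps"]
      card_Un_disjoint[of ?E "low_faces eps"] by simp
  then show ?thesis
    using le by simp
qed

lemma not_combinatorially_isomorphic: "\<not> combinatorially_isomorphic (Poly eps) (Poly 0)"
  using card_faces_less bij_betw_same_card
  unfolding combinatorially_isomorphic_def inclusion_isomorphic_def by (metis less_irrefl)

text \<open>Here \<open>t > 0\<close>. On a floor, only one kind of wall can be tight. Off the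
  floors, \<open>WallP i\<close> and \<open>WallQ i\<close> are both tight only if
  \<open>y = i * t\<close>, which happens for at most one \<open>i\<close> because the slopes
  differ.\<close>

lemma card_Tight_at_le:
  assumes z: "z \<in> Poly eps" and ne: "z \<bullet> b n \<noteq> 0 \<or> y_coord z \<noteq> 0"
  shows "card (Tight_at eps z) \<le> n + 1"
proof -
  define y where "y = y_coord z"
  define t where "t = z \<bullet> b n"
  have zP: "\<And>i. i < n \<Longrightarrow> 0 \<le> z \<bullet> b i" "\<And>i. i < n \<Longrightarrow> 0 \<le> z \<bullet> b i + y - i * t"
    "0 \<le> t - eps * y" "0 \<le> t + eps * y"
    using z by (auto simp: mem_Poly y_def t_def)
  have "t \<noteq> 0"
  proof
    assume "t = 0"
    then have "eps * y = 0"
      using zP by linarith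
    then show False
      using eps(1) ne \<open>t = 0\<close> by (simp add: y_def t_def)
  qed
  then have t: "0 < t"
    using zP by linarith
  let ?SP = "{i. WallP i \<in> Tight_at eps z}" and ?SQ = "{i. WallQ i \<in> Tight_at eps z}"
  have sub: "?SP \<subseteq> {..<n}" "?SQ \<subseteq> {..<n}"
    by (auto simp: mem_Tight_at)
  then have finS: "finite ?SP" "finite ?SQ" "card ?SP \<le> n" "card ?SQ \<le> n"
    using finite_subset card_mono[of "{..<n}"] by fastforce+
  have both: "y = i * t" if "i \<in> ?SP" "i \<in> ?SQ" for i
    using that by (simp add: mem_Tight_at y_def t_def)
  have floor: "\<not> (FloorP \<in> Tight_at eps z \<and> FloorQ \<in> Tight_at eps z)"
    unfolding mem_Tight_at y_def[symmetric] t_def[symmetric] using t by linarith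
  consider "FloorP \<in> Tight_at eps z" | "FloorQ \<in> Tight_at eps z" 
    | "FloorP \<notin> Tight_at eps z" "FloorQ \<notin> Tight_at eps z"
    by blast
  then show ?thesis
  proof cases
    case 1
    then have "Tight_at eps z \<subseteq> insert FloorP (WallP ` ?SP)"
      using floor WallQ_loose[OF z 1] by (intro wall_subsetI) auto
    then have "card (Tight_at eps z) \<le> card (insert FloorP (WallP ` ?SP))"
      using finS by (intro card_mono) auto
    also have "\<dots> \<le> Suc (card (WallP ` ?SP))"
      by (rule card_insert_le_m1) auto
    also have "card (WallP ` ?SP) \<le> card ?SP"
      using finS by (intro card_image_le)
    finally show ?thesis
      using finS by simp
  next
    case 2
    then have "Tight_at eps z \<subseteq> insert FloorQ (WallQ ` ?SQ)"
      using floor WallP_loose[OF z 2] by (intro wall_subsetI) auto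
    then have "card (Tight_at eps z) \<le> card (insert FloorQ (WallQ ` ?SQ))"
      using finS by (intro card_mono) auto
    also have "\<dots> \<le> Suc (card (WallQ ` ?SQ))"
      by (rule card_insert_le_m1) auto
    also have "card (WallQ ` ?SQ) \<le> card ?SQ"
      using finS by (intro card_image_le)
    finally show ?thesis
      using finS by simp
  next
    case 3
    then have "Tight_at eps z \<subseteq> WallP ` ?SP \<union> WallQ ` ?SQ"
      by (intro wall_subsetI) auto
    then have "card (Tight_at eps z) \<le> card (WallP ` ?SP \<union> WallQ ` ?SQ)"
      using finS by (intro card_mono) auto
    also have "\<dots> \<le> card (WallP ` ?SP) + card (WallQ ` ?SQ)"
      by (rule card_Un_le)
    also have "\<dots> \<le> card ?SP + card ?SQ"
      using finS by (intro add_mono card_image_le)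
    also have "\<dots> = card (?SP \<union> ?SQ) + card (?SP \<inter> ?SQ)"
      using finS by (intro card_Un_Int)
    also have "card (?SP \<union> ?SQ) \<le> card {..<n}"
      using sub by (intro card_mono) auto
    also have "card (?SP \<inter> ?SQ) \<le> 1"
    proof -
      have "i = k" if "i \<in> ?SP \<inter> ?SQ" "k \<in> ?SP \<inter> ?SQ" for i k
        using both[of i] both[of k] that t by auto
      then show ?thesis
        using finS by (simp add: card_le_Suc0_iff_eq)
    qed
    finally show ?thesis
      by simp
  qed
qed

text \<open>A nonsimple vertex has \<open>t = y = 0\<close>, so some coordinate \<open>x j\<close>
  is nonzero. Every inequality tight at the vertex is then tight at \<open>b j\<close>, and the face
  cut out by these inequalities is the vertex alone.\<close>

lemma nonsimple_vertices_Poly: "nonsimple_vertices (n + 1) (Poly eps) \<subseteq> b ` {..<n}"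
proof
  fix z assume "z \<in> nonsimple_vertices (n + 1) (Poly eps)"
  then have z: "z \<in> verts (Poly eps)" "card {e. e edge_of Poly eps \<and> z \<in> e} > n + 1"
    by (auto simp: nonsimple_vertices_def verts_def)
  have zP: "z \<in> Poly eps"
    using z verts_subset by blast
  have "\<not> card (Tight_at eps z) \<le> n + 1"
    using ineq_system.card_edges_le[OF sys bounded_Poly z(1) aff_dim_ambient] z(2) eps(1) by fastforce
  then have 0: "z \<bullet> b n = 0" "y_coord z = 0"
    using card_Tight_at_le[OF zP] by blast+
  have "(\<Sum>k<n. z \<bullet> b k) = 1"
    using sum_coords[of z] 0 by simp
  then obtain j where j: "j < n" "z \<bullet> b j \<noteq> 0"
    by (metis lessThan_iff sum.neutral zero_neq_one)
  have bj: "b j \<bullet> b i = (if i = j then 1 else 0)" if "i \<le> n" for i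
    using inner_b[of j i] that j by auto
  have yj: "y_coord (b j) = 0"
  proof -
    have "(\<Sum>k<n. b j \<bullet> b k) = (\<Sum>k<n. if k = j then 1 else 0)"
      using bj by (intro sum.cong) auto
    then show ?thesis
      unfolding y_coord_eq using j bj[of n] by simp
  qed
  have "b j \<in> ambient"
    using j by (auto simp: ambient_def intro: span_base)
  then have "b j \<in> Poly eps"
    unfolding mem_Poly yj using bj j by simp
  moreover have "k \<in> Tight_at eps (b j)" if "k \<in> Tight_at eps z" for k
    using that j bj yj 0 by (cases k) (auto simp: mem_Tight_at)
  ultimately have "b j \<in> Cell eps (Tight_at eps z)"
    by (auto simp: ineq_system.cell_def[OF sys] ineq_system.tight_at_def[OF sys])
  moreover have "Cell eps (Tight_at eps z) \<subseteq> {z}"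
    using z(1) by (intro ineq_system.cell_subset_face[OF sys]) (auto simp: verts_def face_of_singleton)
  ultimately show "z \<in> b ` {..<n}"
    using j by auto
qed

lemma bent_pair:
  "\<exists>(P :: 'a set) (Q :: 'a set). d_polytope (n + 1) P \<and> d_polytope (n + 1) Q \<and> card (nonsimple_vertices (n + 1) P) \<le> n \<and>
    (\<forall>k. k + 2 \<le> n \<longrightarrow> inclusion_isomorphic (skeleton k P) (skeleton k Q)) \<and> \<not> combinatorially_isomorphic P Q"
proof -
  have "d_polytope (n + 1) (Poly eps)" "d_polytope (n + 1) (Poly 0)"
    using polytope_Poly aff_dim_Poly eps(1) by (simp_all add: d_polytope_def)
  moreover have "card (nonsimple_vertices (n + 1) (Poly eps)) \<le> n"
  proof -
    have "card (nonsimple_vertices (n + 1) (Poly eps)) \<le> card (b ` {..<n})"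
      using nonsimple_vertices_Poly by (intro card_mono) auto
    also have "\<dots> \<le> card {..<n}"
      by (rule card_image_le) simp
    finally show ?thesis
      by simp
  qed
  ultimately show ?thesis
    using skeleton_iso not_combinatorially_isomorphic by blast
qed

end

theorem bent_polytopes:
  assumes d: "4 \<le> d" "d \<le> DIM('a::euclidean_space)"
  shows "\<exists>(P :: 'a set) (Q :: 'a set). d_polytope d P \<and> d_polytope d Q \<and> card (nonsimple_vertices d P) \<le> d - 1 \<and>
    (\<forall>k\<le>d - 3. inclusion_isomorphic (skeleton k P) (skeleton k Q)) \<and> \<not> combinatorially_isomorphic P Q"
proof -
  define n where "n = d - 1"
  have nd: "3 \<le> n" "d = n + 1"
    using d by (auto simp: n_def)
  obtain B :: "'a set" where B: "B \<subseteq> Basis" "card B = d" "finite B"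
    using obtain_subset_with_card_n[OF d(2)] by (metis finite_Basis finite_subset)
  then obtain b where b: "bij_betw b {0..<d} B"
    using ex_bij_betw_nat_finite by blast
  have "{0..<d} = {..n}"
    using nd by auto
  then interpret bent_system n b
    using nd b B by unfold_locales (auto simp: bij_betw_def)
  have "k + 2 \<le> n" if "k \<le> d - 3" for k
    using that nd by linarith
  then show ?thesis
    using bent_pair unfolding nd(2) by (metis add_diff_cancel_right')
qed

section \<open>The reconstruction thresholds\<close>

lemma all_reconstructible_le:
  assumes "4 \<le> d" "d \<le> DIM('a::euclidean_space)" "k \<le> d - 3" and j: "all_reconstructible TYPE('a) k d j"
  shows "j \<le> d - 2"
proof (rule ccontr)
  assume "\<not> j \<le> d - 2"
  then have "d - 1 \<le> j"
    by simp
  moreover obtain P Q :: "'a set" where "d_polytope d P" "d_polytope d Q" "card (nonsimple_vertices d P) \<le> d - 1"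
    "inclusion_isomorphic (skeleton k P) (skeleton k Q)" "\<not> combinatorially_isomorphic P Q"
    using bent_polytopes[OF assms(1,2)] assms(3) by blast
  ultimately show False
    using j unfolding all_reconstructible_def reconstructible_def by (meson le_trans)
qed

text \<open>The upper bound \<open>N\<close> is what makes \<open>GREATEST\<close> an actual
  maximum.\<close>

lemma beta_bounds:
  assumes m: "all_reconstructible T k d m" and N: "\<And>j. all_reconstructible T k d j \<Longrightarrow> j \<le> N"
  shows "beta_exists T k d" "m \<le> beta T k d" "beta T k d \<le> N"
proof -
  have b: "\<forall>j. all_reconstructible T k d j \<longrightarrow> j \<le> N"
    using N by blast
  have g: "all_reconstructible T k d (beta T k d)"
    unfolding beta_def using GreatestI_nat[of "all_reconstructible T k d", OF m] b by blast
  have le: "j \<le> beta T k d" if "all_reconstructible T k d j" for j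
    unfolding beta_def using Greatest_le_nat[of "all_reconstructible T k d", OF that] b by blast
  show "beta_exists T k d"
    unfolding beta_exists_def using g le by blast
  show "m \<le> beta T k d" "beta T k d \<le> N"
    using g le m N by blast+
qed

lemma all_reconstructible_graph: "4 \<le> d \<Longrightarrow> 1 \<le> k \<Longrightarrow> all_reconstructible T k d 2"
  unfolding all_reconstructible_def using reconstructible_from_graph by blast

lemma all_reconstructible_2_skeleton: "2 \<le> d \<Longrightarrow> 2 \<le> k \<Longrightarrow> all_reconstructible T k d (d - 2)"
  unfolding all_reconstructible_def using reconstructible_from_2_skeleton by blast

lemma beta_graph_bounds:
  assumes "4 \<le> d" "d \<le> DIM('a::euclidean_space)" "1 \<le> k" "k \<le> d - 3"
  shows "beta_exists TYPE('a) k d" "2 \<le> beta TYPE('a) k d" "beta TYPE('a) k d \<le> d - 2"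
  by (rule beta_bounds[OF all_reconstructible_graph[OF assms(1,3)] all_reconstructible_le[OF assms(1,2,4)]];
    assumption)+

theorem mainTheorem1:
  fixes d :: nat
  assumes "d \<ge> 4" and "d \<le> DIM('a::euclidean_space)"
  shows "(\<forall>k. 1 \<le> k \<and> k \<le> d - 3 \<longrightarrow> beta_exists TYPE('a) k d)
    \<and> (\<forall>k. 2 \<le> k \<and> k \<le> d - 3 \<longrightarrow> beta TYPE('a) k d = d - 2)
    \<and> 2 \<le> beta TYPE('a) 1 d \<and> beta TYPE('a) 1 d \<le> d - 2
    \<and> beta TYPE('a) 1 4 = 2"
proof (intro conjI allI impI)
  show "beta_exists TYPE('a) k d" if "1 \<le> k \<and> k \<le> d - 3" for k
    using that assms by (intro beta_graph_bounds(1)) auto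
  show "beta TYPE('a) k d = d - 2" if k: "2 \<le> k \<and> k \<le> d - 3" for k
  proof -
    have "all_reconstructible TYPE('a) k d (d - 2)"
      using assms k by (intro all_reconstructible_2_skeleton) auto
    then have "d - 2 \<le> beta TYPE('a) k d" "beta TYPE('a) k d \<le> d - 2"
      by (rule beta_bounds(2,3); use assms k all_reconstructible_le in blast)+
    then show ?thesis
      by simp
  qed
  \<comment> \<open>Stated for all dimensions \<open>c\<close> up to \<open>d\<close>, since the
    last claim concerns dimension 4 in the same ambient space; there both bounds are 2.\<close>
  have edge: "2 \<le> beta TYPE('a) 1 c \<and> beta TYPE('a) 1 c \<le> c - 2" if "4 \<le> c" "c \<le> d" for c
    using that assms(2) by (intro conjI beta_graph_bounds(2,3)) auto
  show "2 \<le> beta TYPE('a) 1 d" "beta TYPE('a) 1 d \<le> d - 2"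
    using edge[of d] assms(1) by simp_all
  show "beta TYPE('a) 1 4 = 2"
    using edge[of 4] assms(1) by simp
qed

end
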